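(* For any point $p\in\mathcal{S}_n\subseteq\mathbb{P}(\Delta)$ we have $$\dim T_p^s\mathcal{S}_n=\sum_{k=1}^s\binom{n}{2k}$$ for $0\leq s\leq\left\lfloor\frac{n}{2}\right\rfloor-1$, while $T_p^s\mathcal{S}_n=\mathbb{P}(\Delta)=\mathbb{P}^{2^{n-1}-1}$ for $s\geq\left\lfloor\frac{n}{2}\right\rfloor$.
   Context: Everything is over $\mathbb{C}$. $V$ is a complex vector space of dimension $2n$ with a non-degenerate quadratic form $Q$. The variety of $n$-dimensional $Q$-isotropic subspaces of $V$ has two isomorphic connected components; the Spinor variety $\mathcal{S}_n$ is either one of them, of dimension $\frac{n(n-1)}{2}$. The Spinor embedding $\mathcal{S}_n\subset\mathbb{P}(\Delta)=\mathbb{P}^{2^{n-1}-1}$ is the minimal homogeneous embedding, in the projectivized half-spin representation; in the affine chart where the points of $\mathcal{S}_n$ are represented by $n\times n$ skew-symmetric matrices $B$ it is given by $B\mapsto(1,\mathrm{pf}_{2j}(B))$, all the $2j\times 2j$ principal Pfaffians of $B$, for $1\leq j\leq\lfloor n/2\rfloor$. For an irreducible variety $X\subset\mathbb{P}^N$ of dimension $m$, a smooth point $p\in X$, and a local parametrization $\phi:\mathcal{U}\subseteq\mathbb{C}^m\to\mathbb{C}^N$ of $X$ near $p$ with $\phi(0)=p$, the $s$-osculating space $T_p^sX$ is the projective closure in $\mathbb{P}^N$ of the affine subspace of $\mathbb{C}^N$ through $p$ whose direction is spanned by all partial derivatives of $\phi$ at $0$ of order at most $s$. Dimensions are projective dimensions.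 *)

theory Defs
  imports "HOL-Analysis.Analysis"
begin

text \<open>
  \<open>vec.span\<close>, \<open>vec.dim\<close>, \<open>vec.subspace\<close> and \<open>linear_vec\<close> below refer to the complex vector space
  structure of \<open>complex ^ 'a\<close> (the unqualified library versions are over the reals).
\<close>

abbreviation linear_vec :: "(complex ^ 'a \<Rightarrow> complex ^ 'b) \<Rightarrow> bool"
  where "linear_vec \<equiv> Vector_Spaces.linear (*s) (*s)"

abbreviation linear_form :: "(complex ^ 'a \<Rightarrow> complex) \<Rightarrow> bool"
  where "linear_form \<equiv> Vector_Spaces.linear (*s) (*)"

text \<open>
  \<open>tuples m\<close> models \<open>m\<close>-tuples, as sequences vanishing from \<open>m\<close> on, with the topology induced by
  the product topology. In particular \<open>tuples m :: (nat \<Rightarrow> complex) set\<close> is \<open>\<complex>\<^sup>m\<close>; unlike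
  \<open>complex ^ 'm\<close> this includes \<open>m = 0\<close>.
\<close>

definition tuples :: "nat \<Rightarrow> (nat \<Rightarrow> 'a::zero) set"
  where "tuples m = {t. \<forall>i\<ge>m. t i = 0}"


subsection \<open>Quadratic forms and isotropic subspaces\<close>

definition polar :: "(complex ^ 'v \<Rightarrow> complex) \<Rightarrow> complex ^ 'v \<Rightarrow> complex ^ 'v \<Rightarrow> complex"
  where "polar Q u v = Q (u + v) - Q u - Q v"

definition quadratic_form :: "(complex ^ 'v \<Rightarrow> complex) \<Rightarrow> bool"
  where "quadratic_form Q \<longleftrightarrow>
    (\<forall>a v. Q (a *s v) = a\<^sup>2 * Q v) \<and> (\<forall>u. linear_form (polar Q u))"

definition nondegenerate :: "(complex ^ 'v \<Rightarrow> complex) \<Rightarrow> bool"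
  where "nondegenerate Q \<longleftrightarrow> (\<forall>u. (\<forall>v. polar Q u v = 0) \<longrightarrow> u = 0)"

definition isotropic_subspaces :: "(complex ^ 'v \<Rightarrow> complex) \<Rightarrow> nat \<Rightarrow> (complex ^ 'v) set set"
  where "isotropic_subspaces Q n =
    {W. vec.subspace W \<and> vec.dim W = n \<and> (\<forall>w\<in>W. Q w = 0)}"

definition isotropic_frames :: "(complex ^ 'v \<Rightarrow> complex) \<Rightarrow> nat \<Rightarrow> (nat \<Rightarrow> complex ^ 'v) set"
  where "isotropic_frames Q n =
    {b \<in> tuples n. vec.span (b ` {..<n}) \<in> isotropic_subspaces Q n}"

text \<open>
  The space of \<open>n\<close>-dimensional isotropic subspaces carries the quotient topology of the space of
  their bases, i.e. the classical topology induced from the Grassmannian. For a complex variety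
  its connected components are the same as those of the Zariski topology.
\<close>

definition isotropic_grassmannian ::
    "(complex ^ 'v \<Rightarrow> complex) \<Rightarrow> nat \<Rightarrow> (complex ^ 'v) set topology"
  where "isotropic_grassmannian Q n = topology (\<lambda>\<U>. \<U> \<subseteq> isotropic_subspaces Q n \<and>
    openin (top_of_set (isotropic_frames Q n))
      {b \<in> isotropic_frames Q n. vec.span (b ` {..<n}) \<in> \<U>})"

lemma openin_isotropic_grassmannian:
  "openin (isotropic_grassmannian Q n) \<U> \<longleftrightarrow> \<U> \<subseteq> isotropic_subspaces Q n \<and>
    openin (top_of_set (isotropic_frames Q n))
      {b \<in> isotropic_frames Q n. vec.span (b ` {..<n}) \<in> \<U>}"
proof -
  let ?F = "isotropic_frames Q n"
  let ?P = "\<lambda>\<U>. {b \<in> ?F. vec.span (b ` {..<n}) \<in> \<U>}"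
  have "istopology (\<lambda>\<U>. \<U> \<subseteq> isotropic_subspaces Q n \<and> openin (top_of_set ?F) (?P \<U>))"
    unfolding istopology_def
  proof (intro conjI allI impI)
    fix \<U> \<V>
    assume *: "\<U> \<subseteq> isotropic_subspaces Q n \<and> openin (top_of_set ?F) (?P \<U>)"
      "\<V> \<subseteq> isotropic_subspaces Q n \<and> openin (top_of_set ?F) (?P \<V>)"
    then show "\<U> \<inter> \<V> \<subseteq> isotropic_subspaces Q n"
      by blast
    have "?P (\<U> \<inter> \<V>) = ?P \<U> \<inter> ?P \<V>"
      by blast
    then show "openin (top_of_set ?F) (?P (\<U> \<inter> \<V>))"
      using * by (simp only: openin_Int)
  next
    fix \<K>
    assume *: "\<forall>\<U>\<in>\<K>. \<U> \<subseteq> isotropic_subspaces Q n \<and> openin (top_of_set ?F) (?P \<U>)"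
    then show "\<Union>\<K> \<subseteq> isotropic_subspaces Q n"
      by blast
    have "?P (\<Union>\<K>) = \<Union>(?P ` \<K>)"
      by blast
    then show "openin (top_of_set ?F) (?P (\<Union>\<K>))"
      using * by (simp only:) (rule openin_Union, blast)
  qed
  then show ?thesis
    unfolding isotropic_grassmannian_def by (simp add: topology_inverse')
qed


subsection \<open>Spin and half-spin representations\<close>

definition submodule :: "(complex ^ 's \<Rightarrow> complex ^ 's) set \<Rightarrow> (complex ^ 's) set \<Rightarrow> bool"
  where "submodule F M \<longleftrightarrow> vec.subspace M \<and> (\<forall>f\<in>F. f ` M \<subseteq> M)"

definition irreducible_module :: "(complex ^ 's \<Rightarrow> complex ^ 's) set \<Rightarrow> (complex ^ 's) set \<Rightarrow> bool"
  where "irreducible_module F M \<longleftrightarrow> submodule F M \<and> M \<noteq> {0} \<and>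
    (\<forall>N. submodule F N \<and> N \<subseteq> M \<longrightarrow> N = {0} \<or> N = M)"

text \<open>
  The action of \<open>V\<close> on an irreducible module of the Clifford algebra of \<open>(V, Q)\<close>. For a
  non-degenerate \<open>Q\<close> and \<open>dim V = 2 n\<close> such a module is unique up to isomorphism.
\<close>

definition spin_representation ::
    "(complex ^ 'v \<Rightarrow> complex) \<Rightarrow> (complex ^ 'v \<Rightarrow> complex ^ 's \<Rightarrow> complex ^ 's) \<Rightarrow> bool"
  where "spin_representation Q c \<longleftrightarrow>
    (\<forall>v. linear_vec (c v)) \<and> (\<forall>x. linear_vec (\<lambda>v. c v x)) \<and>
    (\<forall>v x. c v (c v x) = Q v *s x) \<and>
    irreducible_module (range c) UNIV"

text \<open>
  The products \<open>c u \<circ> c v\<close> generate the image of the even Clifford algebra, which is the linear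
  span of the image of the spin group, so this is irreducibility under the spin group.
\<close>

definition half_spin ::
    "(complex ^ 'v \<Rightarrow> complex ^ 's \<Rightarrow> complex ^ 's) \<Rightarrow> (complex ^ 's) set \<Rightarrow> bool"
  where "half_spin c \<Delta> \<longleftrightarrow> irreducible_module {c u \<circ> c v | u v. True} \<Delta>"


subsection \<open>Projective spaces and the spinor embedding\<close>

text \<open>Points of a projective space are one-dimensional linear subspaces.\<close>

definition projectivization :: "(complex ^ 's) set \<Rightarrow> (complex ^ 's) set set"
  where "projectivization M = {L. vec.subspace L \<and> vec.dim L = 1 \<and> L \<subseteq> M}"

definition proj_dim :: "(complex ^ 's) set set \<Rightarrow> int"
  where "proj_dim P = int (vec.dim (\<Union>P)) - 1"

text \<open>
  The spinor embedding sends a maximal isotropic subspace \<open>W\<close> to the line of spinors annihilated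
  by \<open>W\<close> (its pure spinors, the highest weight vectors of the half-spin representation for the
  stabilizers of \<open>W\<close>). If \<open>V = E \<oplus> F\<close> with \<open>E\<close>, \<open>F\<close> isotropic, \<open>F\<close> annihilates \<open>\<phi>\<close>, and
  \<open>e\<^sub>1, \<dots>, e\<^sub>n\<close> is a basis of \<open>E\<close>, then the subspaces transverse to \<open>E\<close> are graphs of
  skew-symmetric matrices \<open>B\<close>, with pure spinor (for suitable signs) the sum of
  \<open>pf B\<^sub>I\<close> times \<open>e\<^sub>I \<phi>\<close> over the subsets \<open>I\<close> of even cardinality.
\<close>

definition spinor_embedding ::
    "(complex ^ 'v \<Rightarrow> complex ^ 's \<Rightarrow> complex ^ 's) \<Rightarrow> (complex ^ 'v) set \<Rightarrow> (complex ^ 's) set"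
  where "spinor_embedding c W = {x. \<forall>w\<in>W. c w x = 0}"

definition spinor_variety ::
    "(complex ^ 'v \<Rightarrow> complex ^ 's \<Rightarrow> complex ^ 's) \<Rightarrow> (complex ^ 'v) set set \<Rightarrow> (complex ^ 's) set set"
  where "spinor_variety c C = spinor_embedding c ` C"


subsection \<open>Local parametrizations and osculating spaces\<close>

definition partial_deriv ::
    "nat \<Rightarrow> ((nat \<Rightarrow> complex) \<Rightarrow> complex ^ 's) \<Rightarrow> (nat \<Rightarrow> complex) \<Rightarrow> complex ^ 's"
  where "partial_deriv i f t = (\<chi> k. deriv (\<lambda>z. f (t(i := z)) $ k) (t i))"

definition holomorphic_several ::
    "nat \<Rightarrow> (nat \<Rightarrow> complex) set \<Rightarrow> ((nat \<Rightarrow> complex) \<Rightarrow> complex ^ 's) \<Rightarrow> bool"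
  where "holomorphic_several m U f \<longleftrightarrow> continuous_on U f \<and>
    (\<forall>t\<in>U. \<forall>i<m. \<forall>k. (\<lambda>z. f (t(i := z)) $ k) field_differentiable (at (t i)))"

text \<open>
  The linear form \<open>l\<close> fixes the affine chart: a line not contained in its kernel is represented
  by its unique vector \<open>x\<close> with \<open>l x = 1\<close>.
\<close>

definition affine_part :: "(complex ^ 's \<Rightarrow> complex) \<Rightarrow> (complex ^ 's) set set \<Rightarrow> (complex ^ 's) set"
  where "affine_part l X = {x. l x = 1 \<and> vec.span {x} \<in> X}"

definition local_parametrization ::
    "nat \<Rightarrow> (complex ^ 's) set set \<Rightarrow> (complex ^ 's) set \<Rightarrow> (complex ^ 's \<Rightarrow> complex) \<Rightarrow>
     (nat \<Rightarrow> complex) set \<Rightarrow> ((nat \<Rightarrow> complex) \<Rightarrow> complex ^ 's) \<Rightarrow> bool"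
  where "local_parametrization m X p l U \<phi> \<longleftrightarrow>
    linear_form l \<and>
    openin (top_of_set (tuples m)) U \<and> (\<lambda>_. 0) \<in> U \<and>
    vec.span {\<phi> (\<lambda>_. 0)} = p \<and>
    holomorphic_several m U \<phi> \<and>
    openin (top_of_set (affine_part l X)) (\<phi> ` U) \<and>
    (\<exists>\<psi>. homeomorphism U (\<phi> ` U) \<phi> \<psi>) \<and>
    (\<forall>t\<in>U. \<forall>a. (\<Sum>i<m. a i *s partial_deriv i \<phi> t) = 0 \<longrightarrow> (\<forall>i<m. a i = 0))"

text \<open>
  Only derivatives of positive order span the direction; the point itself is the summand
  \<open>\<phi> (\<lambda>_. 0)\<close>.
\<close>

definition affine_osculating_space ::
    "nat \<Rightarrow> nat \<Rightarrow> ((nat \<Rightarrow> complex) \<Rightarrow> complex ^ 's) \<Rightarrow> (complex ^ 's) set"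
  where "affine_osculating_space m s \<phi> = {\<phi> (\<lambda>_. 0) + d | d.
    d \<in> vec.span {foldr partial_deriv is \<phi> (\<lambda>_. 0) | is.
                    set is \<subseteq> {..<m} \<and> 1 \<le> length is \<and> length is \<le> s}}"

text \<open>
  The projective closure of an affine subspace of a chart \<open>{x. l x = 1}\<close> is the projectivization
  of its linear span.
\<close>

definition osculating_space ::
    "nat \<Rightarrow> nat \<Rightarrow> ((nat \<Rightarrow> complex) \<Rightarrow> complex ^ 's) \<Rightarrow> (complex ^ 's) set set"
  where "osculating_space m s \<phi> = projectivization (vec.span (affine_osculating_space m s \<phi>))"

end

theory Submission
  imports Defs "HOL-Complex_Analysis.Cauchy_Integral_Formula"
begin

text \<open>
  Let \<open>p\<close> be the line of pure spinors \<open>\<phi>\<^sub>0\<close> of an isotropic subspace \<open>W\<close>, let \<open>f\<^sub>i\<close> be a basis of \<open>W\<close>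
  and \<open>e\<^sub>i\<close> the dual basis of an isotropic complement. Then the half-spin module is spanned by the
  \<open>e\<^sub>I \<phi>\<^sub>0\<close> with \<open>I\<close> even. Near \<open>p\<close> the pure spinors are multiples of \<open>exp (\<Sum>k. t\<^sub>k E\<^sub>k) \<phi>\<^sub>0\<close>, where \<open>E\<^sub>k\<close>
  runs over the products \<open>e\<^sub>i e\<^sub>j\<close> with \<open>i < j\<close>. Since the \<open>E\<^sub>k\<close> commute, any
  parametrization \<open>\<phi>\<close> solves a linear system \<open>\<partial>\<^sub>i \<phi> = u\<^sub>i \<phi> + (\<Sum>k. H\<^sub>i\<^sub>k E\<^sub>k \<phi>)\<close>, with \<open>H\<close> invertible at \<open>0\<close>
  because \<open>\<phi>\<close> is an immersion into an affine chart. By induction on the order, the derivatives of order at most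
  \<open>s\<close> span the same space as the products of at most \<open>s\<close> operators \<open>E\<^sub>k\<close> applied to \<open>\<phi>\<^sub>0\<close>, i.e. as the
  \<open>e\<^sub>I \<phi>\<^sub>0\<close> with \<open>I\<close> even of cardinality at most \<open>2 s\<close>.
\<close>


subsection \<open>Separately holomorphic functions on polydiscs\<close>

text \<open>The claim concerns every local parametrization, so the coefficients \<open>u\<close> and
  \<open>H\<close> are just some holomorphic functions, and they get differentiated again at each
  order. This forces a class of functions that is closed under partial derivatives. Here
  \<open>H\<close> is the Jacobian of the affine coordinates \<open>coord k\<close> divided by
  \<kappa>, while \<open>u\<close> is the logarithmic derivative of the factor \<kappa> by which
  \<phi> differs from a normalized pure spinor.

  Invertibility of \<open>H\<close> at the origin: if \<open>H\<close> kills a weight vector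
  \<open>p\<close>, the partial derivatives weighted by \<open>p\<close> add up to a multiple of
  \<phi> at the origin. The form \<open>l\<close> is constantly 1 along \<phi>, so it kills all
  partial derivatives but not \<phi> itself. The multiple is therefore zero, and immersivity gives
  \<open>p = 0\<close>.

  Which half-spin module and which family of isotropic subspaces are given need not be decided:
  parity is counted from the pure spinor of the chosen point.\<close>

definition polydisc :: "nat \<Rightarrow> real \<Rightarrow> (nat \<Rightarrow> complex) set"
  where "polydisc m r = {t \<in> tuples m. \<forall>i<m. norm (t i) < r}"

definition coord_deriv :: "nat \<Rightarrow> ((nat \<Rightarrow> complex) \<Rightarrow> complex) \<Rightarrow> (nat \<Rightarrow> complex) \<Rightarrow> complex"
  where "coord_deriv i a t = deriv (\<lambda>z. a (t(i := z))) (t i)"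

definition loc_bounded :: "nat \<Rightarrow> real \<Rightarrow> ((nat \<Rightarrow> complex) \<Rightarrow> complex) \<Rightarrow> bool"
  where "loc_bounded m r a \<longleftrightarrow> (\<forall>t\<in>polydisc m r. \<exists>M. \<exists>\<epsilon>>0. \<forall>t'\<in>polydisc m r.
    (\<forall>i<m. dist (t' i) (t i) < \<epsilon>) \<longrightarrow> norm (a t') \<le> M)"

text \<open>By Osgood's lemma this is holomorphy on the polydisc. Local boundedness replaces
  continuity because it is what Cauchy estimates consume, and the same estimates hand it on to
  partial derivatives.\<close>

definition sep_holo :: "nat \<Rightarrow> real \<Rightarrow> ((nat \<Rightarrow> complex) \<Rightarrow> complex) \<Rightarrow> bool"
  where "sep_holo m r a \<longleftrightarrow> loc_bounded m r a \<and>
    (\<forall>t\<in>polydisc m r. \<forall>i<m. (\<lambda>z. a (t(i := z))) field_differentiable at (t i))"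

lemma polydisc_update:
  "\<lbrakk>t \<in> polydisc m r; i < m; norm z < r\<rbrakk> \<Longrightarrow> t(i := z) \<in> polydisc m r"
  by (auto simp: polydisc_def tuples_def)

lemma sep_holo_has_derivative:
  assumes "sep_holo m r a" "t \<in> polydisc m r" "i < m"
  shows "((\<lambda>z. a (t(i := z))) has_field_derivative coord_deriv i a t) (at (t i))"
  using assms unfolding sep_holo_def coord_deriv_def by (auto simp: field_differentiable_derivI)

lemma sep_holo_holomorphic:
  assumes "sep_holo m r a" "t \<in> polydisc m r" "i < m"
  shows "(\<lambda>z. a (t(i := z))) holomorphic_on ball 0 r"
proof -
  have "(\<lambda>z. a (t(i := z))) field_differentiable at z" if "norm z < r" for z
  proof -
    have "(\<lambda>w. a ((t(i := z))(i := w))) field_differentiable at ((t(i := z)) i)"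
      using assms polydisc_update[OF assms(2,3) that] unfolding sep_holo_def by blast
    then show ?thesis by simp
  qed
  then show ?thesis
    by (auto simp: holomorphic_on_def intro: field_differentiable_at_within)
qed

lemma polydisc_room:
  assumes "t \<in> polydisc m r"
  obtains \<epsilon> where "\<epsilon> > 0" "\<And>i. i < m \<Longrightarrow> norm (t i) + \<epsilon> \<le> r"
proof -
  \<comment> \<open>The inserted \<open>1\<close> keeps the set nonempty when
    \<open>m = 0\<close>.\<close>
  define \<epsilon> where "\<epsilon> = Min (insert 1 ((\<lambda>i. r - norm (t i)) ` {..<m}))"
  have "\<epsilon> > 0"
    using assms unfolding \<epsilon>_def by (subst Min_gr_iff) (auto simp: polydisc_def)
  moreover have "norm (t i) + \<epsilon> \<le> r" if "i < m" for i
  proof -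
    have "\<epsilon> \<le> r - norm (t i)"
      unfolding \<epsilon>_def using that by (intro Min_le) auto
    then show ?thesis by simp
  qed
  ultimately show ?thesis by (rule that)
qed

lemma sep_holo_nbhd:
  assumes "sep_holo m r a" "t \<in> polydisc m r"
  obtains \<epsilon> M where "\<epsilon> > 0" "\<And>t'. \<lbrakk>t' \<in> tuples m; \<And>i. i < m \<Longrightarrow> dist (t' i) (t i) < \<epsilon>\<rbrakk> \<Longrightarrow>
    t' \<in> polydisc m r \<and> norm (a t') \<le> M"
proof -
  obtain \<epsilon>1 where \<epsilon>1: "\<epsilon>1 > 0" "\<And>i. i < m \<Longrightarrow> norm (t i) + \<epsilon>1 \<le> r"
    using polydisc_room[OF assms(2)] by blast
  obtain M \<epsilon>2 where \<epsilon>2: "\<epsilon>2 > 0"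
    "\<And>t'. \<lbrakk>t' \<in> polydisc m r; \<forall>i<m. dist (t' i) (t i) < \<epsilon>2\<rbrakk> \<Longrightarrow> norm (a t') \<le> M"
    using assms unfolding sep_holo_def loc_bounded_def by meson
  show ?thesis
  proof (rule that[of "min \<epsilon>1 \<epsilon>2" M])
    show "min \<epsilon>1 \<epsilon>2 > 0" using \<epsilon>1 \<epsilon>2 by simp
    fix t' assume t': "t' \<in> tuples m" "\<And>i. i < m \<Longrightarrow> dist (t' i) (t i) < min \<epsilon>1 \<epsilon>2"
    have "norm (t' i) < r" if "i < m" for i
    proof -
      have "norm (t' i) \<le> norm (t i) + dist (t' i) (t i)"
        by (simp add: dist_norm norm_triangle_sub)
      then show ?thesis using t'(2)[OF that] \<epsilon>1(2)[OF that] by simp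
    qed
    then have "t' \<in> polydisc m r" using t'(1) by (simp add: polydisc_def)
    then show "t' \<in> polydisc m r \<and> norm (a t') \<le> M"
      using \<epsilon>2(2) t'(2) by simp
  qed
qed

text \<open>A Taylor remainder of first order. Discs of radius \<open>r / 4\<close> about points of
  \<open>ball z (r / 2)\<close> stay inside \<open>ball z r\<close>, so Cauchy bounds the second
  derivative by \<open>2 * M / (r / 4)^2\<close>, which is \<open>32 * M / r^2\<close>. Only
  \<open>M\<close>, \<open>r\<close> and \<open>h\<close> enter, which makes the bound uniform in
  the remaining variables.\<close>

lemma deriv_difference_quotient_bound:
  fixes f :: "complex \<Rightarrow> complex"
  assumes f: "f holomorphic_on ball z r" and M: "\<And>x. x \<in> ball z r \<Longrightarrow> norm (f x) \<le> M"
    and h: "h \<noteq> 0" "norm h < r / 2"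
  shows "norm ((f (z + h) - f z) / h - deriv f z) \<le> 32 * M / r\<^sup>2 * norm h"
proof -
  have r: "r > 0" using h(2) norm_ge_zero[of h] by linarith
  let ?S = "ball z (r / 2)"
  have "norm (f (z + h) - (\<Sum>i\<le>1. (deriv ^^ i) f z * ((z + h) - z) ^ i / fact i))
    \<le> (2 * M / (r / 4)\<^sup>2) * norm ((z + h) - z) ^ Suc 1 / fact 1"
  proof (rule complex_Taylor[where S = ?S and f = "\<lambda>i. (deriv ^^ i) f", simplified funpow_0])
    show "convex ?S" by simp
    show "z \<in> ?S" using r by simp
    show "z + h \<in> ?S" using h by (simp add: dist_norm)
    show "((deriv ^^ i) f has_field_derivative (deriv ^^ Suc i) f x) (at x within ?S)"
      if "x \<in> ?S" for x i
    proof -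
      have "(deriv ^^ i) f holomorphic_on ball z r"
        using f by (rule holomorphic_higher_deriv) simp
      moreover have "x \<in> ball z r" using that r by simp
      ultimately show ?thesis
        by (auto intro: has_field_derivative_at_within holomorphic_derivI)
    qed
    show "cmod ((deriv ^^ Suc 1) f x) \<le> 2 * M / (r / 4)\<^sup>2" if x: "x \<in> ?S" for x
    proof -
      have sub: "cball x (r / 4) \<subseteq> ball z r"
      proof
        fix y assume "y \<in> cball x (r / 4)"
        then show "y \<in> ball z r"
          using x r dist_triangle[of z y x] by simp
      qed
      have "norm ((deriv ^^ 2) f x) \<le> fact 2 * M / (r / 4) ^ 2"
      proof (rule Cauchy_inequality)
        show "f holomorphic_on ball x (r / 4)"
          using sub ball_subset_cball f holomorphic_on_subset by (metis order_trans)
        show "continuous_on (cball x (r / 4)) f"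
          using sub f holomorphic_on_imp_continuous_on continuous_on_subset by blast
        show "norm (f y) \<le> M" if "norm (x - y) = r / 4" for y
          using sub that by (intro M) (auto simp: dist_norm)
      qed (use r in simp)
      then show ?thesis by (simp add: numeral_2_eq_2)
    qed
  qed
  then have le: "norm (f (z + h) - f z - deriv f z * h) \<le> 32 * M / r\<^sup>2 * (norm h)\<^sup>2"
    by (simp add: power2_eq_square diff_diff_eq)
  have "(f (z + h) - f z) / h - deriv f z = (f (z + h) - f z - deriv f z * h) / h"
    using h by (simp add: field_simps)
  then have "norm ((f (z + h) - f z) / h - deriv f z) = norm (f (z + h) - f z - deriv f z * h) / norm h"
    by (simp add: norm_divide)
  also have "\<dots> \<le> 32 * M / r\<^sup>2 * (norm h)\<^sup>2 / norm h"
    using le by (rule divide_right_mono) simp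
  also have "\<dots> = 32 * M / r\<^sup>2 * norm h"
    by (simp add: power2_eq_square)
  finally show ?thesis .
qed

text \<open>
  Partial derivatives of separately holomorphic functions are differentiable in the other variables
  since the difference quotients converge to them locally uniformly.
\<close>

lemma sep_holo_coord_deriv:
  assumes a: "sep_holo m r a" and i: "i < m"
  shows "sep_holo m r (coord_deriv i a)"
  unfolding sep_holo_def
proof (intro conjI ballI allI impI)
  show "loc_bounded m r (coord_deriv i a)"
    unfolding loc_bounded_def
  proof
    fix t assume t: "t \<in> polydisc m r"
    obtain \<epsilon> M where \<epsilon>: "\<epsilon> > 0" and M: "\<And>t'. \<lbrakk>t' \<in> tuples m; \<And>i. i < m \<Longrightarrow> dist (t' i) (t i) < \<epsilon>\<rbrakk> \<Longrightarrow>
        t' \<in> polydisc m r \<and> norm (a t') \<le> M"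
      using sep_holo_nbhd[OF a t] by blast
    \<comment> \<open>The radius \<open>\<epsilon> / 2\<close> for \<open>t'\<close> and the radius
      \<open>\<epsilon> / 4\<close> of the Cauchy circle add up to less than \<epsilon>, so the
      circle stays where \<open>M\<close> bounds \<open>a\<close>.\<close>
    have "norm (coord_deriv i a t') \<le> M / (\<epsilon> / 4)"
      if t': "t' \<in> polydisc m r" "\<forall>i<m. dist (t' i) (t i) < \<epsilon> / 2" for t'
    proof -
      let ?f = "\<lambda>z. a (t'(i := z))"
      have upd: "t'(i := z) \<in> polydisc m r \<and> norm (?f z) \<le> M" if "dist z (t' i) \<le> \<epsilon> / 4" for z
      proof (rule M)
        show "t'(i := z) \<in> tuples m" using t' i by (auto simp: polydisc_def tuples_def)
        show "dist ((t'(i := z)) j) (t j) < \<epsilon>" if "j < m" for j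
        proof (cases "j = i")
          case True
          have "dist z (t i) \<le> dist z (t' i) + dist (t' i) (t i)" by (rule dist_triangle)
          also have "\<dots> < \<epsilon> / 4 + \<epsilon> / 2"
            using \<open>dist z (t' i) \<le> \<epsilon> / 4\<close> t'(2) i by (intro add_le_less_mono) auto
          finally show ?thesis using True \<epsilon> by simp
        next
          case False
          then show ?thesis using t'(2) that \<epsilon> by fastforce
        qed
      qed
      have sub: "cball (t' i) (\<epsilon> / 4) \<subseteq> ball 0 r"
      proof
        fix z assume "z \<in> cball (t' i) (\<epsilon> / 4)"
        then have "t'(i := z) \<in> polydisc m r" using upd by (simp add: dist_commute)
        then have "norm ((t'(i := z)) i) < r" using i unfolding polydisc_def by blast
        then show "z \<in> ball 0 r" by simp
      qed
      have holo: "?f holomorphic_on ball 0 r"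
        using sep_holo_holomorphic[OF a t'(1) i] .
      have "norm ((deriv ^^ 1) ?f (t' i)) \<le> fact 1 * M / (\<epsilon> / 4) ^ 1"
      proof (rule Cauchy_inequality)
        show "?f holomorphic_on ball (t' i) (\<epsilon> / 4)"
          using holo sub ball_subset_cball holomorphic_on_subset by (metis order_trans)
        show "continuous_on (cball (t' i) (\<epsilon> / 4)) ?f"
          using holo sub holomorphic_on_imp_continuous_on continuous_on_subset by blast
        show "norm (?f x) \<le> M" if "norm (t' i - x) = \<epsilon> / 4" for x
          using upd[of x] that by (simp add: dist_norm norm_minus_commute)
      qed (use \<epsilon> in simp)
      then show ?thesis by (simp add: coord_deriv_def)
    qed
    moreover have "\<epsilon> / 2 > 0" using \<epsilon> by simp
    ultimately show "\<exists>M. \<exists>\<epsilon>>0. \<forall>t'\<in>polydisc m r. (\<forall>i<m. dist (t' i) (t i) < \<epsilon>) \<longrightarrow>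
        norm (coord_deriv i a t') \<le> M" by meson
  qed
next
  fix t j assume t: "t \<in> polydisc m r" and j: "j < m"
  show "(\<lambda>z. coord_deriv i a (t(j := z))) field_differentiable at (t j)"
  proof (cases "j = i")
    case True
    have "(\<lambda>z. a (t(i := z))) holomorphic_on ball 0 r"
      using sep_holo_holomorphic[OF a t i] .
    then have "deriv (\<lambda>z. a (t(i := z))) holomorphic_on ball 0 r"
      by (rule holomorphic_deriv) simp
    moreover have "t i \<in> ball 0 r" using t i by (simp add: polydisc_def)
    ultimately have "deriv (\<lambda>z. a (t(i := z))) field_differentiable at (t i)"
      by (simp add: holomorphic_on_imp_differentiable_at)
    then show ?thesis using True by (simp add: coord_deriv_def)
  next
    case False
    obtain \<epsilon> M where \<epsilon>: "\<epsilon> > 0" and M: "\<And>t'. \<lbrakk>t' \<in> tuples m; \<And>i. i < m \<Longrightarrow> dist (t' i) (t i) < \<epsilon>\<rbrakk> \<Longrightarrow>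
        t' \<in> polydisc m r \<and> norm (a t') \<le> M"
      using sep_holo_nbhd[OF a t] by blast
    \<comment> \<open>A null sequence of nonzero increments; the factor
      \<open>\<epsilon> / 4\<close> keeps them below half of the radius \<epsilon>, as the remainder
      bound demands.\<close>
    define h :: "nat \<Rightarrow> complex" where "h = (\<lambda>k. of_real (\<epsilon> / 4 / real (Suc k)))"
    have h: "h k \<noteq> 0" "norm (h k) < \<epsilon> / 2" for k
    proof -
      show "h k \<noteq> 0" using \<epsilon> unfolding h_def of_real_eq_0_iff by simp
      have "norm (h k) = \<epsilon> / 4 / real (Suc k)" using \<epsilon> unfolding h_def norm_of_real by simp
      also have "\<dots> \<le> \<epsilon> / 4 / 1" using \<epsilon> by (intro divide_left_mono) auto
      finally show "norm (h k) < \<epsilon> / 2" using \<epsilon> by simp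
    qed
    have h0: "(\<lambda>k. norm (h k)) \<longlonglongrightarrow> 0"
    proof -
      have "norm (h k) = \<epsilon> / 4 * inverse (real (Suc k))" for k
      proof -
        have "norm (h k) = \<epsilon> / 4 / real (Suc k)" using \<epsilon> unfolding h_def norm_of_real by simp
        then show ?thesis by (simp only: divide_inverse[of "\<epsilon> / 4"])
      qed
      moreover have "(\<lambda>k. \<epsilon> / 4 * inverse (real (Suc k))) \<longlonglongrightarrow> \<epsilon> / 4 * 0"
        by (intro tendsto_mult tendsto_const LIMSEQ_inverse_real_of_nat)
      ultimately show ?thesis by (simp only: mult_zero_right)
    qed
    have upd: "t(j := w, i := z) \<in> polydisc m r \<and> norm (a (t(j := w, i := z))) \<le> M"
      if "dist w (t j) < \<epsilon>" "dist z (t i) < \<epsilon>" for w z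
      using that t i j \<epsilon> by (intro M) (auto simp: polydisc_def tuples_def)
    define F where "F = (\<lambda>k w. (a (t(j := w, i := t i + h k)) - a (t(j := w))) / h k)"
    let ?B = "ball (t j) \<epsilon>"
    have ij: "(t(i := z))(j := w) = t(j := w, i := z)" for z w
      using False by (simp add: fun_upd_twist)
    have tj: "t(j := w, i := t i) = t(j := w)" for w
      using False by auto
    have hol1: "(\<lambda>w. a (t(j := w, i := z))) holomorphic_on ?B" if z: "dist z (t i) < \<epsilon>" for z
    proof -
      have "t(i := z) \<in> polydisc m r"
        using upd[of "t j" z] z \<epsilon> by simp
      then have "(\<lambda>w. a ((t(i := z))(j := w))) holomorphic_on ball 0 r"
        by (rule sep_holo_holomorphic[OF a _ j])
      moreover have "?B \<subseteq> ball 0 r"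
      proof
        fix w assume "w \<in> ?B"
        then have "t(j := w) \<in> polydisc m r"
          using upd[of w "t i"] \<epsilon> by (simp add: tj dist_commute)
        then have "norm ((t(j := w)) j) < r" using j unfolding polydisc_def by blast
        then show "w \<in> ball 0 r" by simp
      qed
      ultimately show ?thesis
        using holomorphic_on_subset ij by simp
    qed
    have "(\<lambda>w. coord_deriv i a (t(j := w))) holomorphic_on ?B"
    proof (rule holomorphic_uniform_sequence[where f = F])
      show "F k holomorphic_on ?B" for k
      proof -
        have "norm (h k) < \<epsilon>" using h(2)[of k] \<epsilon> by simp
        then have "(\<lambda>w. a (t(j := w, i := t i + h k))) holomorphic_on ?B"
          by (intro hol1) (simp add: dist_norm)
        moreover have "(\<lambda>w. a (t(j := w))) holomorphic_on ?B"
          using hol1[of "t i"] \<epsilon> by (simp add: tj)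
        ultimately show ?thesis
          unfolding F_def using h(1) by (intro holomorphic_intros) auto
      qed
      have lim: "uniform_limit ?B F (\<lambda>w. coord_deriv i a (t(j := w))) sequentially"
      proof (rule uniform_limitI)
        fix e :: real assume e: "e > 0"
        have "(\<lambda>k. 32 * M / \<epsilon>\<^sup>2 * norm (h k)) \<longlonglongrightarrow> 32 * M / \<epsilon>\<^sup>2 * 0"
          by (intro tendsto_mult tendsto_const h0)
        then have "\<forall>\<^sub>F k in sequentially. 32 * M / \<epsilon>\<^sup>2 * norm (h k) < e"
          using e by (auto dest: order_tendstoD(2))
        then show "\<forall>\<^sub>F k in sequentially. \<forall>w\<in>?B. dist (F k w) (coord_deriv i a (t(j := w))) < e"
        proof (rule eventually_mono, intro ballI)
          fix k w assume k: "32 * M / \<epsilon>\<^sup>2 * norm (h k) < e" and w: "w \<in> ?B"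
          let ?f = "\<lambda>z. a (t(j := w, i := z))"
          have w': "dist w (t j) < \<epsilon>" using w by (simp add: dist_commute)
          have "norm ((?f (t i + h k) - ?f (t i)) / h k - deriv ?f (t i)) \<le> 32 * M / \<epsilon>\<^sup>2 * norm (h k)"
          proof (rule deriv_difference_quotient_bound)
            have tw: "t(j := w) \<in> polydisc m r"
              using upd[of w "t i"] w' \<epsilon> by (simp add: tj)
            have "ball (t i) \<epsilon> \<subseteq> ball 0 r"
            proof
              fix z assume "z \<in> ball (t i) \<epsilon>"
              then have "t(j := w, i := z) \<in> polydisc m r"
                using upd[of w z] w' by (simp add: dist_commute)
              then have "norm ((t(j := w, i := z)) i) < r" using i unfolding polydisc_def by blast
              then show "z \<in> ball 0 r" by simp
            qed
            then show "?f holomorphic_on ball (t i) \<epsilon>"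
              using sep_holo_holomorphic[OF a tw i] holomorphic_on_subset by blast
            show "norm (?f x) \<le> M" if "x \<in> ball (t i) \<epsilon>" for x
              using upd[OF w', of x] that by (simp add: dist_commute)
          qed (use h in auto)
          then show "dist (F k w) (coord_deriv i a (t(j := w))) < e"
            using k False by (simp add: F_def coord_deriv_def dist_norm tj)
        qed
      qed
      show "\<exists>d>0. cball x d \<subseteq> ?B \<and> uniform_limit (cball x d) F (\<lambda>w. coord_deriv i a (t(j := w))) sequentially"
        if x: "x \<in> ?B" for x
      proof -
        obtain d where "d > 0" "cball x d \<subseteq> ?B"
          using x open_contains_cball[of ?B] open_ball by blast
        then show ?thesis using lim uniform_limit_on_subset by blast
      qed
    qed simp
    then show ?thesis
      using \<epsilon> by (simp add: holomorphic_on_imp_differentiable_at)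
  qed
qed

section \<open>Closure properties of separately holomorphic functions\<close>

lemma loc_boundedI: "(\<And>t. t \<in> polydisc m r \<Longrightarrow> norm (a t) \<le> M) \<Longrightarrow> loc_bounded m r a"
  unfolding loc_bounded_def by (intro ballI exI[of _ M] exI[of _ 1]) simp

lemma loc_bounded_combine:
  assumes "loc_bounded m r a" "loc_bounded m r b"
    and "\<And>t M N. \<lbrakk>norm (a t) \<le> M; norm (b t) \<le> N\<rbrakk> \<Longrightarrow> norm (c t) \<le> f M N"
  shows "loc_bounded m r c"
  unfolding loc_bounded_def
proof
  fix t assume t: "t \<in> polydisc m r"
  obtain M d where "d > 0" "\<And>t'. \<lbrakk>t'\<in>polydisc m r; \<forall>i<m. dist (t' i) (t i) < d\<rbrakk> \<Longrightarrow> norm (a t') \<le> M"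
    using assms(1) t unfolding loc_bounded_def by meson
  moreover obtain N e where "e > 0" "\<And>t'. \<lbrakk>t'\<in>polydisc m r; \<forall>i<m. dist (t' i) (t i) < e\<rbrakk> \<Longrightarrow> norm (b t') \<le> N"
    using assms(2) t unfolding loc_bounded_def by meson
  ultimately have "min d e > 0" "\<forall>t'\<in>polydisc m r. (\<forall>i<m. dist (t' i) (t i) < min d e) \<longrightarrow> norm (c t') \<le> f M N"
    using assms(3) by auto
  then show "\<exists>M. \<exists>\<epsilon>>0. \<forall>t'\<in>polydisc m r. (\<forall>i<m. dist (t' i) (t i) < \<epsilon>) \<longrightarrow> norm (c t') \<le> M"
    by blast
qed

lemma sep_holo_const [simp]: "sep_holo m r (\<lambda>_. c)"
  unfolding sep_holo_def by (auto intro: loc_boundedI)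

lemma sep_holo_add:
  assumes "sep_holo m r a" "sep_holo m r b"
  shows "sep_holo m r (\<lambda>t. a t + b t)"
proof -
  have "loc_bounded m r (\<lambda>t. a t + b t)"
  proof (rule loc_bounded_combine[where f = "(+)" and a = a and b = b])
    show "norm (a t + b t) \<le> M + N" if "norm (a t) \<le> M" "norm (b t) \<le> N" for t M N
      using that by (rule norm_triangle_mono)
  qed (use assms in \<open>auto simp: sep_holo_def\<close>)
  then show ?thesis
    using assms unfolding sep_holo_def by (auto intro: field_differentiable_add)
qed

lemma sep_holo_mult:
  assumes "sep_holo m r a" "sep_holo m r b"
  shows "sep_holo m r (\<lambda>t. a t * b t)"
proof -
  have "loc_bounded m r (\<lambda>t. a t * b t)"
  proof (rule loc_bounded_combine[where f = "(*)" and a = a and b = b])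
    fix t and M N :: real assume "norm (a t) \<le> M" "norm (b t) \<le> N"
    then show "norm (a t * b t) \<le> M * N"
      unfolding norm_mult by (meson mult_mono norm_ge_zero order_trans)
  qed (use assms in \<open>auto simp: sep_holo_def\<close>)
  then show ?thesis
    using assms unfolding sep_holo_def by (auto intro: field_differentiable_mult)
qed

lemma sep_holo_sum:
  "(\<And>k. k \<in> K \<Longrightarrow> sep_holo m r (a k)) \<Longrightarrow> sep_holo m r (\<lambda>t. \<Sum>k\<in>K. a k t)"
  by (induction K rule: infinite_finite_induct) (auto intro: sep_holo_add)

text \<open>A positive lower bound, rather than nonvanishing, is assumed because it bounds the
  inverse at once; it is obtained later by shrinking the polydisc.\<close>

lemma sep_holo_inverse:
  assumes "sep_holo m r a" "\<And>t. t \<in> polydisc m r \<Longrightarrow> norm (a t) \<ge> d" "d > 0"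
  shows "sep_holo m r (\<lambda>t. inverse (a t))"
proof -
  have "loc_bounded m r (\<lambda>t. inverse (a t))"
  proof (rule loc_boundedI[where M = "inverse d"])
    fix t assume "t \<in> polydisc m r"
    then show "norm (inverse (a t)) \<le> inverse d"
      unfolding norm_inverse using assms by (intro le_imp_inverse_le) auto
  qed
  moreover have "a t \<noteq> 0" if "t \<in> polydisc m r" for t
    using assms(2)[OF that] assms(3) by auto
  ultimately show ?thesis
    using assms(1) unfolding sep_holo_def by (simp add: field_differentiable_inverse)
qed

text \<open>Coordinates from \<open>m\<close> on vanish in \<open>tuples m\<close>, so only the
  first \<open>m\<close> factors of a basic open box around the origin matter, and the least of
  their radii works.\<close>

lemma open_tuples_contains_polydisc:
  assumes "openin (top_of_set (tuples m)) U" "(\<lambda>_. 0) \<in> U"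
  obtains r where "r > 0" "polydisc m r \<subseteq> U"
proof -
  obtain T where T: "open T" "U = tuples m \<inter> T"
    using assms(1) by (auto simp: openin_open)
  have "openin (product_topology (\<lambda>i. euclidean) UNIV) T"
    using T(1) by (simp add: open_fun_def)
  moreover have "(\<lambda>_. 0) \<in> T" using assms T by simp
  ultimately obtain X where X: "(\<lambda>_. 0) \<in> (\<Pi>\<^sub>E i\<in>UNIV. X i)" "\<And>i. openin euclidean (X i :: complex set)"
      "(\<Pi>\<^sub>E i\<in>UNIV. X i) \<subseteq> T"
    using product_topology_open_contains_basis[of "\<lambda>_. euclidean" UNIV T "\<lambda>_. 0"] by metis
  have X0: "0 \<in> X i" "open (X i)" for i using X(1,2) by (auto simp: PiE_def Pi_def)
  have "\<exists>e>0. ball 0 e \<subseteq> X i" for i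
    using X0 open_contains_ball by blast
  then obtain e where e: "\<And>i. e i > 0" "\<And>i. ball 0 (e i) \<subseteq> X i" by metis
  define r where "r = Min (insert 1 (e ` {..<m}))"
  have "r > 0" unfolding r_def using e by (subst Min_gr_iff) auto
  moreover have "polydisc m r \<subseteq> U"
  proof
    fix t assume t: "t \<in> polydisc m r"
    have "t i \<in> X i" for i
    proof (cases "i < m")
      case True
      then have "r \<le> e i" unfolding r_def by (intro Min_le) auto
      moreover have "norm (t i) < r" using t True by (simp add: polydisc_def)
      ultimately show ?thesis using e(2)[of i] by auto
    next
      case False
      then show ?thesis using t X0 by (simp add: polydisc_def tuples_def)
    qed
    then show "t \<in> U" using X(3) T t by (auto simp: polydisc_def)
  qed
  ultimately show ?thesis by (rule that)
qed

subsection \<open>Fock spaces\<close>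

lemma linear_vec_component:
  assumes "linear_vec L"
  shows "L x $ k = (\<Sum>j\<in>UNIV. matrix L $ k $ j * x $ j)"
  by (subst matrix_works[OF assms, symmetric]) (simp add: matrix_vector_mult_def)

text \<open>Componentwise like \<open>partial_deriv\<close>; complex linear maps preserve it because
  they act on the components through a matrix.\<close>

definition has_componentwise_deriv ::
    "(complex \<Rightarrow> complex ^ 's) \<Rightarrow> complex ^ 's \<Rightarrow> complex \<Rightarrow> bool"
  where "has_componentwise_deriv g g' z \<longleftrightarrow>
    (\<forall>k. ((\<lambda>w. g w $ k) has_field_derivative g' $ k) (at z))"

lemma has_componentwise_deriv_const: "has_componentwise_deriv (\<lambda>_. x) 0 z"
  by (simp add: has_componentwise_deriv_def)

lemma has_componentwise_deriv_add:
  "\<lbrakk>has_componentwise_deriv g g' z; has_componentwise_deriv h h' z\<rbrakk> \<Longrightarrow>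
    has_componentwise_deriv (\<lambda>w. g w + h w) (g' + h') z"
  by (simp add: has_componentwise_deriv_def DERIV_add)

lemma has_componentwise_deriv_scale:
  "\<lbrakk>(a has_field_derivative a') (at z); has_componentwise_deriv g g' z\<rbrakk> \<Longrightarrow>
    has_componentwise_deriv (\<lambda>w. a w *s g w) (a' *s g z + a z *s g') z"
  unfolding has_componentwise_deriv_def by (auto intro!: derivative_eq_intros)

lemma has_componentwise_deriv_linear:
  assumes "linear_vec L" "has_componentwise_deriv g g' z"
  shows "has_componentwise_deriv (\<lambda>w. L (g w)) (L g') z"
  using assms(2) unfolding has_componentwise_deriv_def linear_vec_component[OF assms(1)]
  by (auto intro!: DERIV_sum DERIV_cmult)

lemma partial_deriv_eqI:
  "has_componentwise_deriv (\<lambda>z. f (t(i := z))) g' (t i) \<Longrightarrow> partial_deriv i f t = g'"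
  by (simp add: partial_deriv_def has_componentwise_deriv_def vec_eq_iff DERIV_imp_deriv)

text \<open>The canonical anticommutation relations for creation operators \<open>e i\<close> and
  annihilation operators \<open>f i\<close>, with a vacuum that is unique up to scalars. Neither
  \<open>V\<close> nor \<open>Q\<close> appears. The maps \<open>a\<close> and \<open>b\<close> list
  the pairs \<open>i < j\<close>, so that the entries of a skew-symmetric matrix become an
  \<open>m\<close>-tuple.\<close>

locale fock_space =
  fixes n m :: nat
    and e f :: "nat \<Rightarrow> complex ^ 's \<Rightarrow> complex ^ 's"
    and \<phi>\<^sub>0 :: "complex ^ 's"
    and a b :: "nat \<Rightarrow> nat"
  assumes linear_e: "i < n \<Longrightarrow> linear_vec (e i)"
    and linear_f: "i < n \<Longrightarrow> linear_vec (f i)"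
    and ee: "\<lbrakk>i < n; j < n\<rbrakk> \<Longrightarrow> e i (e j x) = - e j (e i x)"
    and ff: "\<lbrakk>i < n; j < n\<rbrakk> \<Longrightarrow> f i (f j x) = - f j (f i x)"
    and fe: "\<lbrakk>i < n; j < n\<rbrakk> \<Longrightarrow> f i (e j x) = (if i = j then x else 0) - e j (f i x)"
    and vacuum: "i < n \<Longrightarrow> f i \<phi>\<^sub>0 = 0"
    and vacuum_nonzero: "\<phi>\<^sub>0 \<noteq> 0"
    and vacuum_unique: "(\<And>i. i < n \<Longrightarrow> f i x = 0) \<Longrightarrow> \<exists>q. x = q *s \<phi>\<^sub>0"
    and pairs: "bij_betw (\<lambda>k. (a k, b k)) {..<m} {(i, j). i < j \<and> j < n}"
begin

lemmas e_linear [simp] = vec.linear_add[OF linear_e] vec.linear_scale[OF linear_e]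
  vec.linear_0[OF linear_e] vec.linear_neg[OF linear_e] vec.linear_diff[OF linear_e]

lemmas f_linear [simp] = vec.linear_add[OF linear_f] vec.linear_scale[OF linear_f]
  vec.linear_0[OF linear_f] vec.linear_neg[OF linear_f] vec.linear_diff[OF linear_f]

lemma self_neg_zero: "(x :: complex ^ 's) = - x \<Longrightarrow> x = 0"
  by (simp add: vec_eq_iff)

lemma ee_same [simp]: "i < n \<Longrightarrow> e i (e i x) = 0"
  using ee[of i i x] self_neg_zero by blast

lemma ff_same [simp]: "i < n \<Longrightarrow> f i (f i x) = 0"
  using ff[of i i x] self_neg_zero by blast

section \<open>Monomials in the creation operators\<close>

definition mon :: "nat set \<Rightarrow> complex ^ 's"
  where "mon I = foldr e (sorted_list_of_set I) \<phi>\<^sub>0"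

text \<open>\<open>e i\<close> after \<open>f i\<close> is the number operator of the site
  \<open>i\<close>, whose eigenvalue on a word tells whether the letter \<open>i\<close>
  occurs.\<close>

lemma occupation:
  "\<lbrakk>set xs \<subseteq> {..<n}; i < n\<rbrakk> \<Longrightarrow>
    e i (f i (foldr e xs \<phi>\<^sub>0)) = (if i \<in> set xs then foldr e xs \<phi>\<^sub>0 else 0)"
proof (induction xs)
  case Nil
  then show ?case by (simp add: vacuum)
next
  case (Cons x xs)
  then have x: "x < n" and IH: "e i (f i (foldr e xs \<phi>\<^sub>0)) = (if i \<in> set xs then foldr e xs \<phi>\<^sub>0 else 0)"
    by auto
  show ?case
  proof (cases "i = x")
    case True
    then show ?thesis using x by (simp add: fe)
  next
    case False
    have "e i (f i (e x (foldr e xs \<phi>\<^sub>0))) = e x (e i (f i (foldr e xs \<phi>\<^sub>0)))"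
      using False x Cons.prems by (simp add: fe ee[of i x])
    then show ?thesis using IH False x by simp
  qed
qed

text \<open>Complementary projections: site \<open>i\<close> occupied, respectively empty. Their
  product over all \<open>i < n\<close> keeps \<open>mon I\<close> and kills the other monomials,
  which is how coefficients are read off.\<close>

definition select :: "nat set \<Rightarrow> nat \<Rightarrow> complex ^ 's \<Rightarrow> complex ^ 's"
  where "select I i x = (if i \<in> I then e i (f i x) else f i (e i x))"

lemma linear_select: "i < n \<Longrightarrow> linear_vec (select I i)"
  unfolding select_def by (rule Vector_Spaces.linear_iff[THEN iffD2])
    (auto simp: vec.vector_space_axioms)

lemma linear_foldr:
  "(\<And>k. k \<in> set ks \<Longrightarrow> linear_vec (g k)) \<Longrightarrow> linear_vec (foldr g ks)"
  for g :: "nat \<Rightarrow> complex ^ 's \<Rightarrow> complex ^ 's"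
proof (induction ks)
  case Nil
  then show ?case using vec.linear_id by (simp add: id_def)
next
  case (Cons k ks)
  then have "linear_vec (g k \<circ> foldr g ks)"
    by (intro Vector_Spaces.linear_compose) auto
  then show ?case by (simp only: foldr.simps)
qed

lemma foldr_select:
  assumes "set xs \<subseteq> {..<n}"
  shows "set ks \<subseteq> {..<n} \<Longrightarrow> foldr (select I) ks (foldr e xs \<phi>\<^sub>0) =
    (if \<forall>i\<in>set ks. i \<in> I \<longleftrightarrow> i \<in> set xs then foldr e xs \<phi>\<^sub>0 else 0)"
proof (induction ks)
  case Nil
  then show ?case by simp
next
  case (Cons k ks)
  have "select I k (foldr e xs \<phi>\<^sub>0) = (if k \<in> I \<longleftrightarrow> k \<in> set xs then foldr e xs \<phi>\<^sub>0 else 0)"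
    using occupation[OF assms, of k] Cons.prems by (simp add: select_def fe)
  moreover have "select I k 0 = 0" using Cons.prems by (simp add: select_def)
  ultimately show ?case using Cons by simp
qed

lemma foldr_e_nonzero:
  "\<lbrakk>set xs \<subseteq> {..<n}; distinct xs\<rbrakk> \<Longrightarrow> foldr e xs \<phi>\<^sub>0 \<noteq> 0"
proof (induction xs)
  case Nil
  then show ?case by (simp add: vacuum_nonzero)
next
  case (Cons x xs)
  then have x: "x < n" and IH: "foldr e xs \<phi>\<^sub>0 \<noteq> 0" and 0: "e x (f x (foldr e xs \<phi>\<^sub>0)) = 0"
    using occupation[of xs x] by auto
  have "f x (e x (foldr e xs \<phi>\<^sub>0)) = foldr e xs \<phi>\<^sub>0"
    using x 0 by (simp add: fe)
  then show ?case using IH x by auto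
qed

lemma mon_nonzero: "I \<subseteq> {..<n} \<Longrightarrow> mon I \<noteq> 0"
  unfolding mon_def by (intro foldr_e_nonzero) (simp_all add: finite_subset[OF _ finite_lessThan])

lemma foldr_select_mon:
  assumes "I \<subseteq> {..<n}" "J \<subseteq> {..<n}"
  shows "foldr (select I) [0..<n] (mon J) = (if I = J then mon J else 0)"
proof -
  have J: "finite J" using assms finite_subset by blast
  have "(\<forall>i\<in>set [0..<n]. i \<in> I \<longleftrightarrow> i \<in> J) \<longleftrightarrow> I = J" using assms by auto
  then show ?thesis
    unfolding mon_def using foldr_select[of "sorted_list_of_set J" "[0..<n]" I] assms J
    by (simp add: atLeast0LessThan)
qed

lemma inj_mon: "inj_on mon (Pow {..<n})"
proof (rule inj_onI)
  fix I J assume *: "I \<in> Pow {..<n}" "J \<in> Pow {..<n}" "mon I = mon J"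
  then have "foldr (select I) [0..<n] (mon J) = mon J"
    using foldr_select_mon[of I I] by simp
  then show "I = J" using * foldr_select_mon[of I J] mon_nonzero[of J] by (auto split: if_splits)
qed

lemma independent_mon: "vec.independent (mon ` Pow {..<n})"
proof
  assume "vec.dependent (mon ` Pow {..<n})"
  then obtain u I where u: "u (mon I) \<noteq> 0" "I \<in> Pow {..<n}" "(\<Sum>v\<in>mon ` Pow {..<n}. u v *s v) = 0"
    using vec.dependent_finite[of "mon ` Pow {..<n}"] by auto
  let ?S = "foldr (select I) [0..<n]"
  have lin: "linear_vec ?S"
    by (rule linear_foldr) (simp add: linear_select)
  have "(\<Sum>J\<in>Pow {..<n}. u (mon J) *s mon J) = 0"
    using u(3) by (simp add: sum.reindex[OF inj_mon])
  then have "?S (\<Sum>J\<in>Pow {..<n}. u (mon J) *s mon J) = 0"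
    using vec.linear_0[OF lin] by simp
  then have "(\<Sum>J\<in>Pow {..<n}. u (mon J) *s ?S (mon J)) = 0"
    by (simp add: vec.linear_sum[OF lin] vec.linear_scale[OF lin])
  moreover have "(\<Sum>J\<in>Pow {..<n}. u (mon J) *s ?S (mon J)) =
      (\<Sum>J\<in>Pow {..<n}. if J = I then u (mon I) *s mon I else 0)"
    using u(2) by (intro sum.cong) (auto simp: foldr_select_mon)
  ultimately show False
    using u(1,2) mon_nonzero[of I] by simp
qed

lemma dim_span_mon:
  "vec.dim (vec.span (mon ` {I. I \<subseteq> {..<n} \<and> P I})) = card {I. I \<subseteq> {..<n} \<and> P I}"
proof -
  have sub: "{I. I \<subseteq> {..<n} \<and> P I} \<subseteq> Pow {..<n}" by auto
  have "vec.independent (mon ` {I. I \<subseteq> {..<n} \<and> P I})"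
    using independent_mon by (rule vec.independent_mono) (use sub in auto)
  then have "vec.dim (vec.span (mon ` {I. I \<subseteq> {..<n} \<and> P I})) = card (mon ` {I. I \<subseteq> {..<n} \<and> P I})"
    by (rule vec.dim_span_eq_card_independent)
  also have "\<dots> = card {I. I \<subseteq> {..<n} \<and> P I}"
    using inj_on_subset[OF inj_mon sub] by (rule card_image)
  finally show ?thesis .
qed

text \<open>Moving \<open>e x\<close> to its sorted position costs one sign per letter
  passed.\<close>

lemma foldr_insort:
  "\<lbrakk>x < n; set ys \<subseteq> {..<n}\<rbrakk> \<Longrightarrow>
    \<exists>\<sigma>\<in>{1, -1}. foldr e (insort x ys) y = \<sigma> *s e x (foldr e ys y)"
proof (induction ys)
  case Nil
  then show ?case by simp
next
  case (Cons z ys)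
  then obtain \<sigma> where \<sigma>: "\<sigma> \<in> {1, -1}" "foldr e (insort x ys) y = \<sigma> *s e x (foldr e ys y)"
    by (metis insert_subset list.set(2))
  have "e z (\<sigma> *s e x (foldr e ys y)) = (- \<sigma>) *s e x (e z (foldr e ys y))"
    using Cons.prems ee[of z x] by (simp add: vec.scale_minus_left)
  moreover have "- \<sigma> \<in> {1, -1}" using \<sigma>(1) by auto
  ultimately show ?case
    using \<sigma> by (cases "x \<le> z") auto
qed

lemma e_foldr_mem: "\<lbrakk>x \<in> set xs; set xs \<subseteq> {..<n}\<rbrakk> \<Longrightarrow> e x (foldr e xs y) = 0"
proof (induction xs)
  case Nil
  then show ?case by simp
next
  case (Cons z xs)
  then have "x < n" "z < n" by auto
  then show ?case
    using Cons by (cases "x = z") (auto simp: ee[of x z])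
qed

lemma foldr_not_distinct:
  "\<lbrakk>set xs \<subseteq> {..<n}; \<not> distinct xs\<rbrakk> \<Longrightarrow> foldr e xs y = 0"
  by (induction xs) (auto simp: e_foldr_mem)

lemma foldr_e_mon:
  "\<lbrakk>set xs \<subseteq> {..<n}; distinct xs\<rbrakk> \<Longrightarrow> \<exists>\<sigma>\<in>{1, -1}. foldr e xs \<phi>\<^sub>0 = \<sigma> *s mon (set xs)"
proof (induction xs)
  case Nil
  then show ?case by (simp add: mon_def)
next
  case (Cons x xs)
  then obtain \<sigma> where \<sigma>: "\<sigma> \<in> {1, -1}" "foldr e xs \<phi>\<^sub>0 = \<sigma> *s mon (set xs)"
    by (metis distinct.simps(2) insert_subset list.set(2))
  have "\<exists>\<tau>\<in>{1, -1}. mon (insert x (set xs)) = \<tau> *s e x (mon (set xs))"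
    unfolding mon_def
    using foldr_insort[of x "sorted_list_of_set (set xs)" \<phi>\<^sub>0] Cons.prems
    by (simp add: sorted_list_of_set_insert)
  then obtain \<tau> where \<tau>: "\<tau> \<in> {1, -1}" "mon (insert x (set xs)) = \<tau> *s e x (mon (set xs))"
    by blast
  have "foldr e (x # xs) \<phi>\<^sub>0 = (\<sigma> * \<tau>) *s mon (set (x # xs))"
    using \<sigma> \<tau> Cons.prems by (auto simp: vec.scale_minus_left)
  moreover have "\<sigma> * \<tau> \<in> {1, -1}" using \<sigma> \<tau> by auto
  ultimately show ?case by blast
qed

text \<open>Words are easy to generate, sorted monomials easy to count. Reordering only changes
  signs and a repeated letter gives zero, so a condition on the length turns into one on the
  cardinality.\<close>

lemma span_foldr_e:
  "vec.span {foldr e xs \<phi>\<^sub>0 | xs. set xs \<subseteq> {..<n} \<and> P (length xs)} =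
    vec.span (mon ` {I. I \<subseteq> {..<n} \<and> P (card I)})"
proof (rule subset_antisym)
  show "vec.span {foldr e xs \<phi>\<^sub>0 | xs. set xs \<subseteq> {..<n} \<and> P (length xs)} \<subseteq>
    vec.span (mon ` {I. I \<subseteq> {..<n} \<and> P (card I)})"
  proof (rule vec.span_minimal[OF _ vec.subspace_span], safe)
    fix xs assume xs: "set xs \<subseteq> {..<n}" "P (length xs)"
    show "foldr e xs \<phi>\<^sub>0 \<in> vec.span (mon ` {I. I \<subseteq> {..<n} \<and> P (card I)})"
    proof (cases "distinct xs")
      case True
      then obtain \<sigma> where "foldr e xs \<phi>\<^sub>0 = \<sigma> *s mon (set xs)" using foldr_e_mon xs by blast
      moreover have "mon (set xs) \<in> mon ` {I. I \<subseteq> {..<n} \<and> P (card I)}"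
        using xs True by (auto simp: distinct_card)
      ultimately show ?thesis by (simp add: vec.span_base vec.span_scale)
    next
      case False
      then show ?thesis using xs foldr_not_distinct vec.span_zero by simp
    qed
  qed
  show "vec.span (mon ` {I. I \<subseteq> {..<n} \<and> P (card I)}) \<subseteq>
    vec.span {foldr e xs \<phi>\<^sub>0 | xs. set xs \<subseteq> {..<n} \<and> P (length xs)}"
  proof (rule vec.span_mono, safe)
    fix I assume I: "I \<subseteq> {..<n}" "P (card I)"
    then have "finite I" using finite_subset by blast
    then show "\<exists>xs. mon I = foldr e xs \<phi>\<^sub>0 \<and> set xs \<subseteq> {..<n} \<and> P (length xs)"
      using I by (intro exI[of _ "sorted_list_of_set I"]) (simp add: mon_def)
  qed
qed

text \<open>
  The projection \<open>foldr (select {}) [0..<n]\<close> onto the line of the vacuum yields the coordinate \<open>\<kappa>\<close>.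
\<close>

definition \<kappa> :: "complex ^ 's \<Rightarrow> complex"
  where "\<kappa> x = (let k = SOME k. \<phi>\<^sub>0 $ k \<noteq> 0 in foldr (select {}) [0..<n] x $ k / \<phi>\<^sub>0 $ k)"

lemma \<kappa>_vacuum [simp]: "\<kappa> \<phi>\<^sub>0 = 1"
proof -
  have "\<exists>k. \<phi>\<^sub>0 $ k \<noteq> 0" using vacuum_nonzero by (auto simp: vec_eq_iff)
  then have "\<phi>\<^sub>0 $ (SOME k. \<phi>\<^sub>0 $ k \<noteq> 0) \<noteq> 0" by (rule someI_ex)
  moreover have "foldr (select {}) [0..<n] \<phi>\<^sub>0 = \<phi>\<^sub>0"
    using foldr_select[of "[]" "[0..<n]" "{}"] by (simp add: atLeast0LessThan)
  ultimately show ?thesis by (simp add: \<kappa>_def Let_def)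
qed

lemma \<kappa>_add [simp]: "\<kappa> (x + y) = \<kappa> x + \<kappa> y"
  and \<kappa>_scale [simp]: "\<kappa> (q *s x) = q * \<kappa> x"
proof -
  have "linear_vec (foldr (select {}) [0..<n])"
    by (rule linear_foldr) (simp add: linear_select)
  note [simp] = vec.linear_add[OF this] vec.linear_scale[OF this]
  show "\<kappa> (x + y) = \<kappa> x + \<kappa> y" "\<kappa> (q *s x) = q * \<kappa> x"
    by (simp_all add: \<kappa>_def Let_def add_divide_distrib)
qed

lemma linear_\<kappa>: "linear_form \<kappa>"
  by (rule Vector_Spaces.linear_iff[THEN iffD2])
    (auto simp: vec.vector_space_axioms vector_space_def algebra_simps)

lemma \<kappa>_0 [simp]: "\<kappa> 0 = 0"
  using \<kappa>_scale[of 0 0] by simp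

lemma \<kappa>_minus [simp]: "\<kappa> (- x) = - \<kappa> x"
  using \<kappa>_add[of x "- x"] by (simp add: eq_neg_iff_add_eq_0 add.commute)

lemma \<kappa>_diff [simp]: "\<kappa> (x - y) = \<kappa> x - \<kappa> y"
  using \<kappa>_add[of x "- y"] by simp

lemma \<kappa>_sum: "\<kappa> (\<Sum>k\<in>K. g k) = (\<Sum>k\<in>K. \<kappa> (g k))"
  by (induction K rule: infinite_finite_induct) auto

text \<open>In the projection onto the vacuum, the factor at the site \<open>i\<close> kills every
  vector in the image of \<open>e i\<close>, and the factors at other sites commute with
  \<open>e i\<close>.\<close>

lemma \<kappa>_e [simp]:
  assumes "i < n"
  shows "\<kappa> (e i x) = 0"
proof -
  have "\<lbrakk>i \<in> set ks; set ks \<subseteq> {..<n}\<rbrakk> \<Longrightarrow> foldr (select {}) ks (e i x) = 0" for ks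
  proof (induction ks)
    case (Cons k ks)
    have comm: "set ls \<subseteq> {..<n} \<Longrightarrow> i \<notin> set ls \<Longrightarrow>
        foldr (select {}) ls (e i x) = e i (foldr (select {}) ls x)" for ls
      using assms by (induction ls) (auto simp: select_def fe ee[of _ i])
    have "select {} k (e k z) = 0" "select {} k 0 = 0" for z
      using Cons.prems by (simp_all add: select_def)
    note [simp] = this
    show ?case
    proof (cases "i \<in> set ks")
      case True
      then show ?thesis using Cons by simp
    next
      case False
      then show ?thesis using Cons.prems comm[of ks] by auto
    qed
  qed simp
  from this[of "[0..<n]"] assms show ?thesis
    by (simp add: \<kappa>_def Let_def atLeast0LessThan)
qed

section \<open>Products of two creation operators and their exponential\<close>

definition E :: "nat \<Rightarrow> complex ^ 's \<Rightarrow> complex ^ 's"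
  where "E k x = e (a k) (e (b k) x)"

text \<open>The coefficient of \<open>E k \<phi>\<^sub>0\<close>. The annihilators stand in the
  order opposite to the creators in \<open>E k\<close>, so no sign arises.\<close>

definition coord :: "nat \<Rightarrow> complex ^ 's \<Rightarrow> complex"
  where "coord k x = \<kappa> (f (b k) (f (a k) x))"

lemma pair_less: "k < m \<Longrightarrow> a k < b k" "k < m \<Longrightarrow> b k < n" "k < m \<Longrightarrow> a k < n"
  using bij_betw_apply[OF pairs, of k] by auto

lemma pair_inj: "\<lbrakk>j < m; k < m; a j = a k; b j = b k\<rbrakk> \<Longrightarrow> j = k"
  using pairs unfolding bij_betw_def inj_on_def by auto

lemma pair_surj:
  assumes "i < j" "j < n" obtains k where "k < m" "a k = i" "b k = j"
proof -
  have "(i, j) \<in> (\<lambda>k. (a k, b k)) ` {..<m}"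
    using pairs assms unfolding bij_betw_def by auto
  then show ?thesis using that by auto
qed

lemma linear_E: "k < m \<Longrightarrow> linear_vec (E k)"
  unfolding E_def using pair_less
  by (intro Vector_Spaces.linear_iff[THEN iffD2]) (auto simp: vec.vector_space_axioms)

lemmas E_linear [simp] = vec.linear_add[OF linear_E] vec.linear_scale[OF linear_E]
  vec.linear_0[OF linear_E] vec.linear_neg[OF linear_E] vec.linear_diff[OF linear_E]

lemma E_e: "\<lbrakk>k < m; i < n\<rbrakk> \<Longrightarrow> E k (e i x) = e i (E k x)"
  using pair_less by (simp add: E_def ee[of _ i])

lemma E_comm: "\<lbrakk>j < m; k < m\<rbrakk> \<Longrightarrow> E j (E k x) = E k (E j x)"
  using pair_less by (simp add: E_def[of k] E_e)

lemma EE [simp]: "k < m \<Longrightarrow> E k (E k x) = 0"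
  using pair_less by (simp add: E_def ee[of "b k" "a k"])

text \<open>The commutator of \<open>f c\<close> with \<open>E k\<close>, written out: a combination
  of creation operators, hence commuting with every \<open>E j\<close>.\<close>

definition comm :: "nat \<Rightarrow> nat \<Rightarrow> complex ^ 's \<Rightarrow> complex ^ 's"
  where "comm c k x = (if c = a k then e (b k) x else 0) - (if c = b k then e (a k) x else 0)"

lemma f_E: "\<lbrakk>c < n; k < m\<rbrakk> \<Longrightarrow> f c (E k x) = E k (f c x) + comm c k x"
  using pair_less by (auto simp: E_def comm_def fe)

lemma comm_linear [simp]:
  assumes "k < m"
  shows "comm c k (x + y) = comm c k x + comm c k y" "comm c k (q *s x) = q *s comm c k x"
  using pair_less[OF assms] by (auto simp: comm_def vec.scale_right_diff_distrib)

lemma comm_E: "\<lbrakk>j < m; k < m\<rbrakk> \<Longrightarrow> comm c k (E j x) = E j (comm c k x)"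
  using pair_less by (simp add: comm_def E_e)

lemma E_comm_same [simp]: "k < m \<Longrightarrow> E k (comm c k x) = 0"
  using pair_less by (simp add: comm_def E_def ee[of "b k" "a k"])

text \<open>
  The \<open>E k\<close> commute and have square zero, so this is \<open>exp (\<Sum>k\<leftarrow>ks. t k E k)\<close>.
\<close>

definition Exp :: "nat list \<Rightarrow> (nat \<Rightarrow> complex) \<Rightarrow> complex ^ 's \<Rightarrow> complex ^ 's"
  where "Exp ks t = foldr (\<lambda>k x. x + t k *s E k x) ks"

lemma Exp_simps [simp]:
  "Exp [] t x = x" "Exp (k # ks) t x = Exp ks t x + t k *s E k (Exp ks t x)"
  by (simp_all add: Exp_def)

lemma linear_Exp: "set ks \<subseteq> {..<m} \<Longrightarrow> linear_vec (Exp ks t)"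
  unfolding Exp_def
  by (intro linear_foldr Vector_Spaces.linear_iff[THEN iffD2])
    (auto simp: vec.vector_space_axioms vec.scale_right_distrib subset_iff mult.commute)

lemma Exp_cong: "(\<And>k. k \<in> set ks \<Longrightarrow> t k = t' k) \<Longrightarrow> Exp ks t x = Exp ks t' x"
  by (induction ks) auto

lemma Exp_E: "\<lbrakk>set ks \<subseteq> {..<m}; j < m\<rbrakk> \<Longrightarrow> Exp ks t (E j x) = E j (Exp ks t x)"
  by (induction ks) (auto simp: E_comm[of _ j])

lemma Exp_e: "\<lbrakk>set ks \<subseteq> {..<m}; i < n\<rbrakk> \<Longrightarrow> Exp ks t (e i x) = e i (Exp ks t x)"
  by (induction ks) (auto simp: E_e)

lemma Exp_comm: "\<lbrakk>set ks \<subseteq> {..<m}; j < m\<rbrakk> \<Longrightarrow> Exp ks t (comm c j x) = comm c j (Exp ks t x)"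
  by (induction ks) (auto simp: comm_E)

lemma Exp_inverse: "set ks \<subseteq> {..<m} \<Longrightarrow> Exp ks (\<lambda>k. - t k) (Exp ks t x) = x"
proof (induction ks arbitrary: x)
  case (Cons k ks)
  then have k: "k < m" and ks: "set ks \<subseteq> {..<m}" by auto
  note [simp] = vec.linear_add[OF linear_Exp[OF ks]] vec.linear_scale[OF linear_Exp[OF ks]]
  show ?case using Cons.IH[OF ks] k
    by (simp add: Exp_E[OF ks] vec.scale_minus_left)
qed simp

text \<open>Conjugating \<open>f c\<close> by an exponential adds its commutator with the exponent;
  the series stops there because this commutator commutes with all \<open>E k\<close>.\<close>

lemma f_Exp:
  "\<lbrakk>set ks \<subseteq> {..<m}; c < n\<rbrakk> \<Longrightarrow>
    f c (Exp ks t x) = Exp ks t (f c x + (\<Sum>k\<leftarrow>ks. t k *s comm c k x))"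
proof (induction ks)
  case (Cons k ks)
  then have k: "k < m" and ks: "set ks \<subseteq> {..<m}" by auto
  note [simp] = vec.linear_add[OF linear_Exp[OF ks]] vec.linear_scale[OF linear_Exp[OF ks]]
  let ?y = "f c x + (\<Sum>k\<leftarrow>ks. t k *s comm c k x)"
  have IH: "f c (Exp ks t x) = Exp ks t ?y" using Cons by auto
  have "f c (Exp (k # ks) t x) = Exp ks t ?y + t k *s (E k (Exp ks t ?y) + comm c k (Exp ks t x))"
    using Cons.prems k by (simp add: f_E IH del: map_append)
  also have "\<dots> = Exp (k # ks) t (?y + t k *s comm c k x)"
    using k by (simp add: Exp_comm[OF ks] vec.scale_right_distrib)
  finally show ?case by (simp add: add.commute add.left_commute)
qed simp

lemma \<kappa>_E [simp]: "k < m \<Longrightarrow> \<kappa> (E k x) = 0"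
  using pair_less by (simp add: E_def)

lemma \<kappa>_Exp: "set ks \<subseteq> {..<m} \<Longrightarrow> \<kappa> (Exp ks t x) = \<kappa> x"
  by (induction ks) auto

lemma coord_add [simp]: "k < m \<Longrightarrow> coord k (x + y) = coord k x + coord k y"
  and coord_scale [simp]: "k < m \<Longrightarrow> coord k (q *s x) = q * coord k x"
  and coord_vacuum [simp]: "k < m \<Longrightarrow> coord k \<phi>\<^sub>0 = 0"
  and coord_0 [simp]: "k < m \<Longrightarrow> coord k 0 = 0"
  using pair_less by (simp_all add: coord_def vacuum)

lemma coord_sum: "k < m \<Longrightarrow> coord k (\<Sum>j\<in>J. g j) = (\<Sum>j\<in>J. coord k (g j))"
  by (induction J rule: infinite_finite_induct) auto

lemma coord_E: "\<lbrakk>j < m; k < m\<rbrakk> \<Longrightarrow> coord j (E k x) = (if j = k then \<kappa> x else 0)"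
  using pair_less[of j] pair_less[of k] pair_inj[of j k]
  by (auto simp: coord_def E_def fe)

text \<open>Terms with two or more factors \<open>E k\<close> drop out, since \<open>coord_E\<close>
  leaves \<kappa> of a vector in the image of some \<open>E k\<close>, which is zero.\<close>

lemma coord_Exp:
  "\<lbrakk>set ks \<subseteq> {..<m}; distinct ks; j < m\<rbrakk> \<Longrightarrow>
    coord j (Exp ks t x) = coord j x + (if j \<in> set ks then t j * \<kappa> x else 0)"
  by (induction ks) (auto simp: coord_E \<kappa>_Exp)

section \<open>Pure spinors of the affine chart\<close>

abbreviation pure :: "(nat \<Rightarrow> complex) \<Rightarrow> complex ^ 's"
  where "pure t \<equiv> Exp [0..<m] t \<phi>\<^sub>0"

lemma set_upt_m: "set [0..<m] \<subseteq> {..<m}"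
  by auto

lemmas Exp_m_linear [simp] =
  vec.linear_add[OF linear_Exp[OF set_upt_m]] vec.linear_scale[OF linear_Exp[OF set_upt_m]]
  vec.linear_0[OF linear_Exp[OF set_upt_m]]

lemma \<kappa>_pure [simp]: "\<kappa> (pure t) = 1"
  by (simp add: \<kappa>_Exp[OF set_upt_m])

lemma coord_pure [simp]: "k < m \<Longrightarrow> coord k (pure t) = t k"
  by (simp add: coord_Exp[OF set_upt_m])

lemma f_Exp_m:
  "c < n \<Longrightarrow> f c (Exp [0..<m] t x) = Exp [0..<m] t (f c x + (\<Sum>k<m. t k *s comm c k x))"
  by (simp add: f_Exp[OF set_upt_m] interv_sum_list_conv_sum_set_nat atLeast0LessThan)

lemma Exp_sum_comm:
  "Exp [0..<m] t (\<Sum>k<m. u k *s comm c k x) = (\<Sum>k<m. u k *s comm c k (Exp [0..<m] t x))"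
  by (simp add: vec.linear_sum[OF linear_Exp[OF set_upt_m]] Exp_comm[OF set_upt_m])

lemma Exp_m_inverse:
  "Exp [0..<m] (\<lambda>k. - t k) (Exp [0..<m] t x) = x"
  "Exp [0..<m] t (Exp [0..<m] (\<lambda>k. - t k) x) = x"
  using Exp_inverse[OF set_upt_m, of t x] Exp_inverse[OF set_upt_m, of "\<lambda>k. - t k" x] by simp_all

lemma Exp_m_eq_0: "Exp [0..<m] t x = 0 \<Longrightarrow> x = 0"
  using Exp_m_inverse(1)[of t x] by simp

lemma f_pure: "c < n \<Longrightarrow> f c (pure t) = (\<Sum>k<m. t k *s comm c k (pure t))"
  by (simp add: f_Exp_m vacuum Exp_sum_comm)

text \<open>The inverse exponential turns these equations into those of the vacuum, which is unique
  up to a scalar.\<close>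

lemma pure_unique:
  assumes "\<And>c. c < n \<Longrightarrow> f c x = (\<Sum>k<m. t k *s comm c k x)"
  shows "\<exists>q. x = q *s pure t"
proof -
  define y where "y = Exp [0..<m] (\<lambda>k. - t k) x"
  have x: "x = Exp [0..<m] t y" by (simp add: y_def Exp_m_inverse)
  have "f c y = 0" if c: "c < n" for c
  proof -
    have "Exp [0..<m] t (f c y) = 0"
      using assms[OF c] f_Exp_m[OF c, of t y] by (simp add: x Exp_sum_comm)
    then show ?thesis by (rule Exp_m_eq_0)
  qed
  then obtain q where "y = q *s \<phi>\<^sub>0" using vacuum_unique by blast
  then show ?thesis using x by auto
qed

lemma \<kappa>_f_sum_e:
  assumes "d < n"
  shows "\<kappa> (f d (\<Sum>j<n. \<beta> j *s e j y)) = \<beta> d * \<kappa> y"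
proof -
  have "\<kappa> (f d (\<Sum>j<n. \<beta> j *s e j y)) = (\<Sum>j<n. \<beta> j * \<kappa> (f d (e j y)))"
    using assms by (simp add: vec.linear_sum[OF linear_f] \<kappa>_sum)
  also have "\<dots> = (\<Sum>j<n. if j = d then \<beta> d * \<kappa> y else 0)"
    using assms by (intro sum.cong) (auto simp: fe)
  finally show ?thesis using assms by simp
qed

lemma comm_eq_sum_e:
  assumes "k < m"
  shows "comm c k y = (\<Sum>d<n. ((if c = a k \<and> d = b k then 1 else 0) -
    (if c = b k \<and> d = a k then 1 else 0)) *s e d y)"
proof -
  have 1: "(\<Sum>d<n. (if P \<and> d = j then 1 else 0) *s e d y) = (if P then e j y else 0)" if "j < n" for P j
  proof -
    have "(\<Sum>d<n. (if P \<and> d = j then 1 else 0) *s e d y) = (\<Sum>d<n. if d = j then (if P then e j y else 0) else 0)"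
      by (intro sum.cong) auto
    then show ?thesis using that by simp
  qed
  show ?thesis
    using pair_less[OF assms] by (simp add: vec.scale_left_diff_distrib sum_subtractf 1 comm_def)
qed

text \<open>
  Conjugation by \<open>Exp\<close> reduces to the case where all \<open>coord k\<close> vanish; then \<open>B = 0\<close>.
\<close>

lemma pure_chart:
  assumes \<kappa>: "\<kappa> x \<noteq> 0" and B: "\<And>c. c < n \<Longrightarrow> f c x + (\<Sum>d<n. B c d *s e d x) = 0"
  shows "x = \<kappa> x *s pure (\<lambda>k. coord k x / \<kappa> x)"
proof -
  define t where "t = (\<lambda>k. coord k x / \<kappa> x)"
  define y where "y = Exp [0..<m] (\<lambda>k. - t k) x"
  have x: "x = Exp [0..<m] t y" by (simp add: y_def Exp_m_inverse)
  have \<kappa>y: "\<kappa> y = \<kappa> x" by (simp add: y_def \<kappa>_Exp[OF set_upt_m])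
  have coordy: "coord k y = 0" if "k < m" for k
    using that \<kappa> by (simp add: y_def coord_Exp[OF set_upt_m] t_def)
  \<comment> \<open>Antisymmetry extends the vanishing of the coordinates from the pairs
    \<open>a k < b k\<close> to all pairs.\<close>
  have ffy: "\<kappa> (f d (f c y)) = 0" if cd: "c < n" "d < n" for c d
  proof -
    consider "c = d" | "c < d" | "d < c" by linarith
    then show ?thesis
    proof cases
      case 2
      then obtain k where "k < m" "a k = c" "b k = d" using pair_surj[OF _ cd(2)] by blast
      then show ?thesis using coordy[of k] by (simp add: coord_def)
    next
      case 3
      then obtain k where "k < m" "a k = d" "b k = c" using pair_surj[OF _ cd(1)] by blast
      then show ?thesis using coordy[of k] ff[of d c y] that by (simp add: coord_def)
    qed (use that in simp)
  qed
  have "f c y = 0" if c: "c < n" for c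
  proof -
    \<comment> \<open>Creation operators commute with \<open>Exp\<close>, so conjugation merely
      shifts the matrix \<open>B\<close> by the contribution of \<open>t\<close>.\<close>
    define \<beta> where "\<beta> = (\<lambda>d. (\<Sum>k<m. t k * ((if c = a k \<and> d = b k then 1 else 0) -
      (if c = b k \<and> d = a k then 1 else 0))) + B c d)"
    have "(\<Sum>k<m. t k *s comm c k y) + (\<Sum>d<n. B c d *s e d y) = (\<Sum>d<n. \<beta> d *s e d y)"
    proof -
      have "(\<Sum>k<m. t k *s comm c k y) = (\<Sum>k<m. \<Sum>d<n. (t k * ((if c = a k \<and> d = b k then 1 else 0) -
          (if c = b k \<and> d = a k then 1 else 0))) *s e d y)"
        by (intro sum.cong refl) (simp only: lessThan_iff comm_eq_sum_e vec.scale_sum_right vec.scale_scale)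
      also have "\<dots> = (\<Sum>d<n. (\<Sum>k<m. t k * ((if c = a k \<and> d = b k then 1 else 0) -
          (if c = b k \<and> d = a k then 1 else 0))) *s e d y)"
        by (subst sum.swap) (simp add: vec.scale_sum_left)
      finally show ?thesis by (simp add: \<beta>_def vec.scale_left_distrib sum.distrib)
    qed
    moreover have "Exp [0..<m] t (f c y + ((\<Sum>k<m. t k *s comm c k y) + (\<Sum>d<n. B c d *s e d y))) = 0"
      using B[OF c] f_Exp_m[OF c, of t y]
      by (simp add: x vec.linear_sum[OF linear_Exp[OF set_upt_m]] Exp_e[OF set_upt_m] add.assoc)
    ultimately have fc: "f c y + (\<Sum>d<n. \<beta> d *s e d y) = 0"
      using Exp_m_eq_0 by presburger
    \<comment> \<open>Applying \<open>f d\<close> and then \<kappa> leaves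
      \<open>\<beta> d * \<kappa> y\<close>, since the coordinates of \<open>y\<close>
      vanish.\<close>
    have "\<beta> d = 0" if "d < n" for d
    proof -
      have "\<kappa> (f d (f c y + (\<Sum>d<n. \<beta> d *s e d y))) = 0"
        using that by (subst fc) simp
      then show ?thesis
        using that c \<kappa> by (simp add: ffy \<kappa>_f_sum_e \<kappa>y)
    qed
    then show ?thesis using fc by simp
  qed
  then obtain q where q: "y = q *s \<phi>\<^sub>0" using vacuum_unique by blast
  then have "q = \<kappa> x" using \<kappa>y by simp
  then have "Exp [0..<m] t y = \<kappa> x *s pure t" by (simp only: q Exp_m_linear)
  then have "x = \<kappa> x *s pure t" by (rule trans[OF x])
  then show ?thesis unfolding t_def .
qed

text \<open>The factors commute, so differentiation brings the derivative of the exponent to the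
  front. The sum contains terms with \<open>E k\<close> twice that the product rule does not
  produce; they vanish because \<open>E k\<close> squares to zero.\<close>

lemma has_componentwise_deriv_Exp:
  assumes "\<And>k. k \<in> set ks \<Longrightarrow> ((\<lambda>w. \<alpha> w k) has_field_derivative \<alpha>' k) (at z)"
  shows "set ks \<subseteq> {..<m} \<Longrightarrow> has_componentwise_deriv (\<lambda>w. Exp ks (\<alpha> w) x)
    (\<Sum>k\<leftarrow>ks. \<alpha>' k *s E k (Exp ks (\<alpha> z) x)) z"
  using assms
proof (induction ks)
  case Nil
  then show ?case by (simp add: has_componentwise_deriv_const)
next
  case (Cons k ks)
  then have k: "k < m" and ks: "set ks \<subseteq> {..<m}" by auto
  let ?y = "Exp ks (\<alpha> z) x" and ?A = "\<lambda>y. \<Sum>k\<leftarrow>ks. \<alpha>' k *s E k y"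
  have IH: "has_componentwise_deriv (\<lambda>w. Exp ks (\<alpha> w) x) (?A ?y) z"
    using Cons by auto
  have A: "?A (u + q *s E k v) = ?A u + q *s E k (?A v)" for u v q
  proof -
    have "set ls \<subseteq> {..<m} \<Longrightarrow> (\<Sum>k\<leftarrow>ls. \<alpha>' k *s E k (u + q *s E k' v)) =
      (\<Sum>k\<leftarrow>ls. \<alpha>' k *s E k u) + q *s E k' (\<Sum>k\<leftarrow>ls. \<alpha>' k *s E k v)" if "k' < m" for ls k'
      using that by (induction ls) (auto simp: E_comm[of k'] vec.scale_right_distrib mult.commute algebra_simps)
    then show ?thesis using k ks by blast
  qed
  have "has_componentwise_deriv (\<lambda>w. Exp ks (\<alpha> w) x + \<alpha> w k *s E k (Exp ks (\<alpha> w) x))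
      (?A ?y + (\<alpha>' k *s E k ?y + \<alpha> z k *s E k (?A ?y))) z"
    using Cons.prems IH
    by (intro has_componentwise_deriv_add has_componentwise_deriv_scale
        has_componentwise_deriv_linear[OF linear_E[OF k]]) auto
  then show ?case using k by (simp add: A algebra_simps)
qed

lemma has_componentwise_deriv_Exp_m:
  assumes "\<And>k. k < m \<Longrightarrow> ((\<lambda>w. \<alpha> w k) has_field_derivative \<alpha>' k) (at z)"
  shows "has_componentwise_deriv (\<lambda>w. pure (\<alpha> w)) (\<Sum>k<m. \<alpha>' k *s E k (pure (\<alpha> z))) z"
  using has_componentwise_deriv_Exp[OF _ set_upt_m, of \<alpha> \<alpha>' z \<phi>\<^sub>0] assms
  by (simp add: interv_sum_list_conv_sum_set_nat atLeast0LessThan)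

section \<open>The filtration by degree and its dimensions\<close>

definition filtration :: "nat \<Rightarrow> (complex ^ 's) set"
  where "filtration s = vec.span {foldr E ks \<phi>\<^sub>0 | ks. set ks \<subseteq> {..<m} \<and> length ks \<le> s}"

lemma subspace_filtration: "vec.subspace (filtration s)"
  by (simp add: filtration_def)

lemma foldr_E_eq_foldr_e: "foldr E ks x = foldr e (concat (map (\<lambda>k. [a k, b k]) ks)) x"
  by (induction ks) (simp_all add: E_def)

text \<open>Letters are grouped two by two. Depending on the order of its two indices, a pair is
  zero, some \<open>E l\<close> or its negative.\<close>

lemma foldr_e_in_span:
  "\<lbrakk>set xs \<subseteq> {..<n}; length xs = 2 * k\<rbrakk> \<Longrightarrow>
    foldr e xs \<phi>\<^sub>0 \<in> vec.span {foldr E ks \<phi>\<^sub>0 | ks. set ks \<subseteq> {..<m} \<and> length ks = k}"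
proof (induction k arbitrary: xs)
  case 0
  then show ?case by (auto intro!: vec.span_base exI[of _ "[]"])
next
  case (Suc k)
  let ?S = "\<lambda>k. vec.span {foldr E ks \<phi>\<^sub>0 | ks. set ks \<subseteq> {..<m} \<and> length ks = k}"
  obtain i j ys where xs: "xs = i # j # ys" "length ys = 2 * k"
    using Suc.prems(2) by (metis Suc_length_conv mult_Suc_right add_2_eq_Suc)
  let ?y = "foldr e ys \<phi>\<^sub>0"
  have y: "?y \<in> ?S k" using Suc xs by auto
  have E: "E l v \<in> ?S (Suc k)" if l: "l < m" and "v \<in> ?S k" for l v
    using that(2)
  proof (induction rule: vec.span_induct_alt)
    case base
    then show ?case using l vec.span_zero by simp
  next
    case (step q v w)
    then obtain ks where ks: "v = foldr E ks \<phi>\<^sub>0" "set ks \<subseteq> {..<m}" "length ks = k" by auto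
    then have "E l v \<in> ?S (Suc k)"
      using l by (intro vec.span_base) (auto intro!: exI[of _ "l # ks"])
    then show ?case using l step by (simp add: vec.span_add vec.span_scale)
  qed
  consider "i = j" | "i < j" | "j < i" by linarith
  then show ?case
  proof cases
    case 1
    then show ?thesis using xs Suc.prems vec.span_zero by simp
  next
    case 2
    then obtain l where l: "l < m" "a l = i" "b l = j" using pair_surj[of i j] Suc.prems xs by auto
    then have "foldr e xs \<phi>\<^sub>0 = E l ?y" using xs by (simp add: E_def)
    then show ?thesis using E[OF l(1) y] by simp
  next
    case 3
    then obtain l where l: "l < m" "a l = j" "b l = i" using pair_surj[of j i] Suc.prems xs by auto
    then have "foldr e xs \<phi>\<^sub>0 = - E l ?y" using xs Suc.prems by (simp add: E_def ee[of i j])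
    then show ?thesis using E[OF l(1) y] vec.span_neg by simp
  qed
qed

lemma filtration_eq:
  "filtration s = vec.span {foldr e xs \<phi>\<^sub>0 | xs. set xs \<subseteq> {..<n} \<and> even (length xs) \<and> length xs \<le> 2 * s}"
  (is "_ = vec.span ?M")
proof (rule subset_antisym)
  show "filtration s \<subseteq> vec.span ?M"
    unfolding filtration_def
  proof (rule vec.span_mono, safe)
    fix ks assume ks: "set ks \<subseteq> {..<m}" "length ks \<le> s"
    have "length (concat (map (\<lambda>k. [a k, b k]) ks)) = 2 * length ks"
      by (induction ks) auto
    then show "\<exists>xs. foldr E ks \<phi>\<^sub>0 = foldr e xs \<phi>\<^sub>0 \<and> set xs \<subseteq> {..<n} \<and> even (length xs) \<and> length xs \<le> 2 * s"
      unfolding foldr_E_eq_foldr_e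
      using ks pair_less by (intro exI[of _ "concat (map (\<lambda>k. [a k, b k]) ks)"]) auto
  qed
  show "vec.span ?M \<subseteq> filtration s"
  proof (rule vec.span_minimal)
    show "vec.subspace (filtration s)" by (simp add: filtration_def)
    show "?M \<subseteq> filtration s"
    proof safe
      fix xs assume xs: "set xs \<subseteq> {..<n}" "even (length xs)" "length xs \<le> 2 * s"
      then obtain k where k: "length xs = 2 * k" by blast
      have "vec.span {foldr E ks \<phi>\<^sub>0 | ks. set ks \<subseteq> {..<m} \<and> length ks = k} \<subseteq> filtration s"
        unfolding filtration_def using k xs by (intro vec.span_mono) auto
      then show "foldr e xs \<phi>\<^sub>0 \<in> filtration s"
        using foldr_e_in_span[OF xs(1) k] by blast
    qed
  qed
qed

lemma dim_filtration: "vec.dim (filtration s) = (\<Sum>k=0..s. n choose (2 * k))"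
proof -
  have "vec.dim (filtration s) = card {I. I \<subseteq> {..<n} \<and> (even (card I) \<and> card I \<le> 2 * s)}"
    unfolding filtration_eq
    using span_foldr_e[of "\<lambda>l. even l \<and> l \<le> 2 * s"] dim_span_mon[of "\<lambda>I. even (card I) \<and> card I \<le> 2 * s"]
    by simp
  also have "{I. I \<subseteq> {..<n} \<and> (even (card I) \<and> card I \<le> 2 * s)} =
      (\<Union>k\<in>{0..s}. {I. I \<subseteq> {..<n} \<and> card I = 2 * k})"
    by (auto elim!: evenE)
  also have "card \<dots> = (\<Sum>k=0..s. card {I. I \<subseteq> {..<n} \<and> card I = 2 * k})"
    by (intro card_UN_disjoint) auto
  also have "\<dots> = (\<Sum>k=0..s. n choose (2 * k))"
    by (simp add: n_subsets)
  finally show ?thesis .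
qed

definition even_part :: "(complex ^ 's) set"
  where "even_part = vec.span {foldr e xs \<phi>\<^sub>0 | xs. set xs \<subseteq> {..<n} \<and> even (length xs)}"

lemma subspace_even_part: "vec.subspace even_part"
  by (simp add: even_part_def)

lemma filtration_eq_even_part:
  assumes "n div 2 \<le> s"
  shows "filtration s = even_part"
proof -
  have "{I. I \<subseteq> {..<n} \<and> (even (card I) \<and> card I \<le> 2 * s)} = {I. I \<subseteq> {..<n} \<and> even (card I)}"
  proof -
    have "card I \<le> 2 * s" if "I \<subseteq> {..<n}" "even (card I)" for I
    proof -
      have "card I \<le> n" using card_mono[OF _ that(1)] by simp
      then show ?thesis using assms that(2) by (auto elim!: evenE)
    qed
    then show ?thesis by blast
  qed
  then show ?thesis
    unfolding filtration_eq even_part_def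
    using span_foldr_e[of "\<lambda>l. even l \<and> l \<le> 2 * s"] span_foldr_e[of even] by simp
qed

lemma dim_even_part:
  assumes "n > 0"
  shows "vec.dim even_part = 2 ^ (n - 1)"
proof -
  have "vec.dim even_part = card {I. I \<subseteq> {..<n} \<and> even (card I)}"
    unfolding even_part_def using span_foldr_e[of even] dim_span_mon[of "\<lambda>I. even (card I)"] by simp
  also have "{I. I \<subseteq> {..<n} \<and> even (card I)} = (\<Union>k\<in>{k\<in>{..n}. even k}. {I. I \<subseteq> {..<n} \<and> card I = k})"
    using card_mono[of "{..<n}"] by fastforce
  also have "card \<dots> = (\<Sum>k | k \<in> {..n} \<and> even k. card {I. I \<subseteq> {..<n} \<and> card I = k})"
    by (intro card_UN_disjoint) auto
  also have "\<dots> = (\<Sum>k | k \<in> {..n} \<and> even k. n choose k)"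
    by (simp add: n_subsets)
  also have "\<dots> = (\<Sum>k\<le>n. if even k then n choose k else 0)"
    by (rule sum.inter_filter) simp
  finally have "int (vec.dim even_part) = (\<Sum>k\<le>n. if even k then of_nat (n choose k) else 0)"
    by (simp add: if_distrib cong: if_cong)
  then have "2 * int (vec.dim even_part) = 2 ^ n"
    using choose_even_sum[OF assms, where 'a = int] by simp
  then have "2 * vec.dim even_part = 2 ^ n"
    by (metis (mono_tags, lifting) of_nat_eq_iff of_nat_mult of_nat_numeral of_nat_power)
  then show ?thesis using assms by (cases n) auto
qed

end

subsection \<open>Iterated derivatives of parametrizations\<close>

lemma linear_form_add: "linear_form l \<Longrightarrow> l (x + y) = l x + l y"
  and linear_form_scale: "linear_form l \<Longrightarrow> l (q *s x) = q * l x"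
  by (auto simp: Vector_Spaces.linear_iff)

lemma linear_form_0: "linear_form l \<Longrightarrow> l 0 = 0"
  using linear_form_scale[of l 0 0] by simp

lemma linear_form_sum: "linear_form l \<Longrightarrow> l (\<Sum>k\<in>K. g k) = (\<Sum>k\<in>K. l (g k))"
  by (induction K rule: infinite_finite_induct) (auto simp: linear_form_add linear_form_0)

lemma linear_form_component:
  assumes "linear_form l"
  shows "l x = (\<Sum>k\<in>UNIV. l (axis k 1) * x $ k)"
  using linear_form_sum[OF assms, of "\<lambda>k. x $ k *s axis k 1" UNIV] assms
  by (simp add: basis_expansion linear_form_scale mult.commute)

lemma has_field_derivative_linear_form:
  assumes "linear_form l" "has_componentwise_deriv g g' z"
  shows "((\<lambda>w. l (g w)) has_field_derivative l g') (at z)"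
proof -
  have "((\<lambda>w. \<Sum>k\<in>UNIV. l (axis k 1) * g w $ k) has_field_derivative
      (\<Sum>k\<in>UNIV. l (axis k 1) * g' $ k)) (at z)"
    using assms(2) unfolding has_componentwise_deriv_def by (auto intro!: DERIV_sum DERIV_cmult)
  then show ?thesis by (simp only: linear_form_component[OF assms(1), symmetric])
qed

lemma has_componentwise_deriv_transform:
  assumes "has_componentwise_deriv g g' z" "open S" "z \<in> S" "\<And>w. w \<in> S \<Longrightarrow> g w = h w"
  shows "has_componentwise_deriv h g' z"
  using assms unfolding has_componentwise_deriv_def
  by (metis (no_types, lifting) has_field_derivative_transform_within_open)

lemma has_componentwise_deriv_sum:
  "(\<And>k. k \<in> K \<Longrightarrow> has_componentwise_deriv (g k) (g' k) z) \<Longrightarrow>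
    has_componentwise_deriv (\<lambda>w. \<Sum>k\<in>K. g k w) (\<Sum>k\<in>K. g' k) z"
  by (induction K rule: infinite_finite_induct)
    (auto intro: has_componentwise_deriv_add simp: has_componentwise_deriv_const)

lemma independent_family:
  fixes v :: "nat \<Rightarrow> complex ^ 's"
  assumes "\<And>q. (\<Sum>i<n. q i *s v i) = 0 \<Longrightarrow> \<forall>i<n. q i = 0"
  shows "inj_on v {..<n}" "vec.independent (v ` {..<n})" "vec.dim (vec.span (v ` {..<n})) = n"
proof -
  show inj: "inj_on v {..<n}"
  proof (rule inj_onI, rule ccontr)
    fix i j assume ij: "i \<in> {..<n}" "j \<in> {..<n}" "v i = v j" "i \<noteq> j"
    let ?q = "\<lambda>k. (if k = i then 1 else 0) - (if k = j then 1 else (0::complex))"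
    have "(if P then 1 else 0) *s x = (if P then x else 0)" for P and x :: "complex ^ 's"
      by simp
    then have "(\<Sum>k<n. ?q k *s v k) = v i - v j"
      using ij by (simp add: vec.scale_left_diff_distrib sum_subtractf)
    then show False using assms[of ?q] ij by auto
  qed
  show ind: "vec.independent (v ` {..<n})"
  proof
    assume "vec.dependent (v ` {..<n})"
    then obtain u i where u: "i < n" "u (v i) \<noteq> 0" "(\<Sum>w\<in>v ` {..<n}. u w *s w) = 0"
      using vec.dependent_finite[of "v ` {..<n}"] by auto
    then have "(\<Sum>i<n. u (v i) *s v i) = 0" by (simp add: sum.reindex[OF inj])
    then show False using assms[of "\<lambda>i. u (v i)"] u by blast
  qed
  show "vec.dim (vec.span (v ` {..<n})) = n"
    using vec.dim_span_eq_card_independent[OF ind] card_image[OF inj] by simp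
qed

lemma span_image_lessThan:
  fixes v :: "nat \<Rightarrow> complex ^ 's"
  assumes "inj_on v {..<n}" "x \<in> vec.span (v ` {..<n})"
  obtains q where "x = (\<Sum>i<n. q i *s v i)"
proof -
  obtain u where "x = (\<Sum>w\<in>v ` {..<n}. u w *s w)"
    using assms(2) vec.span_finite[of "v ` {..<n}"] by auto
  then show ?thesis using that[of "\<lambda>i. u (v i)"] by (simp add: sum.reindex[OF assms(1)])
qed

context fock_space
begin

lemma coord_sum_E:
  assumes "k < m"
  shows "coord k (\<Sum>j<m. q j *s E j x) = q k * \<kappa> x"
proof -
  have "coord k (\<Sum>j<m. q j *s E j x) = (\<Sum>j<m. q j * coord k (E j x))"
    using assms by (simp add: coord_sum)
  also have "\<dots> = (\<Sum>j<m. if j = k then q k * \<kappa> x else 0)"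
    using assms by (intro sum.cong) (auto simp: coord_E)
  finally have "coord k (\<Sum>j<m. q j *s E j x) = (\<Sum>j<m. if j = k then q k * \<kappa> x else 0)" .
  then show ?thesis using assms by simp
qed

text \<open>The rows of \<open>H\<close> become vectors in the span of the
  \<open>E k \<phi>\<^sub>0\<close>, with \<open>coord\<close> recovering the entries. They are
  \<open>m\<close> independent vectors, hence span it, and the coefficients of the
  \<open>E j \<phi>\<^sub>0\<close> in terms of them form \<open>G\<close>. This replaces matrix
  inversion by a dimension count, as the size \<open>m\<close> is a number and not a type.\<close>

lemma left_inverse_matrix:
  fixes H :: "nat \<Rightarrow> nat \<Rightarrow> complex"
  assumes "\<And>q. (\<And>k. k < m \<Longrightarrow> (\<Sum>i<m. q i * H i k) = 0) \<Longrightarrow> \<forall>i<m. q i = 0"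
  shows "\<exists>G. \<forall>j<m. \<forall>k<m. (\<Sum>i<m. G j i * H i k) = (if j = k then 1 else 0)"
proof -
  define v where "v = (\<lambda>i. \<Sum>k<m. H i k *s E k \<phi>\<^sub>0)"
  define w where "w = (\<lambda>k. E k \<phi>\<^sub>0)"
  have coordv: "coord k (\<Sum>i<m. q i *s v i) = (\<Sum>i<m. q i * H i k)" if "k < m" for q k
  proof -
    have "coord k (v i) = H i k" for i
      using coord_sum_E[OF that, of "H i" \<phi>\<^sub>0] by (simp add: v_def)
    then show ?thesis using that by (simp add: coord_sum)
  qed
  have v: "\<forall>i<m. q i = 0" if "(\<Sum>i<m. q i *s v i) = 0" for q
    using coordv[of _ q] that by (intro assms) simp
  have "w ` {..<m} \<subseteq> vec.span (v ` {..<m})"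
  proof -
    have "vec.span (w ` {..<m}) \<subseteq> vec.span (v ` {..<m})"
    proof (rule vec.card_ge_dim_independent)
      show "v ` {..<m} \<subseteq> vec.span (w ` {..<m})"
        unfolding v_def w_def
        by (safe, rule vec.span_sum, rule vec.span_scale, rule vec.span_base) auto
      show "vec.independent (v ` {..<m})" by (rule independent_family(2)) (rule v)
      have "vec.dim (vec.span (w ` {..<m})) \<le> card (w ` {..<m})"
        using vec.dim_le_card'[of "w ` {..<m}"] by simp
      also have "\<dots> \<le> m" using card_image_le[of "{..<m}" w] by simp
      also have "m = card (v ` {..<m})"
        using card_image[OF independent_family(1)[of v m, OF v]] by simp
      finally show "vec.dim (vec.span (w ` {..<m})) \<le> card (v ` {..<m})" .
    qed
    then show ?thesis using vec.span_superset[of "w ` {..<m}"] by (rule order_trans[rotated])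
  qed
  then have "\<exists>q. w j = (\<Sum>i<m. q i *s v i)" if "j < m" for j
  proof -
    have "w j \<in> vec.span (v ` {..<m})" using \<open>w ` {..<m} \<subseteq> _\<close> that by auto
    then show ?thesis
      using span_image_lessThan[OF independent_family(1)[of v m, OF v], of "w j"] by metis
  qed
  then obtain G where G: "\<And>j. j < m \<Longrightarrow> w j = (\<Sum>i<m. G j i *s v i)" by metis
  have "(\<Sum>i<m. G j i * H i k) = (if j = k then 1 else 0)" if "j < m" "k < m" for j k
    using coordv[OF that(2), of "G j"] that by (auto simp flip: G simp: w_def coord_E)
  then show ?thesis by blast
qed

lemma linear_foldr_E: "set ks \<subseteq> {..<m} \<Longrightarrow> linear_vec (foldr E ks)"
  by (intro linear_foldr linear_E) auto

text \<open>The remainders that differentiation leaves behind. Their coefficients vary with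
  \<open>t\<close> because remainders are differentiated again. The bound on the length is strict so
  that \<open>s = 0\<close> leaves only the zero function, the remainder of the zeroth
  derivative.\<close>

inductive jet :: "real \<Rightarrow> ((nat \<Rightarrow> complex) \<Rightarrow> complex ^ 's) \<Rightarrow> nat \<Rightarrow>
    ((nat \<Rightarrow> complex) \<Rightarrow> complex ^ 's) \<Rightarrow> bool" for r \<phi> s
  where jet_0: "jet r \<phi> s (\<lambda>_. 0)"
  | jet_term: "\<lbrakk>sep_holo m r c; set ks \<subseteq> {..<m}; length ks < s; jet r \<phi> s g\<rbrakk> \<Longrightarrow>
      jet r \<phi> s (\<lambda>t. c t *s foldr E ks (\<phi> t) + g t)"

lemma jet_single:
  "\<lbrakk>sep_holo m r c; set ks \<subseteq> {..<m}; length ks < s\<rbrakk> \<Longrightarrow> jet r \<phi> s (\<lambda>t. c t *s foldr E ks (\<phi> t))"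
  using jet_term[OF _ _ _ jet_0] by fastforce

lemma jet_add:
  assumes "jet r \<phi> s g" "jet r \<phi> s g'"
  shows "jet r \<phi> s (\<lambda>t. g t + g' t)"
  using assms
proof (induction rule: jet.induct)
  case (jet_term c ks g)
  then have "jet r \<phi> s (\<lambda>t. c t *s foldr E ks (\<phi> t) + (g t + g' t))"
    by (intro jet.jet_term) auto
  then show ?case by (simp add: add.assoc)
qed simp

lemma jet_scale:
  assumes "jet r \<phi> s g" "sep_holo m r d"
  shows "jet r \<phi> s (\<lambda>t. d t *s g t)"
  using assms
proof (induction rule: jet.induct)
  case (jet_term c ks g)
  then have "jet r \<phi> s (\<lambda>t. (d t * c t) *s foldr E ks (\<phi> t) + d t *s g t)"
    by (intro jet.jet_term sep_holo_mult) auto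
  then show ?case by (simp add: vec.scale_right_distrib)
qed (simp add: jet_0)

lemma jet_E:
  assumes "jet r \<phi> s g" "k < m"
  shows "jet r \<phi> (Suc s) (\<lambda>t. E k (g t))"
  using assms
proof (induction rule: jet.induct)
  case (jet_term c ks g)
  then have "jet r \<phi> (Suc s) (\<lambda>t. c t *s foldr E (k # ks) (\<phi> t) + E k (g t))"
    by (intro jet.jet_term) auto
  then show ?case using jet_term by simp
qed (simp add: jet_0)

lemma jet_sum:
  "(\<And>k. k \<in> K \<Longrightarrow> jet r \<phi> s (g k)) \<Longrightarrow> jet r \<phi> s (\<lambda>t. \<Sum>k\<in>K. g k t)"
  by (induction K rule: infinite_finite_induct) (auto intro: jet_0 jet_add)

lemma jet_in_span:
  assumes "jet r \<phi> s g"
  shows "g t \<in> vec.span {foldr E ks (\<phi> t) | ks. set ks \<subseteq> {..<m} \<and> length ks < s}"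
  using assms
  by (induction rule: jet.induct)
    (auto simp: vec.span_zero intro!: vec.span_add vec.span_scale intro: vec.span_base)

end

text \<open>What the induction on the order needs of a parametrization: the linear system that it
  solves, with holomorphic coefficients. The chart \<open>l\<close> and the variety no longer
  occur.\<close>

locale fock_parametrization = fock_space n m e f \<phi>\<^sub>0 a b
  for n m and e f :: "nat \<Rightarrow> complex ^ 's \<Rightarrow> complex ^ 's" and \<phi>\<^sub>0 a b +
  fixes r :: real
    and \<phi> :: "(nat \<Rightarrow> complex) \<Rightarrow> complex ^ 's"
    and u :: "nat \<Rightarrow> (nat \<Rightarrow> complex) \<Rightarrow> complex"
    and H :: "nat \<Rightarrow> nat \<Rightarrow> (nat \<Rightarrow> complex) \<Rightarrow> complex"
  assumes r: "r > 0"
    and u: "i < m \<Longrightarrow> sep_holo m r (u i)"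
    and H: "\<lbrakk>i < m; k < m\<rbrakk> \<Longrightarrow> sep_holo m r (H i k)"
    and \<phi>_deriv: "\<lbrakk>t \<in> polydisc m r; i < m\<rbrakk> \<Longrightarrow>
      has_componentwise_deriv (\<lambda>z. \<phi> (t(i := z))) (u i t *s \<phi> t + (\<Sum>k<m. H i k t *s E k (\<phi> t))) (t i)"
begin

text \<open>The principal part of the partial derivative in direction \<open>i\<close>, the part
  that raises the degree in the \<open>E k\<close>.\<close>

definition \<Omega> :: "(nat \<Rightarrow> complex) \<Rightarrow> nat \<Rightarrow> complex ^ 's \<Rightarrow> complex ^ 's"
  where "\<Omega> t i x = (\<Sum>k<m. H i k t *s E k x)"

lemma linear_\<Omega>: "linear_vec (\<Omega> t i)"
  unfolding \<Omega>_def
  by (intro Vector_Spaces.linear_iff[THEN iffD2])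
    (auto simp: vec.vector_space_axioms vec.scale_right_distrib sum.distrib vec.scale_sum_right mult.commute)

lemma \<Omega>_comm: "\<Omega> t i (\<Omega> t j x) = \<Omega> t j (\<Omega> t i x)"
proof -
  have *: "\<Omega> t i (\<Omega> t j x) = (\<Sum>k<m. \<Sum>l<m. (H i k t * H j l t) *s E k (E l x))" for i j
    unfolding \<Omega>_def by (intro sum.cong) (auto simp: vec.linear_sum[OF linear_E] vec.scale_sum_right)
  have "(\<Sum>k<m. \<Sum>l<m. (H i k t * H j l t) *s E k (E l x)) =
      (\<Sum>l<m. \<Sum>k<m. (H j l t * H i k t) *s E l (E k x))"
    by (subst sum.swap) (intro sum.cong refl, auto simp: mult.commute E_comm)
  then show ?thesis by (simp add: *)
qed

text \<open>Differentiating a coefficient keeps the word; differentiating \<phi> lengthens it by at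
  most one letter, through the linear system.\<close>

lemma jet_deriv:
  assumes "jet r \<phi> s g" "i < m"
  shows "\<exists>g'. jet r \<phi> (Suc s) g' \<and>
    (\<forall>t\<in>polydisc m r. has_componentwise_deriv (\<lambda>z. g (t(i := z))) (g' t) (t i))"
  using assms
proof (induction rule: jet.induct)
  case jet_0
  then show ?case
    by (intro exI[of _ "\<lambda>_. 0"]) (simp add: jet.jet_0 has_componentwise_deriv_const)
next
  case (jet_term c ks g)
  obtain g' where g': "jet r \<phi> (Suc s) g'"
    "\<And>t. t \<in> polydisc m r \<Longrightarrow> has_componentwise_deriv (\<lambda>z. g (t(i := z))) (g' t) (t i)"
    using jet_term.IH[OF jet_term.prems] by blast
  let ?E = "foldr E ks"
  note lin = linear_foldr_E[OF jet_term(2)]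
  let ?d = "\<lambda>t. u i t *s \<phi> t + (\<Sum>k<m. H i k t *s E k (\<phi> t))"
  let ?g = "\<lambda>t. (coord_deriv i c t *s ?E (\<phi> t) + c t *s ?E (?d t)) + g' t"
  have "jet r \<phi> (Suc s) (\<lambda>t. u i t *s ?E (\<phi> t) + (\<Sum>k<m. H i k t *s foldr E (ks @ [k]) (\<phi> t)))"
    using jet_term by (intro jet_add jet_sum jet_single) (auto simp: u H)
  also have "(\<lambda>t. u i t *s ?E (\<phi> t) + (\<Sum>k<m. H i k t *s foldr E (ks @ [k]) (\<phi> t))) = (\<lambda>t. ?E (?d t))"
    by (simp add: vec.linear_add[OF lin] vec.linear_sum[OF lin] vec.linear_scale[OF lin])
  finally have "jet r \<phi> (Suc s) ?g"
    using jet_term by (intro jet_add jet_scale[of _ _ _ "\<lambda>t. ?E (?d t)"] jet_single g'(1) sep_holo_coord_deriv) auto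
  moreover have "has_componentwise_deriv (\<lambda>z. c (t(i := z)) *s ?E (\<phi> (t(i := z))) + g (t(i := z))) (?g t) (t i)"
    if t: "t \<in> polydisc m r" for t
    using has_componentwise_deriv_add[OF has_componentwise_deriv_scale[OF
          sep_holo_has_derivative[OF jet_term(1) t jet_term(6)]
          has_componentwise_deriv_linear[OF lin \<phi>_deriv[OF t jet_term(6)]]] g'(2)[OF t]]
    by simp
  ultimately show ?case by blast
qed

definition lead :: "nat list \<Rightarrow> (nat \<Rightarrow> complex) \<Rightarrow> complex ^ 's"
  where "lead is t = foldr (\<Omega> t) is (\<phi> t)"

lemma lead_simps [simp]: "lead [] t = \<phi> t" "lead (i # is) t = \<Omega> t i (lead is t)"
  by (simp_all add: lead_def)

lemma jet_\<Omega>: "\<lbrakk>jet r \<phi> s g; i < m\<rbrakk> \<Longrightarrow> jet r \<phi> (Suc s) (\<lambda>t. \<Omega> t i (g t))"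
  unfolding \<Omega>_def by (intro jet_sum jet_scale jet_E H) auto

lemma jet_lead: "set is \<subseteq> {..<m} \<Longrightarrow> jet r \<phi> (Suc (length is)) (lead is)"
proof (induction "is")
  case Nil
  show ?case using jet_single[of r "\<lambda>_. 1" "[]" "Suc 0" \<phi>] by (simp add: lead_def)
next
  case (Cons i "is")
  moreover have "lead (i # is) = (\<lambda>t. \<Omega> t i (lead is t))" by (rule ext) simp
  ultimately show ?case using jet_\<Omega>[of _ "lead is" i] by simp
qed

text \<open>The new operator first appears innermost, next to \<phi>, and
  \<open>\<Omega>_comm\<close> moves it to the front. Everything else, the derivatives of
  \<open>H\<close> and the multiple \<open>u i\<close> of \<phi>, has no more letters than
  \<open>is\<close>.\<close>

lemma lead_deriv:
  assumes "i < m"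
  shows "set is \<subseteq> {..<m} \<Longrightarrow> \<exists>g. jet r \<phi> (Suc (length is)) g \<and> (\<forall>t\<in>polydisc m r.
    has_componentwise_deriv (\<lambda>z. lead is (t(i := z))) (lead (i # is) t + g t) (t i))"
proof (induction "is")
  case Nil
  have "jet r \<phi> (Suc (length [])) (\<lambda>t. u i t *s \<phi> t)"
    using jet_single[of r "u i" "[]" "Suc 0" \<phi>] assms by (simp add: u)
  moreover have "has_componentwise_deriv (\<lambda>z. lead [] (t(i := z))) (lead [i] t + u i t *s \<phi> t) (t i)"
    if "t \<in> polydisc m r" for t
    using \<phi>_deriv[OF that assms] by (simp add: \<Omega>_def add.commute)
  ultimately show ?case by blast
next
  case (Cons j "is")
  then have j: "j < m" and "is": "set is \<subseteq> {..<m}" by auto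
  obtain g where g: "jet r \<phi> (Suc (length is)) g" "\<And>t. t\<in>polydisc m r \<Longrightarrow>
      has_componentwise_deriv (\<lambda>z. lead is (t(i := z))) (lead (i # is) t + g t) (t i)"
    using Cons.IH[OF "is"] by blast
  let ?g = "\<lambda>t. (\<Sum>k<m. coord_deriv i (H j k) t *s E k (lead is t)) + \<Omega> t j (g t)"
  have "jet r \<phi> (Suc (length (j # is))) ?g"
    unfolding list.size add_Suc_right add_0_right using assms j by (intro jet_add jet_sum jet_scale[of _ _ _ "\<lambda>t. E _ (lead is t)"] jet_E jet_lead "is" jet_\<Omega> g
        sep_holo_coord_deriv H) auto
  moreover have "has_componentwise_deriv (\<lambda>z. lead (j # is) (t(i := z))) (lead (i # j # is) t + ?g t) (t i)"
    if t: "t \<in> polydisc m r" for t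
  proof -
    have "has_componentwise_deriv (\<lambda>z. \<Sum>k<m. H j k (t(i := z)) *s E k (lead is (t(i := z))))
      (\<Sum>k<m. coord_deriv i (H j k) t *s E k (lead is (t(i := t i))) +
        H j k (t(i := t i)) *s E k (lead (i # is) t + g t)) (t i)"
      using H j t assms
      by (intro has_componentwise_deriv_sum has_componentwise_deriv_scale
          has_componentwise_deriv_linear[OF linear_E] g(2)) (auto intro: sep_holo_has_derivative)
    also have "(\<Sum>k<m. coord_deriv i (H j k) t *s E k (lead is (t(i := t i))) +
        H j k (t(i := t i)) *s E k (lead (i # is) t + g t)) =
        (\<Sum>k<m. coord_deriv i (H j k) t *s E k (lead is t)) + \<Omega> t j (lead (i # is) t + g t)"
      by (simp add: \<Omega>_def sum.distrib)
    also have "\<Omega> t j (lead (i # is) t + g t) = lead (i # j # is) t + \<Omega> t j (g t)"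
      using \<Omega>_comm[of t j i "lead is t"] by (simp add: vec.linear_add[OF linear_\<Omega>])
    finally have "has_componentwise_deriv (\<lambda>z. lead (j # is) (t(i := z)))
        ((\<Sum>k<m. coord_deriv i (H j k) t *s E k (lead is t)) +
          (lead (i # j # is) t + \<Omega> t j (g t))) (t i)"
      by (simp only: lead_simps \<Omega>_def)
    then show ?thesis by (subst add.left_commute)
  qed
  ultimately show ?case by blast
qed

lemma iterated_deriv:
  "set is \<subseteq> {..<m} \<Longrightarrow> \<exists>g. jet r \<phi> (length is) g \<and>
    (\<forall>t\<in>polydisc m r. foldr partial_deriv is \<phi> t = lead is t + g t)"
proof (induction "is")
  case Nil
  show ?case by (intro exI[of _ "\<lambda>_. 0"]) (simp add: jet_0)
next
  case (Cons i "is")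
  then have i: "i < m" and "is": "set is \<subseteq> {..<m}" by auto
  obtain g where g: "jet r \<phi> (length is) g"
    "\<And>t. t\<in>polydisc m r \<Longrightarrow> foldr partial_deriv is \<phi> t = lead is t + g t"
    using Cons.IH[OF "is"] by blast
  obtain g1 where g1: "jet r \<phi> (Suc (length is)) g1" "\<And>t. t\<in>polydisc m r \<Longrightarrow>
      has_componentwise_deriv (\<lambda>z. lead is (t(i := z))) (lead (i # is) t + g1 t) (t i)"
    using lead_deriv[OF i "is"] by blast
  obtain g2 where g2: "jet r \<phi> (Suc (length is)) g2" "\<And>t. t\<in>polydisc m r \<Longrightarrow>
      has_componentwise_deriv (\<lambda>z. g (t(i := z))) (g2 t) (t i)"
    using jet_deriv[OF g(1) i] by blast
  have "foldr partial_deriv (i # is) \<phi> t = lead (i # is) t + (g1 t + g2 t)" if t: "t \<in> polydisc m r" for t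
  proof -
    have "has_componentwise_deriv (\<lambda>z. lead is (t(i := z)) + g (t(i := z)))
        (lead (i # is) t + g1 t + g2 t) (t i)"
      by (intro has_componentwise_deriv_add g1 g2 t)
    then have "has_componentwise_deriv (\<lambda>z. foldr partial_deriv is \<phi> (t(i := z)))
        (lead (i # is) t + g1 t + g2 t) (t i)"
    proof (rule has_componentwise_deriv_transform)
      \<comment> \<open>The induction hypothesis holds on the polydisc only, whose slice in
        direction \<open>i\<close> is this disc.\<close>
      show "open (ball 0 r :: complex set)" by simp
      show "t i \<in> ball 0 r" using t i by (simp add: polydisc_def)
      show "lead is (t(i := w)) + g (t(i := w)) = foldr partial_deriv is \<phi> (t(i := w))" if "w \<in> ball 0 r" for w
        using g(2)[OF polydisc_update[OF t i]] that by simp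
    qed
    then show ?thesis by (simp add: partial_deriv_eqI add.assoc)
  qed
  then show ?case using jet_add[OF g1(1) g2(1)] by (intro exI[of _ "\<lambda>t. g1 t + g2 t"]) simp
qed

end

text \<open>The affine space contains its base point and the base point plus each direction, so its
  linear span contains both. The base point is the derivative of order zero, given by the empty
  list.\<close>

lemma span_affine_osculating_space:
  "vec.span (affine_osculating_space m s \<phi>) =
    vec.span {foldr partial_deriv is \<phi> (\<lambda>_. 0) | is. set is \<subseteq> {..<m} \<and> length is < Suc s}"
  (is "_ = vec.span ?D")
proof -
  let ?D1 = "{foldr partial_deriv is \<phi> (\<lambda>_. 0) | is. set is \<subseteq> {..<m} \<and> 1 \<le> length is \<and> length is \<le> s}"
  have D: "?D = insert (\<phi> (\<lambda>_. 0)) ?D1"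
  proof (rule subset_antisym; rule subsetI)
    fix x assume "x \<in> ?D"
    then obtain "is" where "is": "x = foldr partial_deriv is \<phi> (\<lambda>_. 0)" "set is \<subseteq> {..<m}" "length is < Suc s"
      by blast
    show "x \<in> insert (\<phi> (\<lambda>_. 0)) ?D1"
    proof (cases "is = []")
      case False
      then have "1 \<le> length is" by (simp add: Suc_leI)
      then have "x \<in> ?D1" using "is" by (intro CollectI exI[of _ "is"]) simp
      then show ?thesis by blast
    qed (use "is" in simp)
  next
    fix x assume "x \<in> insert (\<phi> (\<lambda>_. 0)) ?D1"
    then show "x \<in> ?D"
    proof
      assume "x = \<phi> (\<lambda>_. 0)"
      then show ?thesis by (intro CollectI exI[of _ "[]"]) simp
    next
      assume "x \<in> ?D1"
      then obtain "is" where "x = foldr partial_deriv is \<phi> (\<lambda>_. 0)" "set is \<subseteq> {..<m}" "length is \<le> s"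
        by blast
      then show ?thesis by (intro CollectI exI[of _ "is"]) simp
    qed
  qed
  have A: "affine_osculating_space m s \<phi> = {\<phi> (\<lambda>_. 0) + d | d. d \<in> vec.span ?D1}"
    unfolding affine_osculating_space_def ..
  show ?thesis
  proof (rule subset_antisym)
    show "vec.span (affine_osculating_space m s \<phi>) \<subseteq> vec.span ?D"
    proof (rule vec.span_minimal[OF _ vec.subspace_span])
      show "affine_osculating_space m s \<phi> \<subseteq> vec.span ?D"
      proof
        fix x assume "x \<in> affine_osculating_space m s \<phi>"
        then obtain d where d: "x = \<phi> (\<lambda>_. 0) + d" "d \<in> vec.span ?D1" unfolding A by blast
        have "d \<in> vec.span ?D" unfolding D by (rule subsetD[OF vec.span_mono[OF subset_insertI] d(2)])
        then show "x \<in> vec.span ?D"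
          unfolding d(1) D by (intro vec.span_add vec.span_base[OF insertI1])
      qed
    qed
    have 0: "\<phi> (\<lambda>_. 0) \<in> affine_osculating_space m s \<phi>"
      unfolding A using vec.span_zero by (intro CollectI exI[of _ 0]) simp
    have "d \<in> vec.span (affine_osculating_space m s \<phi>)" if "d \<in> ?D1" for d
    proof -
      have "\<phi> (\<lambda>_. 0) + d \<in> affine_osculating_space m s \<phi>"
        unfolding A using vec.span_base[OF that] by blast
      then have "\<phi> (\<lambda>_. 0) + d - \<phi> (\<lambda>_. 0) \<in> vec.span (affine_osculating_space m s \<phi>)"
        using 0 by (intro vec.span_diff vec.span_base)
      then show ?thesis by simp
    qed
    then show "vec.span ?D \<subseteq> vec.span (affine_osculating_space m s \<phi>)"
      unfolding D using 0 by (intro vec.span_minimal vec.subspace_span) (auto intro: vec.span_base)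
  qed
qed

context fock_parametrization
begin

abbreviation "origin \<equiv> (\<lambda>_. 0 :: complex)"

lemma origin_polydisc: "origin \<in> polydisc m r"
  using r by (simp add: polydisc_def tuples_def)

text \<open>With \<open>G\<close> inverse to \<open>H\<close> at the origin, each \<open>E j\<close>
  is a combination of the operators \<open>\<Omega> origin i\<close>; a product of such combinations
  expands into leading terms of the same length.\<close>

lemma foldr_E_in_span_lead:
  assumes G: "\<And>j k. \<lbrakk>j < m; k < m\<rbrakk> \<Longrightarrow> (\<Sum>i<m. G j i * H i k origin) = (if j = k then 1 else 0)"
  shows "set ks \<subseteq> {..<m} \<Longrightarrow>
    foldr E ks (\<phi> origin) \<in> vec.span {lead is origin | is. set is \<subseteq> {..<m} \<and> length is = length ks}"
proof (induction ks)
  case Nil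
  then show ?case by (auto intro!: vec.span_base exI[of _ "[]"])
next
  case (Cons j ks)
  let ?S = "\<lambda>l. vec.span {lead is origin | is. set is \<subseteq> {..<m} \<and> length is = l}"
  have E: "E j x = (\<Sum>i<m. G j i *s \<Omega> origin i x)" if j: "j < m" for x
  proof -
    have "(\<Sum>i<m. G j i *s \<Omega> origin i x) = (\<Sum>k<m. \<Sum>i<m. (G j i * H i k origin) *s E k x)"
      unfolding \<Omega>_def by (subst sum.swap) (simp add: vec.scale_sum_right)
    also have "\<dots> = (\<Sum>k<m. (if j = k then 1 else 0) *s E k x)"
      by (intro sum.cong refl) (simp only: vec.scale_sum_left[symmetric] G[OF j] lessThan_iff)
    also have "\<dots> = (\<Sum>k<m. if j = k then E k x else 0)"
      by (intro sum.cong) auto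
    finally show ?thesis using j by simp
  qed
  have \<Omega>: "\<Omega> origin i v \<in> ?S (Suc l)" if i: "i < m" and v: "v \<in> ?S l" for i v l
    using v
  proof (induction rule: vec.span_induct_alt)
    case base
    then show ?case using vec.linear_0[OF linear_\<Omega>] vec.span_zero by simp
  next
    case (step q v w)
    then obtain "is" where "is": "v = lead is origin" "set is \<subseteq> {..<m}" "length is = l" by blast
    then have "\<Omega> origin i v = lead (i # is) origin" by simp
    then have "\<Omega> origin i v \<in> ?S (Suc l)"
      using i "is" by (intro vec.span_base CollectI exI[of _ "i # is"]) simp
    then show ?case
      using step by (simp add: vec.linear_add[OF linear_\<Omega>] vec.linear_scale[OF linear_\<Omega>] vec.span_add vec.span_scale)
  qed
  have "foldr E (j # ks) (\<phi> origin) = (\<Sum>i<m. G j i *s \<Omega> origin i (foldr E ks (\<phi> origin)))"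
    using Cons.prems by (simp add: E)
  also have "\<dots> \<in> ?S (Suc (length ks))"
    using Cons by (intro vec.span_sum vec.span_scale \<Omega>) auto
  finally show ?case by simp
qed

text \<open>Derivatives and words in the \<open>E k\<close> agree up to shorter words and an
  invertible change of the leading terms. Since the comparison is triangular, the reverse inclusion
  goes by induction on \<open>s\<close>.\<close>

lemma span_derivs:
  assumes G: "\<And>j k. \<lbrakk>j < m; k < m\<rbrakk> \<Longrightarrow> (\<Sum>i<m. G j i * H i k origin) = (if j = k then 1 else 0)"
  shows "vec.span {foldr partial_deriv is \<phi> origin | is. set is \<subseteq> {..<m} \<and> length is < s} =
    vec.span {foldr E ks (\<phi> origin) | ks. set ks \<subseteq> {..<m} \<and> length ks < s}"
    (is "vec.span (?D s) = vec.span (?F s)")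
proof (rule subset_antisym)
  have mono: "x \<in> vec.span (?F s')" if "x \<in> vec.span (?F s)" "s \<le> s'" for x s s'
  proof -
    have "?F s \<subseteq> ?F s'" using that(2) by fastforce
    then show ?thesis using that(1) vec.span_mono by blast
  qed
  have D: "\<exists>g. foldr partial_deriv is \<phi> origin = lead is origin + g \<and> g \<in> vec.span (?F (length is))"
    if "set is \<subseteq> {..<m}" for "is"
    using iterated_deriv[OF that] jet_in_span[of r \<phi> _ _ origin] origin_polydisc by meson
  have "x \<in> vec.span (?F s)" if x: "x \<in> ?D s" for x
  proof -
    obtain "is" where "is": "x = foldr partial_deriv is \<phi> origin" "set is \<subseteq> {..<m}" "length is < s"
      using x by blast
    obtain g where g: "x = lead is origin + g" "g \<in> vec.span (?F (length is))"
      using D[OF "is"(2)] "is"(1) by blast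
    have "lead is origin \<in> vec.span (?F (Suc (length is)))"
      by (rule jet_in_span[OF jet_lead[OF "is"(2)]])
    then have "lead is origin \<in> vec.span (?F s)" by (rule mono) (use "is" in simp)
    moreover have "g \<in> vec.span (?F s)" using g(2) by (rule mono) (use "is" in simp)
    ultimately show ?thesis unfolding g(1) by (rule vec.span_add)
  qed
  then show "vec.span (?D s) \<subseteq> vec.span (?F s)"
    by (intro vec.span_minimal vec.subspace_span subsetI)
  show "vec.span (?F s) \<subseteq> vec.span (?D s)"
  proof (induction s)
    case (Suc s)
    have sub: "vec.span (?D s) \<subseteq> vec.span (?D (Suc s))"
      by (intro vec.span_mono) fastforce
    have lead: "lead is origin \<in> vec.span (?D (Suc s))" if "is": "set is \<subseteq> {..<m}" "length is = s" for "is"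
    proof -
      obtain g where g: "foldr partial_deriv is \<phi> origin = lead is origin + g" "g \<in> vec.span (?F s)"
        using D[OF "is"(1)] "is"(2) by blast
      have "foldr partial_deriv is \<phi> origin \<in> ?D (Suc s)" using "is" by auto
      moreover have "g \<in> vec.span (?D (Suc s))" using Suc sub g(2) by blast
      ultimately have "foldr partial_deriv is \<phi> origin - g \<in> vec.span (?D (Suc s))"
        by (intro vec.span_diff[OF vec.span_base])
      then show ?thesis using g(1) by simp
    qed
    have "x \<in> vec.span (?D (Suc s))" if x: "x \<in> ?F (Suc s)" for x
    proof -
      obtain ks where ks: "x = foldr E ks (\<phi> origin)" "set ks \<subseteq> {..<m}" "length ks < Suc s"
        using x by blast
      show ?thesis
      proof (cases "length ks = s")
        case True
        have "vec.span {lead is origin | is. set is \<subseteq> {..<m} \<and> length is = length ks} \<subseteq> vec.span (?D (Suc s))"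
          using lead True by (intro vec.span_minimal vec.subspace_span subsetI) blast
        then show ?thesis using foldr_E_in_span_lead[OF G ks(2)] ks(1) by blast
      next
        case False
        then have "x \<in> ?F s" using ks by (intro CollectI exI[of _ ks]) simp
        then have "x \<in> vec.span (?F s)" by (rule vec.span_base)
        then show ?thesis using Suc sub by blast
      qed
    qed
    then show ?case by (intro vec.span_minimal vec.subspace_span subsetI)
  qed simp
qed

end

lemma continuous_on_linear_form: "linear_form l \<Longrightarrow> continuous_on S l"
  by (subst continuous_on_cong[OF refl linear_form_component]) (auto intro!: continuous_intros)

lemma sep_holo_linear_form:
  assumes "linear_form l" "\<And>k. sep_holo m r (\<lambda>t. \<phi> t $ k)"
  shows "sep_holo m r (\<lambda>t. l (\<phi> t))"
proof -
  have "sep_holo m r (\<lambda>t. \<Sum>k\<in>UNIV. l (axis k 1) * \<phi> t $ k)"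
    by (intro sep_holo_sum sep_holo_mult sep_holo_const assms)
  then show ?thesis by (simp only: linear_form_component[OF assms(1), symmetric])
qed

context fock_space
begin

lemma linear_coord: "k < m \<Longrightarrow> linear_form (coord k)"
  by (rule Vector_Spaces.linear_iff[THEN iffD2])
    (auto simp: vec.vector_space_axioms vector_space_def algebra_simps)

lemma filtration_eq_scaled:
  assumes "q \<noteq> 0"
  shows "filtration s = vec.span {foldr E ks (q *s \<phi>\<^sub>0) | ks. set ks \<subseteq> {..<m} \<and> length ks < Suc s}"
    (is "_ = vec.span ?F")
proof -
  have eq: "foldr E ks (q *s x) = q *s foldr E ks x" if "set ks \<subseteq> {..<m}" for ks q x
    using vec.linear_scale[OF linear_foldr_E[OF that]] .
  show ?thesis
    unfolding filtration_def
  proof (rule subset_antisym; rule vec.span_minimal[OF _ vec.subspace_span]; safe)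
    fix ks assume ks: "set ks \<subseteq> {..<m}" "length ks \<le> s"
    then have "foldr E ks (q *s \<phi>\<^sub>0) \<in> vec.span ?F" by (auto intro!: vec.span_base)
    then have "inverse q *s foldr E ks (q *s \<phi>\<^sub>0) \<in> vec.span ?F" by (rule vec.span_scale)
    then show "foldr E ks \<phi>\<^sub>0 \<in> vec.span ?F" using eq[OF ks(1)] assms by simp
  next
    fix ks assume ks: "set ks \<subseteq> {..<m}" "length ks < Suc s"
    then show "foldr E ks (q *s \<phi>\<^sub>0) \<in>
        vec.span {foldr E ks \<phi>\<^sub>0 | ks. set ks \<subseteq> {..<m} \<and> length ks \<le> s}"
      unfolding eq[OF ks(1)] by (intro vec.span_scale vec.span_base CollectI exI[of _ ks]) simp
  qed
qed

text \<open>Passes from an arbitrary parametrization to the linear system. The geometry of the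
  variety enters through \<open>chart\<close>: where \<kappa> is nonzero, the points are multiples
  of exponentials.\<close>

theorem span_affine_osculating_space_parametrization:
  assumes l: "linear_form l"
    and U: "openin (top_of_set (tuples m)) U" "(\<lambda>_. 0) \<in> U"
    and \<phi>0: "vec.span {\<phi> (\<lambda>_. 0)} = vec.span {\<phi>\<^sub>0}"
    and holo: "holomorphic_several m U \<phi>"
    and l1: "\<And>t. t \<in> U \<Longrightarrow> l (\<phi> t) = 1"
    and chart: "\<And>t. \<lbrakk>t \<in> U; \<kappa> (\<phi> t) \<noteq> 0\<rbrakk> \<Longrightarrow>
      \<phi> t = \<kappa> (\<phi> t) *s pure (\<lambda>k. coord k (\<phi> t) / \<kappa> (\<phi> t))"
    and imm: "\<And>q. (\<Sum>i<m. q i *s partial_deriv i \<phi> (\<lambda>_. 0)) = 0 \<Longrightarrow> \<forall>i<m. q i = 0"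
  shows "vec.span (affine_osculating_space m s \<phi>) = filtration s"
proof -
  let ?o = "\<lambda>_. 0 :: complex"
  have "\<phi> ?o \<in> vec.span {\<phi>\<^sub>0}" using \<phi>0 vec.span_base by blast
  then obtain q where q: "\<phi> ?o = q *s \<phi>\<^sub>0" by (auto simp: vec.span_singleton)
  have q0: "q \<noteq> 0" using l1[OF U(2)] q linear_form_0[OF l] by auto
  \<comment> \<open>At the origin \<kappa> takes the value \<open>q\<close>, so half of
    \<open>norm q\<close> leaves room. This lower bound makes the inverse of \<kappa> holomorphic;
    the upper bound on the norm gives local boundedness.\<close>
  define A where "A = {x. norm (\<kappa> x) > norm q / 2} \<inter> {x. norm x < norm (\<phi> ?o) + 1}"
  have "open A"
    unfolding A_def
    by (intro open_Int open_Collect_less continuous_intros continuous_on_linear_form linear_\<kappa>)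
  then have "openin (top_of_set U) (U \<inter> \<phi> -` A)"
    using holo unfolding holomorphic_several_def by (intro continuous_openin_preimage_gen) auto
  then have "openin (top_of_set (tuples m)) (U \<inter> \<phi> -` A)" using U(1) openin_trans by blast
  moreover have "?o \<in> U \<inter> \<phi> -` A" using U q q0 by (simp add: A_def)
  ultimately obtain r where rU: "r > 0" "polydisc m r \<subseteq> U \<inter> \<phi> -` A"
    using open_tuples_contains_polydisc by blast
  have hol: "sep_holo m r (\<lambda>t. \<phi> t $ k)" for k
    unfolding sep_holo_def
  proof (intro conjI loc_boundedI)
    fix t assume "t \<in> polydisc m r"
    then have "norm (\<phi> t) < norm (\<phi> ?o) + 1" using rU(2) by (auto simp: A_def)
    then show "norm (\<phi> t $ k) \<le> norm (\<phi> ?o) + 1"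
      using Finite_Cartesian_Product.norm_nth_le[of "\<phi> t" k] by linarith
  qed (use holo rU(2) in \<open>auto simp: holomorphic_several_def\<close>)
  let ?\<mu> = "\<lambda>t. \<kappa> (\<phi> t)"
  have \<mu>: "sep_holo m r ?\<mu>" by (rule sep_holo_linear_form[OF linear_\<kappa> hol])
  have \<mu>0: "?\<mu> t \<noteq> 0" and \<mu>_ge: "norm (?\<mu> t) \<ge> norm q / 2" if "t \<in> polydisc m r" for t
    using rU(2) that q0 by (auto simp: A_def)
  have inv: "sep_holo m r (\<lambda>t. inverse (?\<mu> t))"
    by (rule sep_holo_inverse[OF \<mu> \<mu>_ge]) (use q0 in auto)
  \<comment> \<open>Dividing by \<kappa> removes the dependence on the normalization by
    \<open>l\<close>.\<close>
  define h where "h = (\<lambda>k t. coord k (\<phi> t) * inverse (?\<mu> t))"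
  have h: "sep_holo m r (h k)" if "k < m" for k
    unfolding h_def by (intro sep_holo_mult inv sep_holo_linear_form[OF linear_coord hol] that)
  define u where "u = (\<lambda>i t. coord_deriv i ?\<mu> t * inverse (?\<mu> t))"
  define H where "H = (\<lambda>i k. coord_deriv i (h k))"
  have \<phi>_eq: "\<phi> t = ?\<mu> t *s pure (\<lambda>k. h k t)" if "t \<in> polydisc m r" for t
    using chart[of t] \<mu>0[OF that] rU(2) that by (auto simp: h_def divide_inverse)
  have deriv: "has_componentwise_deriv (\<lambda>z. \<phi> (t(i := z))) (u i t *s \<phi> t + (\<Sum>k<m. H i k t *s E k (\<phi> t))) (t i)"
    if t: "t \<in> polydisc m r" and i: "i < m" for t i
  proof -
    have "has_componentwise_deriv (\<lambda>z. ?\<mu> (t(i := z)) *s pure (\<lambda>k. h k (t(i := z))))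
      (coord_deriv i ?\<mu> t *s pure (\<lambda>k. h k (t(i := t i))) +
        ?\<mu> (t(i := t i)) *s (\<Sum>k<m. H i k t *s E k (pure (\<lambda>k. h k (t(i := t i)))))) (t i)"
      unfolding H_def
      by (intro has_componentwise_deriv_scale has_componentwise_deriv_Exp_m
          sep_holo_has_derivative[OF _ t i] \<mu> h)
    moreover have "coord_deriv i ?\<mu> t *s pure (\<lambda>k. h k (t(i := t i))) = u i t *s \<phi> t"
    proof -
      have "u i t *s \<phi> t = u i t *s (?\<mu> t *s pure (\<lambda>k. h k t))"
        using \<phi>_eq[OF t] by (rule arg_cong)
      also have "\<dots> = coord_deriv i ?\<mu> t *s pure (\<lambda>k. h k t)"
        using \<mu>0[OF t] by (simp add: u_def)
      finally show ?thesis by simp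
    qed
    moreover have "?\<mu> (t(i := t i)) *s (\<Sum>k<m. H i k t *s E k (pure (\<lambda>k. h k (t(i := t i))))) =
        (\<Sum>k<m. H i k t *s E k (\<phi> t))"
    proof -
      have "(\<Sum>k<m. H i k t *s E k (\<phi> t)) = (\<Sum>k<m. H i k t *s E k (?\<mu> t *s pure (\<lambda>k. h k t)))"
        by (intro sum.cong refl arg_cong[where f = "E _"] arg_cong[where f = "(*s) _"] \<phi>_eq t)
      also have "\<dots> = ?\<mu> t *s (\<Sum>k<m. H i k t *s E k (pure (\<lambda>k. h k t)))"
        by (simp add: vec.scale_sum_right mult.commute)
      finally show ?thesis by simp
    qed
    ultimately have "has_componentwise_deriv (\<lambda>z. ?\<mu> (t(i := z)) *s pure (\<lambda>k. h k (t(i := z))))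
      (u i t *s \<phi> t + (\<Sum>k<m. H i k t *s E k (\<phi> t))) (t i)" by simp
    then show ?thesis
    proof (rule has_componentwise_deriv_transform)
      show "open (ball 0 r :: complex set)" by simp
      show "t i \<in> ball 0 r" using t i by (simp add: polydisc_def)
      fix w :: complex assume "w \<in> ball 0 r"
      then show "?\<mu> (t(i := w)) *s pure (\<lambda>k. h k (t(i := w))) = \<phi> (t(i := w))"
        using \<phi>_eq[OF polydisc_update[OF t i]] by simp
    qed
  qed
  interpret fock_parametrization n m e f \<phi>\<^sub>0 a b r \<phi> u H
  proof
    show "r > 0" by fact
    show "sep_holo m r (u i)" if "i < m" for i
      unfolding u_def by (intro sep_holo_mult inv sep_holo_coord_deriv \<mu> that)
    show "sep_holo m r (H i k)" if "i < m" "k < m" for i k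
      unfolding H_def by (intro sep_holo_coord_deriv h that)
  qed (rule deriv)
  have "\<exists>G. \<forall>j<m. \<forall>k<m. (\<Sum>i<m. G j i * H i k ?o) = (if j = k then 1 else 0)"
  proof (rule left_inverse_matrix)
    fix p assume p: "\<And>k. k < m \<Longrightarrow> (\<Sum>i<m. p i * H i k ?o) = 0"
    let ?d = "\<lambda>i. u i ?o *s \<phi> ?o + (\<Sum>k<m. H i k ?o *s E k (\<phi> ?o))"
    have d: "has_componentwise_deriv (\<lambda>z. \<phi> (?o(i := z))) (?d i) (?o i)" if "i < m" for i
      using deriv[OF origin_polydisc that] .
    have pd: "partial_deriv i \<phi> ?o = ?d i" if "i < m" for i
      using d[OF that] by (rule partial_deriv_eqI)
    have ld: "l (?d i) = 0" if i: "i < m" for i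
    proof -
      have "((\<lambda>z. l (\<phi> (?o(i := z)))) has_field_derivative l (?d i)) (at 0)"
        using has_field_derivative_linear_form[OF l d[OF i]] .
      moreover have "((\<lambda>z. l (\<phi> (?o(i := z)))) has_field_derivative 0) (at 0)"
      proof (rule has_field_derivative_transform_within_open)
        show "((\<lambda>_. 1) has_field_derivative 0) (at (0::complex))" by simp
        show "open (ball 0 r :: complex set)" "0 \<in> ball (0::complex) r" using rU(1) by auto
        fix z :: complex assume "z \<in> ball 0 r"
        then have "?o(i := z) \<in> U" using polydisc_update[OF origin_polydisc i, of z] rU(2) by auto
        then show "1 = l (\<phi> (?o(i := z)))" using l1 by simp
      qed
      ultimately show ?thesis by (rule DERIV_unique)
    qed
    have "(\<Sum>i<m. p i *s (\<Sum>k<m. H i k ?o *s E k (\<phi> ?o))) =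
        (\<Sum>k<m. \<Sum>i<m. (p i * H i k ?o) *s E k (\<phi> ?o))"
      by (subst sum.swap) (simp add: vec.scale_sum_right)
    also have "\<dots> = 0"
      by (rule sum.neutral, rule ballI)
        (simp only: vec.scale_sum_left[symmetric] p lessThan_iff vec.scale_zero_left)
    finally have "(\<Sum>i<m. p i *s ?d i) = (\<Sum>i<m. p i * u i ?o) *s \<phi> ?o"
      by (simp add: vec.scale_right_distrib sum.distrib vec.scale_sum_left)
    note eq = this
    have "l (\<Sum>i<m. p i *s ?d i) = (\<Sum>i<m. p i * l (?d i))"
      by (simp only: linear_form_sum[OF l] linear_form_scale[OF l])
    also have "\<dots> = 0"
      by (rule sum.neutral, rule ballI) (simp only: ld lessThan_iff mult_zero_right)
    finally have "(\<Sum>i<m. p i * u i ?o) = 0"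
      using l1[OF U(2)] unfolding eq linear_form_scale[OF l] by simp
    then have "(\<Sum>i<m. p i *s ?d i) = 0" unfolding eq by simp
    then show "\<forall>i<m. p i = 0" by (intro imm) (simp add: pd)
  qed
  then obtain G where "\<And>j k. \<lbrakk>j < m; k < m\<rbrakk> \<Longrightarrow> (\<Sum>i<m. G j i * H i k ?o) = (if j = k then 1 else 0)"
    by blast
  from span_derivs[OF this, of "Suc s"] show ?thesis
    unfolding span_affine_osculating_space filtration_eq_scaled[OF q0] q[symmetric] .
qed

end

subsection \<open>Isotropic subspaces and pure spinors\<close>

lemma polar_commute: "polar Q u v = polar Q v u"
  by (simp add: polar_def add.commute)

lemma linear_polar: "quadratic_form Q \<Longrightarrow> linear_form (polar Q u)"
  by (simp add: quadratic_form_def)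

lemma polar_add_right: "quadratic_form Q \<Longrightarrow> polar Q u (v + w) = polar Q u v + polar Q u w"
  and polar_scale_right: "quadratic_form Q \<Longrightarrow> polar Q u (q *s v) = q * polar Q u v"
  and polar_zero_right: "quadratic_form Q \<Longrightarrow> polar Q u 0 = 0"
  and polar_sum_right: "quadratic_form Q \<Longrightarrow> polar Q u (\<Sum>k\<in>K. g k) = (\<Sum>k\<in>K. polar Q u (g k))"
  using linear_polar[of Q u]
  by (simp_all add: linear_form_add linear_form_scale linear_form_0 linear_form_sum)

lemma polar_minus_right: "quadratic_form Q \<Longrightarrow> polar Q u (- v) = - polar Q u v"
  using polar_scale_right[of Q u "-1" v] by simp

lemma polar_diff_right: "quadratic_form Q \<Longrightarrow> polar Q u (v - w) = polar Q u v - polar Q u w"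
  using polar_add_right[of Q u v "- w"] by (simp add: polar_minus_right)

lemma polar_add_left: "quadratic_form Q \<Longrightarrow> polar Q (v + w) u = polar Q v u + polar Q w u"
  and polar_scale_left: "quadratic_form Q \<Longrightarrow> polar Q (q *s v) u = q * polar Q v u"
  and polar_zero_left: "quadratic_form Q \<Longrightarrow> polar Q 0 u = 0"
  and polar_sum_left: "quadratic_form Q \<Longrightarrow> polar Q (\<Sum>k\<in>K. g k) u = (\<Sum>k\<in>K. polar Q (g k) u)"
  and polar_diff_left: "quadratic_form Q \<Longrightarrow> polar Q (v - w) u = polar Q v u - polar Q w u"
  by (simp_all add: polar_commute[of Q _ u] polar_add_right polar_scale_right polar_zero_right
      polar_sum_right polar_diff_right)

lemmas polar_bilinear = polar_add_right polar_scale_right polar_zero_right polar_sum_right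
  polar_diff_right polar_add_left polar_scale_left polar_zero_left polar_sum_left polar_diff_left

lemma sum_delta_mult:
  fixes g :: "nat \<Rightarrow> complex"
  shows "i < n \<Longrightarrow> (\<Sum>j<n. g j * (if j = i then 1 else 0)) = g i"
    and "i < n \<Longrightarrow> (\<Sum>j<n. g j * (if i = j then 1 else 0)) = g i"
  by (simp_all add: if_distrib[of "(*) _"] cong: if_cong)

text \<open>Nondegeneracy makes the map to the dual space injective, hence surjective in finite
  dimension; \<open>T\<close> is this map in coordinates.\<close>

lemma polar_represents:
  fixes Q :: "complex ^ 'v \<Rightarrow> complex"
  assumes Q: "quadratic_form Q" "nondegenerate Q" and \<psi>: "linear_form \<psi>"
  shows "\<exists>u. \<forall>v. polar Q u v = \<psi> v"
proof -
  define T :: "complex ^ 'v \<Rightarrow> complex ^ 'v" where "T = (\<lambda>u. \<chi> k. polar Q u (axis k 1))"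
  have lin: "linear_vec T"
    by (rule Vector_Spaces.linear_iff[THEN iffD2])
      (auto simp: vec.vector_space_axioms T_def vec_eq_iff polar_bilinear[OF Q(1)])
  have polar_eq: "polar Q u v = (\<Sum>k\<in>UNIV. T u $ k * v $ k)" for u v
    using linear_form_component[OF linear_polar[OF Q(1)], of u v] by (simp add: T_def)
  have "inj T"
    unfolding vec.linear_inj_iff_eq_0[OF lin]
  proof (intro allI impI)
    fix u assume "T u = 0"
    then have "polar Q u v = 0" for v by (simp add: polar_eq)
    then show "u = 0" using Q(2) by (simp add: nondegenerate_def)
  qed
  then have "surj T" using vec.linear_inj_imp_surj[OF lin] by blast
  then obtain u where "T u = (\<chi> k. \<psi> (axis k 1))" by (metis surjD)
  then have "polar Q u v = \<psi> v" for v
    unfolding polar_eq linear_form_component[OF \<psi>, of v] by simp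
  then show ?thesis by blast
qed

text \<open>The dual vectors are corrected by elements of \<open>W\<close> to become isotropic.\<close>

lemma isotropic_dual_basis:
  fixes Q :: "complex ^ 'v \<Rightarrow> complex"
  assumes Q: "quadratic_form Q" "nondegenerate Q" and W: "W \<in> isotropic_subspaces Q n"
  obtains E F where "W = vec.span (F ` {..<n})"
    "\<And>i j. \<lbrakk>i < n; j < n\<rbrakk> \<Longrightarrow> polar Q (F i) (F j) = 0"
    "\<And>i j. \<lbrakk>i < n; j < n\<rbrakk> \<Longrightarrow> polar Q (E i) (E j) = 0"
    "\<And>i j. \<lbrakk>i < n; j < n\<rbrakk> \<Longrightarrow> polar Q (E i) (F j) = (if i = j then 1 else 0)"
proof -
  have W': "vec.subspace W" "vec.dim W = n" "\<And>w. w \<in> W \<Longrightarrow> Q w = 0"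
    using W by (auto simp: isotropic_subspaces_def)
  obtain B where B: "B \<subseteq> W" "vec.independent B" "W \<subseteq> vec.span B" "card B = n"
    using vec.basis_exists[of W] W'(2) by metis
  have "finite B" using B(2) by (rule vec.finiteI_independent)
  then obtain F where F: "bij_betw F {0..<card B} B" using ex_bij_betw_nat_finite by blast
  then have F: "F ` {..<n} = B" "inj_on F {..<n}"
    unfolding bij_betw_def B(4) atLeast0LessThan by blast+
  have spanW: "W = vec.span (F ` {..<n})"
    unfolding F using B W'(1) vec.span_minimal by blast
  have FF: "polar Q (F i) (F j) = 0" if "i < n" "j < n" for i j
  proof -
    have "F i \<in> W" "F j \<in> W" using F B that by auto
    then show ?thesis using W' vec.subspace_add[OF W'(1)] by (simp add: polar_def)
  qed
  define B' where "B' = vec.extend_basis B"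
  have B': "vec.independent B'" "vec.span B' = UNIV" "B \<subseteq> B'"
    unfolding B'_def using B(2) by (simp_all add: vec.independent_extend_basis vec.span_extend_basis vec.extend_basis_superset)
  have "\<exists>g. \<forall>j<n. polar Q g (F j) = (if i = j then 1 else 0)" if i: "i < n" for i
  proof -
    \<comment> \<open>The coordinate along \<open>F i\<close> in a basis of \<open>V\<close> that
      contains all the \<open>F j\<close>.\<close>
    let ?\<psi> = "\<lambda>x. vec.representation B' x (F i)"
    have "linear_form ?\<psi>"
      by (rule Vector_Spaces.linear_iff[THEN iffD2])
        (auto simp: vec.vector_space_axioms vector_space_def algebra_simps
          vec.representation_add[OF B'(1)] vec.representation_scale[OF B'(1)] B'(2))
    then obtain g where g: "\<And>v. polar Q g v = ?\<psi> v" using polar_represents[OF Q] by blast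
    have "?\<psi> (F j) = (if i = j then 1 else 0)" if "j < n" for j
    proof -
      have "F j \<in> B'" using F(1) B'(3) that by auto
      then have "?\<psi> (F j) = (if F i = F j then 1 else 0)"
        using vec.representation_basis[OF B'(1), of "F j"] by simp
      then show ?thesis using i that inj_on_eq_iff[OF F(2), of i j] by simp
    qed
    then show ?thesis using g by (intro exI[of _ g]) simp
  qed
  then obtain g where g: "\<And>i j. \<lbrakk>i < n; j < n\<rbrakk> \<Longrightarrow> polar Q (g i) (F j) = (if i = j then 1 else 0)"
    by metis
  have Fg: "polar Q (F j) (g i) = (if i = j then 1 else 0)" if "i < n" "j < n" for i j
    using g[OF that] by (simp add: polar_commute)
  \<comment> \<open>The correction is half of the Gram matrix of the \<open>g i\<close>: in
    \<open>polar Q (E i) (E k)\<close> each argument contributes one half, and by symmetry they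
    cancel the whole. Pairings with the \<open>F j\<close> do not change, as these are mutually
    orthogonal.\<close>
  define E where "E = (\<lambda>i. g i - (\<Sum>j<n. (polar Q (g i) (g j) / 2) *s F j))"
  have EF: "polar Q (E i) (F j) = (if i = j then 1 else 0)" if "i < n" "j < n" for i j
    using that by (simp add: E_def polar_bilinear[OF Q(1)] g FF)
  have "polar Q (E i) (E k) = 0" if ik: "i < n" "k < n" for i k
  proof -
    have "polar Q (E i) (E k) = polar Q (E i) (g k) - (\<Sum>j<n. polar Q (g k) (g j) / 2 * polar Q (E i) (F j))"
    proof -
      have "E k = g k - (\<Sum>j<n. (polar Q (g k) (g j) / 2) *s F j)" by (simp add: E_def)
      then show ?thesis by (simp add: polar_bilinear[OF Q(1)])
    qed
    also have "(\<Sum>j<n. polar Q (g k) (g j) / 2 * polar Q (E i) (F j)) =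
        (\<Sum>j<n. polar Q (g k) (g j) / 2 * (if i = j then 1 else 0))"
      using ik by (intro sum.cong) (auto simp: EF)
    also have "\<dots> = polar Q (g k) (g i) / 2"
      by (rule sum_delta_mult(2)[OF ik(1)])
    also have "polar Q (E i) (g k) = polar Q (g i) (g k) - (\<Sum>j<n. polar Q (g i) (g j) / 2 * polar Q (F j) (g k))"
      unfolding E_def by (simp add: polar_bilinear[OF Q(1)])
    also have "(\<Sum>j<n. polar Q (g i) (g j) / 2 * polar Q (F j) (g k)) =
        (\<Sum>j<n. polar Q (g i) (g j) / 2 * (if k = j then 1 else 0))"
      using ik by (intro sum.cong) (auto simp: Fg)
    also have "\<dots> = polar Q (g i) (g k) / 2"
      by (rule sum_delta_mult(2)[OF ik(2)])
    finally show ?thesis by (simp add: polar_commute[of Q "g k"])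
  qed
  then show ?thesis using that[OF spanW FF _ EF] by blast
qed

lemma sum_lessThan_double: "(\<Sum>k<n + n'. g k) = (\<Sum>k<n. g k) + (\<Sum>k<n'. g (n + k))"
  for g :: "nat \<Rightarrow> 'a::comm_monoid_add"
  by (induction n') (simp_all add: add.assoc)

lemma ex_enumeration_pairs:
  fixes n :: nat
  shows "\<exists>a b :: nat \<Rightarrow> nat. bij_betw (\<lambda>k. (a k, b k)) {..<n * (n - 1) div 2} {(i, j). i < j \<and> j < n}"
proof -
  let ?S = "{(i, j). i < j \<and> j < n}"
  have S: "?S = prod.swap ` (SIGMA j:{..<n}. {..<j})" by auto
  have sum: "\<Sum>{..<n} = n * (n - 1) div 2" for n :: nat
  proof (induction n)
    case (Suc n)
    have "Suc n * (Suc n - 1) = n * (n - 1) + n * 2" by (cases n) simp_all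
    then have "Suc n * (Suc n - 1) div 2 = n * (n - 1) div 2 + n" by simp
    then show ?case using Suc by simp
  qed simp
  have "card ?S = card (SIGMA j:{..<n}. {..<j})"
    unfolding S by (intro card_image) (auto intro: inj_onI)
  also have "\<dots> = n * (n - 1) div 2"
    using sum by (simp add: card_SigmaI)
  finally have card: "card ?S = n * (n - 1) div 2" .
  have "finite ?S" unfolding S by auto
  then obtain h where h: "bij_betw h {0..<n * (n - 1) div 2} ?S"
    using ex_bij_betw_nat_finite[of ?S] card by metis
  then show ?thesis
    by (intro exI[of _ "fst \<circ> h"] exI[of _ "snd \<circ> h"]) (simp add: atLeast0LessThan)
qed

lemma continuous_on_scale_vec:
  "continuous_on S g \<Longrightarrow> continuous_on S h \<Longrightarrow> continuous_on S (\<lambda>s. g s *s h s :: complex ^ 'v)"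
  unfolding vector_scalar_mult_def by (intro continuous_on_vec_lambda continuous_intros)

lemma continuous_on_linear_vec:
  assumes "linear_vec L"
  shows "continuous_on S L"
proof -
  have "continuous_on S (\<lambda>x. \<chi> k. \<Sum>j\<in>UNIV. matrix L $ k $ j * x $ j)"
    by (intro continuous_on_vec_lambda continuous_intros)
  also have "(\<lambda>x. \<chi> k. \<Sum>j\<in>UNIV. matrix L $ k $ j * x $ j) = L"
    by (simp add: fun_eq_iff vec_eq_iff linear_vec_component[OF assms])
  finally show ?thesis .
qed

section \<open>Topology of the isotropic Grassmannian\<close>

lemma topspace_isotropic_grassmannian:
  "topspace (isotropic_grassmannian Q n) = isotropic_subspaces Q n"
proof (rule subset_antisym)
  show "topspace (isotropic_grassmannian Q n) \<subseteq> isotropic_subspaces Q n"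
    using openin_isotropic_grassmannian[of Q n "topspace (isotropic_grassmannian Q n)"] by simp
  have "{b \<in> isotropic_frames Q n. vec.span (b ` {..<n}) \<in> isotropic_subspaces Q n} = isotropic_frames Q n"
    by (auto simp: isotropic_frames_def)
  then have "openin (isotropic_grassmannian Q n) (isotropic_subspaces Q n)"
    by (simp add: openin_isotropic_grassmannian)
  then show "isotropic_subspaces Q n \<subseteq> topspace (isotropic_grassmannian Q n)"
    by (rule openin_subset)
qed

text \<open>Paths of subspaces will be shown continuous by lifting them to frames.\<close>

lemma continuous_map_span_frame:
  "continuous_map (top_of_set (isotropic_frames Q n)) (isotropic_grassmannian Q n)
    (\<lambda>b. vec.span (b ` {..<n}))"
  unfolding continuous_map_def topspace_isotropic_grassmannian
  by (auto simp: openin_isotropic_grassmannian isotropic_frames_def)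

text \<open>A hyperbolic frame adapted to the chosen point: the \<open>\<f> i\<close> span its
  isotropic subspace, the \<open>\<e> i\<close> an isotropic complement. Through
  \<open>embedding\<close> the spinor line of the point supplies the vacuum of a Fock space.\<close>

locale spinor_chart =
  fixes n m :: nat
    and Q :: "complex ^ 'v \<Rightarrow> complex"
    and c :: "complex ^ 'v \<Rightarrow> complex ^ 's \<Rightarrow> complex ^ 's"
    and \<e> \<f> :: "nat \<Rightarrow> complex ^ 'v"
    and \<phi>\<^sub>0 :: "complex ^ 's"
    and a b :: "nat \<Rightarrow> nat"
  assumes card_V: "CARD('v) = 2 * n"
    and quadratic: "quadratic_form Q"
    and linear_c: "linear_vec (c v)"
    and linear_c_left: "linear_vec (\<lambda>v. c v x)"
    and c_square: "c v (c v x) = Q v *s x"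
    and polar_ff: "\<lbrakk>i < n; j < n\<rbrakk> \<Longrightarrow> polar Q (\<f> i) (\<f> j) = 0"
    and polar_ee: "\<lbrakk>i < n; j < n\<rbrakk> \<Longrightarrow> polar Q (\<e> i) (\<e> j) = 0"
    and polar_ef: "\<lbrakk>i < n; j < n\<rbrakk> \<Longrightarrow> polar Q (\<e> i) (\<f> j) = (if i = j then 1 else 0)"
    and embedding: "spinor_embedding c (vec.span (\<f> ` {..<n})) = vec.span {\<phi>\<^sub>0}"
    and nonzero: "\<phi>\<^sub>0 \<noteq> 0"
    and pair_bij: "bij_betw (\<lambda>k. (a k, b k)) {..<m} {(i, j). i < j \<and> j < n}"
begin

lemmas c_linear = vec.linear_add[OF linear_c] vec.linear_scale[OF linear_c]
  vec.linear_0[OF linear_c] vec.linear_neg[OF linear_c] vec.linear_diff[OF linear_c]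
  vec.linear_sum[OF linear_c]

lemmas c_linear_left = vec.linear_add[OF linear_c_left] vec.linear_scale[OF linear_c_left]
  vec.linear_0[OF linear_c_left] vec.linear_neg[OF linear_c_left] vec.linear_diff[OF linear_c_left]
  vec.linear_sum[OF linear_c_left]

lemma clifford: "c u (c v x) = polar Q u v *s x - c v (c u x)"
proof -
  have "c (u + v) (c (u + v) x) = Q (u + v) *s x" by (rule c_square)
  then have "Q u *s x + c u (c v x) + (c v (c u x) + Q v *s x) = Q (u + v) *s x"
    by (simp add: c_linear c_linear_left c_square add.assoc add.left_commute)
  then show ?thesis by (simp add: polar_def vec.scale_left_diff_distrib algebra_simps)
qed

lemma annihilator_span:
  assumes "\<And>v. v \<in> S \<Longrightarrow> c v x = 0" "w \<in> vec.span S"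
  shows "c w x = 0"
  using assms(2) by (induction rule: vec.span_induct_alt) (simp_all add: c_linear_left assms(1))

sublocale fock_space n m "\<lambda>i. c (\<e> i)" "\<lambda>i. c (\<f> i)" \<phi>\<^sub>0 a b
proof
  show "c (\<e> i) (c (\<e> j) x) = - c (\<e> j) (c (\<e> i) x)" if "i < n" "j < n" for i j x
    using clifford[of "\<e> i" "\<e> j" x] that by (simp add: polar_ee)
  show "c (\<f> i) (c (\<f> j) x) = - c (\<f> j) (c (\<f> i) x)" if "i < n" "j < n" for i j x
    using clifford[of "\<f> i" "\<f> j" x] that by (simp add: polar_ff)
  show "c (\<f> i) (c (\<e> j) x) = (if i = j then x else 0) - c (\<e> j) (c (\<f> i) x)" if "i < n" "j < n" for i j x
    using clifford[of "\<f> i" "\<e> j" x] that by (simp add: polar_commute[of Q "\<f> i"] polar_ef)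
  have "\<phi>\<^sub>0 \<in> spinor_embedding c (vec.span (\<f> ` {..<n}))"
    unfolding embedding by (simp add: vec.span_base)
  then show "c (\<f> i) \<phi>\<^sub>0 = 0" if "i < n" for i
    using that by (auto simp: spinor_embedding_def vec.span_base)
  show "\<exists>q. x = q *s \<phi>\<^sub>0" if "\<And>i. i < n \<Longrightarrow> c (\<f> i) x = 0" for x
  proof -
    have "x \<in> spinor_embedding c (vec.span (\<f> ` {..<n}))"
      unfolding spinor_embedding_def using annihilator_span[of "\<f> ` {..<n}"] that by blast
    then show ?thesis unfolding embedding by (auto simp: vec.span_singleton)
  qed
qed (simp_all add: c_linear nonzero pair_bij)

lemma polar_fe: "\<lbrakk>i < n; j < n\<rbrakk> \<Longrightarrow> polar Q (\<f> i) (\<e> j) = (if i = j then 1 else 0)"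
  using polar_ef[of j i] by (auto simp: polar_commute)

lemma polar_combination:
  assumes "j < n"
  shows "polar Q (\<Sum>i<n. p i *s \<e> i + q i *s \<f> i) (\<f> j) = p j"
    and "polar Q (\<Sum>i<n. p i *s \<e> i + q i *s \<f> i) (\<e> j) = q j"
proof -
  have "polar Q (\<Sum>i<n. p i *s \<e> i + q i *s \<f> i) (\<f> j) = (\<Sum>i<n. p i * (if i = j then 1 else 0))"
    unfolding polar_sum_left[OF quadratic] using assms
    by (intro sum.cong) (auto simp: polar_bilinear[OF quadratic] polar_ef polar_ff)
  then show "polar Q (\<Sum>i<n. p i *s \<e> i + q i *s \<f> i) (\<f> j) = p j"
    unfolding sum_delta_mult(1)[OF assms] .
  have "polar Q (\<Sum>i<n. p i *s \<e> i + q i *s \<f> i) (\<e> j) = (\<Sum>i<n. q i * (if i = j then 1 else 0))"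
    unfolding polar_sum_left[OF quadratic] using assms
    by (intro sum.cong) (auto simp: polar_bilinear[OF quadratic] polar_ee polar_fe)
  then show "polar Q (\<Sum>i<n. p i *s \<e> i + q i *s \<f> i) (\<e> j) = q j"
    unfolding sum_delta_mult(1)[OF assms] .
qed

text \<open>Each of the two families reads off the coefficients of the other, so the
  \<open>2 * n\<close> vectors are independent, and by \<open>card_V\<close> they form a
  basis.\<close>

lemma witt_expansion: "v = (\<Sum>i<n. polar Q v (\<f> i) *s \<e> i + polar Q v (\<e> i) *s \<f> i)"
proof -
  define z where "z = (\<lambda>k. if k < n then \<e> k else \<f> (k - n))"
  have sum: "(\<Sum>k<n + n. p k *s z k) = (\<Sum>i<n. p i *s \<e> i + p (n + i) *s \<f> i)" for p
    unfolding sum_lessThan_double by (simp add: z_def sum.distrib)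
  have ind: "\<forall>k<n + n. p k = 0" if "(\<Sum>k<n + n. p k *s z k) = 0" for p
  proof (intro allI impI)
    fix k assume k: "k < n + n"
    have 0: "(\<Sum>i<n. p i *s \<e> i + p (n + i) *s \<f> i) = 0" using that unfolding sum .
    have "p j = 0" "p (n + j) = 0" if "j < n" for j
      using polar_combination[OF that, of p "\<lambda>i. p (n + i)"] unfolding 0
      by (simp_all add: polar_bilinear[OF quadratic])
    from this(1)[of k] this(2)[of "k - n"] show "p k = 0"
      using k by (cases "k < n") auto
  qed
  note fam = independent_family[of z "n + n", OF ind]
  have "vec.span (z ` {..<n + n}) = UNIV"
    using fam(3) card_V
    by (intro vec.subspace_dim_equal) (simp_all add: vec_dim_card del: vec.dim_UNIV)
  then have "v \<in> vec.span (z ` {..<n + n})" by simp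
  from span_image_lessThan[OF fam(1) this] obtain p where
    v: "v = (\<Sum>i<n. p i *s \<e> i + p (n + i) *s \<f> i)" unfolding sum by blast
  have "polar Q v (\<f> i) = p i" "polar Q v (\<e> i) = p (n + i)" if "i < n" for i
    unfolding v using polar_combination[OF that, of p "\<lambda>i. p (n + i)"] by simp_all
  then have "(\<Sum>i<n. polar Q v (\<f> i) *s \<e> i + polar Q v (\<e> i) *s \<f> i) =
      (\<Sum>i<n. p i *s \<e> i + p (n + i) *s \<f> i)"
    by (intro sum.cong) auto
  then show ?thesis using v by simp
qed

text \<open>These span the graph of a skew-symmetric matrix with entries \<open>t k\<close> up to
  sign, as a map from the span of the \<open>\<f> i\<close> to that of the \<open>\<e> i\<close>.
  The signs are those for which the vectors annihilate \<open>pure t\<close>.\<close>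

definition graph_vector :: "(nat \<Rightarrow> complex) \<Rightarrow> nat \<Rightarrow> complex ^ 'v"
  where "graph_vector t i = \<f> i -
    (\<Sum>k<m. t k *s ((if i = a k then \<e> (b k) else 0) - (if i = b k then \<e> (a k) else 0)))"

definition graph :: "(nat \<Rightarrow> complex) \<Rightarrow> (complex ^ 'v) set"
  where "graph t = vec.span (graph_vector t ` {..<n})"

lemma c_graph_vector: "c (graph_vector t i) x = c (\<f> i) x - (\<Sum>k<m. t k *s comm i k x)"
  by (simp add: graph_vector_def c_linear_left comm_def if_distrib[of "\<lambda>v. c v x"] cong: if_cong)

lemma spinor_embedding_graph: "spinor_embedding c (graph t) = vec.span {pure t}"
proof (rule subset_antisym)
  show "vec.span {pure t} \<subseteq> spinor_embedding c (graph t)"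
  proof
    fix x assume "x \<in> vec.span {pure t}"
    then obtain q where x: "x = q *s pure t" by (auto simp: vec.span_singleton)
    have "c (graph_vector t i) (pure t) = 0" if "i < n" for i
      using f_pure[OF that, of t] by (simp add: c_graph_vector)
    then have "c w (pure t) = 0" if "w \<in> graph t" for w
      using annihilator_span[of "graph_vector t ` {..<n}" "pure t" w] that by (auto simp: graph_def)
    then show "x \<in> spinor_embedding c (graph t)"
      by (simp add: spinor_embedding_def x c_linear)
  qed
  show "spinor_embedding c (graph t) \<subseteq> vec.span {pure t}"
  proof
    fix x assume x: "x \<in> spinor_embedding c (graph t)"
    have "c (\<f> i) x = (\<Sum>k<m. t k *s comm i k x)" if "i < n" for i
    proof -
      have "graph_vector t i \<in> graph t" using that by (auto simp: graph_def intro: vec.span_base)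
      then have "c (graph_vector t i) x = 0" using x by (simp add: spinor_embedding_def)
      then show ?thesis by (simp add: c_graph_vector)
    qed
    then show "x \<in> vec.span {pure t}" using pure_unique[of x t] by (auto simp: vec.span_singleton)
  qed
qed

lemma pure_nonzero: "pure t \<noteq> 0"
proof
  assume "pure t = 0"
  then have "\<kappa> (pure t) = \<kappa> 0" by (rule arg_cong)
  then show False by simp
qed

text \<open>Isotropy is read off from the spinor: applying \<open>c w\<close> twice to
  \<open>pure t\<close> gives zero and also \<open>Q w\<close> times a nonzero vector. The dimension
  follows from pairing with the \<open>\<e> j\<close>.\<close>

lemma graph_isotropic: "graph t \<in> isotropic_subspaces Q n"
  unfolding isotropic_subspaces_def
proof (intro CollectI conjI ballI)
  show "vec.subspace (graph t)" by (simp add: graph_def)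
  have e: "polar Q (graph_vector t i) (\<e> j) = (if i = j then 1 else 0)" if "i < n" "j < n" for i j
  proof -
    have "polar Q ((if i = a k then \<e> (b k) else 0) - (if i = b k then \<e> (a k) else 0)) (\<e> j) = 0" if "k < m" for k
      using pair_less[OF that] \<open>j < n\<close> by (simp add: polar_bilinear[OF quadratic] polar_ee)
    then show ?thesis using that by (simp add: graph_vector_def polar_bilinear(6-)[OF quadratic] polar_fe
        del: polar_diff_left)
  qed
  have "\<forall>j<n. q j = 0" if q: "(\<Sum>i<n. q i *s graph_vector t i) = 0" for q
  proof (intro allI impI)
    fix j assume j: "j < n"
    have "polar Q (\<Sum>i<n. q i *s graph_vector t i) (\<e> j) = (\<Sum>i<n. q i * (if i = j then 1 else 0))"
      unfolding polar_sum_left[OF quadratic] using j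
      by (intro sum.cong) (auto simp: polar_scale_left[OF quadratic] e)
    then show "q j = 0" unfolding q sum_delta_mult(1)[OF j] by (simp add: polar_zero_left[OF quadratic])
  qed
  from independent_family(3)[OF this] show "vec.dim (graph t) = n" unfolding graph_def .
  fix w assume "w \<in> graph t"
  then have "c w (pure t) = 0"
    using spinor_embedding_graph[of t] vec.span_base[of "pure t" "{pure t}"]
    by (auto simp: spinor_embedding_def)
  then have "Q w *s pure t = 0" using c_square[of w "pure t"] by (simp add: c_linear)
  then show "Q w = 0" using pure_nonzero by simp
qed

lemma graph_0: "graph (\<lambda>_. 0) = vec.span (\<f> ` {..<n})"
  by (simp add: graph_def graph_vector_def)

text \<open>Scaling \<open>t\<close> by a factor from 0 to 1 gives a path from the span of the
  \<open>\<f> i\<close> to the graph, continuous because it lifts to frames.\<close>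

lemma graph_in_component:
  assumes C: "C \<in> connected_components_of (isotropic_grassmannian Q n)"
    and W: "vec.span (\<f> ` {..<n}) \<in> C"
  shows "graph t \<in> C"
proof -
  \<comment> \<open>The value 0 from the index \<open>n\<close> on puts the frame into
    \<open>tuples n\<close>.\<close>
  define \<gamma> where "\<gamma> = (\<lambda>s i. if i < n then graph_vector (\<lambda>k. of_real s * t k) i else 0)"
  have \<gamma>_span: "vec.span (\<gamma> s ` {..<n}) = graph (\<lambda>k. of_real s * t k)" for s
    unfolding graph_def \<gamma>_def by (rule arg_cong[where f = vec.span], rule image_cong) auto
  have "continuous_on {0..1} \<gamma>"
  proof (rule continuous_on_coordinatewise_then_product)
    fix i
    show "continuous_on {0..1} (\<lambda>s. \<gamma> s i)"
      unfolding \<gamma>_def graph_vector_def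
      by (cases "i < n") (auto intro!: continuous_on_diff continuous_on_sum continuous_on_scale_vec continuous_intros)
  qed
  moreover have "\<gamma> s \<in> isotropic_frames Q n" for s
    using graph_isotropic[of "\<lambda>k. of_real s * t k"]
    by (simp add: isotropic_frames_def \<gamma>_span tuples_def) (simp add: \<gamma>_def)
  ultimately have "continuous_map (top_of_set {0..1}) (top_of_set (isotropic_frames Q n)) \<gamma>"
    by auto
  from continuous_map_compose[OF this continuous_map_span_frame]
  have cont: "continuous_map (top_of_set {0..1}) (isotropic_grassmannian Q n) (\<lambda>s. graph (\<lambda>k. of_real s * t k))"
    by (simp add: comp_def \<gamma>_span)
  have "connectedin (top_of_set {0..1::real}) {0..1}"
    by (simp add: connectedin_subtopology)
  from connectedin_continuous_map_image[OF cont this]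
  have conn: "connectedin (isotropic_grassmannian Q n) ((\<lambda>s. graph (\<lambda>k. of_real s * t k)) ` {0..1})" .
  have "graph (\<lambda>_. 0) \<in> (\<lambda>s. graph (\<lambda>k. of_real s * t k)) ` {0..1}"
    by (rule image_eqI[of _ _ 0]) auto
  then have "\<not> disjnt C ((\<lambda>s. graph (\<lambda>k. of_real s * t k)) ` {0..1})"
    using W unfolding graph_0 disjnt_def by blast
  then have "(\<lambda>s. graph (\<lambda>k. of_real s * t k)) ` {0..1} \<subseteq> C"
    using connected_components_of_maximal[OF C conn] by (simp add: disjnt_sym)
  moreover have "graph t \<in> (\<lambda>s. graph (\<lambda>k. of_real s * t k)) ` {0..1}"
    by (rule image_eqI[of _ _ 1]) auto
  ultimately show ?thesis by blast
qed

lemma dim_span_f: "vec.dim (vec.span (\<f> ` {..<n})) = n"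
  using graph_isotropic[of "\<lambda>_. 0"] by (simp add: graph_0 isotropic_subspaces_def)

text \<open>
  Nonvanishing of \<open>\<kappa> x\<close> means that \<open>W\<close> is transverse to the span of the \<open>\<e> i\<close>.
\<close>

lemma pure_spinor_chart:
  assumes W: "W \<in> isotropic_subspaces Q n" and x: "x \<in> spinor_embedding c W" and \<kappa>: "\<kappa> x \<noteq> 0"
  shows "x = \<kappa> x *s pure (\<lambda>k. coord k x / \<kappa> x)"
proof -
  have ann: "c w x = 0" if "w \<in> W" for w
    using x that by (simp add: spinor_embedding_def)
  have sub: "vec.subspace W" and dim: "vec.dim W = n"
    using W by (auto simp: isotropic_subspaces_def)
  \<comment> \<open>The projection onto the span of the \<open>\<f> i\<close> along the span of the
    \<open>\<e> i\<close>.\<close>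
  define P where "P = (\<lambda>w. \<Sum>i<n. polar Q w (\<e> i) *s \<f> i)"
  have lin: "linear_vec P"
    unfolding P_def
    by (rule Vector_Spaces.linear_iff[THEN iffD2])
      (auto simp: vec.vector_space_axioms polar_bilinear[OF quadratic] vec.scale_left_distrib
        sum.distrib vec.scale_sum_right)
  have P_e: "polar Q (P w) (\<e> j) = polar Q w (\<e> j)" if "j < n" for w j
    using polar_combination(2)[OF that, of "\<lambda>_. 0" "\<lambda>i. polar Q w (\<e> i)"] by (simp add: P_def)
  have split: "w = (\<Sum>i<n. polar Q w (\<f> i) *s \<e> i) + P w" for w
    using witt_expansion[of w] by (simp add: P_def sum.distrib)
  \<comment> \<open>Such a vector is a combination of the \<open>\<e> i\<close> that annihilates
    \<open>x\<close>. Applying \<open>c (\<f> d)\<close> and then \<kappa> yields its coefficient at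
    \<open>\<e> d\<close> times \<open>\<kappa> x\<close>, which is nonzero.\<close>
  have ker: "w = 0" if w: "w \<in> W" "P w = 0" for w
  proof -
    have w_eq: "w = (\<Sum>i<n. polar Q w (\<f> i) *s \<e> i)" using split[of w] w(2) by simp
    have "(\<Sum>i<n. polar Q w (\<f> i) *s c (\<e> i) x) = c (\<Sum>i<n. polar Q w (\<f> i) *s \<e> i) x"
      by (simp add: c_linear_left)
    also have "\<dots> = 0" unfolding w_eq[symmetric] using ann[OF w(1)] .
    finally have 0: "(\<Sum>i<n. polar Q w (\<f> i) *s c (\<e> i) x) = 0" .
    have "polar Q w (\<f> d) = 0" if "d < n" for d
      using \<kappa>_f_sum_e[OF that, of "\<lambda>i. polar Q w (\<f> i)" x] \<kappa> that unfolding 0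
      by (simp add: c_linear)
    then have "(\<Sum>i<n. polar Q w (\<f> i) *s \<e> i) = 0" by (intro sum.neutral) auto
    then show ?thesis using w_eq by simp
  qed
  have "inj_on P W"
  proof (rule inj_onI)
    fix v w assume vw: "v \<in> W" "w \<in> W" "P v = P w"
    then have "P (v - w) = 0" by (simp add: vec.linear_diff[OF lin])
    then show "v = w" using ker[of "v - w"] vw vec.subspace_diff[OF sub] by simp
  qed
  moreover have spanW: "vec.span W = W" using sub by (simp add: vec.span_eq_iff)
  ultimately have "vec.dim (P ` W) = n" using vec.dim_image_eq[OF lin, of W] dim unfolding spanW by simp
  moreover have "P ` W \<subseteq> vec.span (\<f> ` {..<n})"
  proof (rule image_subsetI)
    show "P w \<in> vec.span (\<f> ` {..<n})" for w
      unfolding P_def by (rule vec.span_sum, rule vec.span_scale, rule vec.span_base) simp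
  qed
  ultimately have PW: "P ` W = vec.span (\<f> ` {..<n})"
    using dim_span_f vec.linear_subspace_image[OF lin sub] by (intro vec.subspace_dim_equal) auto
  \<comment> \<open>Lifting \<open>\<f> i\<close> through \<open>P\<close> to \<open>W\<close> gives
    an annihilator of \<open>x\<close> of the shape that \<open>pure_chart\<close> expects.\<close>
  have "\<exists>\<beta>. c (\<f> i) x + (\<Sum>d<n. \<beta> d *s c (\<e> d) x) = 0" if "i < n" for i
  proof -
    have "\<f> i \<in> P ` W" unfolding PW using that by (intro vec.span_base) auto
    then obtain w where w: "w \<in> W" "P w = \<f> i" by auto
    have "c ((\<Sum>d<n. polar Q w (\<f> d) *s \<e> d) + P w) x = 0"
      unfolding split[symmetric] using ann[OF w(1)] .
    then have "c (\<f> i) x + (\<Sum>d<n. polar Q w (\<f> d) *s c (\<e> d) x) = 0"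
      unfolding w(2) by (simp add: c_linear_left add.commute)
    then show ?thesis by (rule exI[of _ "\<lambda>d. polar Q w (\<f> d)"])
  qed
  then obtain B where "\<And>i. i < n \<Longrightarrow> c (\<f> i) x + (\<Sum>d<n. B i d *s c (\<e> d) x) = 0" by metis
  then show ?thesis by (rule pure_chart[OF \<kappa>])
qed

end

context fock_space
begin

lemma continuous_on_Exp: "set ks \<subseteq> {..<m} \<Longrightarrow> continuous_on S (\<lambda>t. Exp ks t x)"
proof (induction ks)
  case (Cons k ks)
  then have k: "k < m" and IH: "continuous_on S (\<lambda>t. Exp ks t x)" by auto
  have "continuous_on S (\<lambda>t. E k (Exp ks t x))"
    using continuous_on_compose[OF IH continuous_on_linear_vec[OF linear_E[OF k]]] by (simp add: comp_def)
  moreover have "continuous_on S (\<lambda>t. t k :: complex)"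
    by (rule continuous_on_subset[OF continuous_on_product_coordinates]) simp
  ultimately show ?case
    unfolding Exp_simps by (intro continuous_on_add continuous_on_scale_vec IH)
qed simp

lemma pure_deriv:
  assumes "i < m"
  shows "has_componentwise_deriv (\<lambda>z. pure (t(i := z))) (E i (pure (t(i := z)))) z"
proof -
  have "has_componentwise_deriv (\<lambda>z. pure (t(i := z)))
      (\<Sum>k<m. (if k = i then 1 else 0) *s E k (pure (t(i := z)))) z"
    by (rule has_componentwise_deriv_Exp_m) (auto simp: fun_upd_apply)
  also have "(\<Sum>k<m. (if k = i then 1 else 0) *s E k (pure (t(i := z)))) =
      (\<Sum>k<m. if k = i then E i (pure (t(i := z))) else 0)"
    by (intro sum.cong) auto
  also have "\<dots> = E i (pure (t(i := z)))" using assms by simp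
  finally show ?thesis .
qed

end

context spinor_chart
begin

section \<open>The half-spin module as the even part\<close>

definition parity_part :: "bool \<Rightarrow> (complex ^ 's) set"
  where "parity_part r = vec.span {foldr (\<lambda>i. c (\<e> i)) xs \<phi>\<^sub>0 | xs. set xs \<subseteq> {..<n} \<and> even (length xs) = r}"

lemma even_part_eq: "even_part = parity_part True"
  by (simp add: even_part_def parity_part_def)

lemma parity_part_foldr:
  "\<lbrakk>set xs \<subseteq> {..<n}; even (length xs) = r\<rbrakk> \<Longrightarrow> foldr (\<lambda>i. c (\<e> i)) xs \<phi>\<^sub>0 \<in> parity_part r"
  unfolding parity_part_def by (intro vec.span_base CollectI exI[of _ xs]) simp

lemma subspace_parity_part: "vec.subspace (parity_part r)"
  by (simp add: parity_part_def)

lemma parity_part_e: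
  assumes "x \<in> parity_part r" "i < n"
  shows "c (\<e> i) x \<in> parity_part (\<not> r)"
  using assms(1) unfolding parity_part_def[of r]
proof (induction rule: vec.span_induct_alt)
  case base
  show ?case using vec.subspace_0[OF subspace_parity_part] by (simp add: c_linear)
next
  case (step q x y)
  then obtain xs where xs: "x = foldr (\<lambda>i. c (\<e> i)) xs \<phi>\<^sub>0" "set xs \<subseteq> {..<n}" "even (length xs) = r"
    by blast
  have "c (\<e> i) x \<in> parity_part (\<not> r)"
    using parity_part_foldr[of "i # xs" "\<not> r"] xs assms(2) by auto
  then show ?case
    using step vec.subspace_add[OF subspace_parity_part] vec.subspace_scale[OF subspace_parity_part]
    by (simp add: c_linear)
qed

text \<open>An annihilator moves to the right through a word; it either removes a letter or reaches
  the vacuum and kills it.\<close>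

lemma parity_part_f:
  assumes "x \<in> parity_part r" "i < n"
  shows "c (\<f> i) x \<in> parity_part (\<not> r)"
proof -
  note sub = vec.subspace_add[OF subspace_parity_part] vec.subspace_scale[OF subspace_parity_part]
    vec.subspace_diff[OF subspace_parity_part] vec.subspace_0[OF subspace_parity_part]
  have foldr: "set xs \<subseteq> {..<n} \<Longrightarrow>
      c (\<f> i) (foldr (\<lambda>i. c (\<e> i)) xs \<phi>\<^sub>0) \<in> parity_part (\<not> even (length xs))" for xs
  proof (induction xs)
    case Nil
    then show ?case using assms(2) by (simp add: vacuum sub)
  next
    case (Cons j xs)
    then have j: "j < n" and xs: "set xs \<subseteq> {..<n}" by auto
    let ?y = "foldr (\<lambda>i. c (\<e> i)) xs \<phi>\<^sub>0"
    have "c (\<e> j) (c (\<f> i) ?y) \<in> parity_part (\<not> \<not> even (length xs))"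
      by (rule parity_part_e[OF Cons.IH[OF xs] j])
    moreover have "(if i = j then ?y else 0) \<in> parity_part (even (length xs))"
      using parity_part_foldr[OF xs] sub by simp
    ultimately have "(if i = j then ?y else 0) - c (\<e> j) (c (\<f> i) ?y) \<in> parity_part (even (length xs))"
      using sub by simp
    then show ?case using assms(2) j by (simp add: fe)
  qed
  show ?thesis
    using assms(1) unfolding parity_part_def[of r]
  proof (induction rule: vec.span_induct_alt)
    case base
    show ?case using sub by (simp add: c_linear)
  next
    case (step q x y)
    then obtain xs where xs: "x = foldr (\<lambda>i. c (\<e> i)) xs \<phi>\<^sub>0" "set xs \<subseteq> {..<n}" "even (length xs) = r"
      by blast
    then have "c (\<f> i) x \<in> parity_part (\<not> r)" using foldr[of xs] by simp
    then show ?case using step sub by (simp add: c_linear)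
  qed
qed

lemma parity_part_c:
  assumes "x \<in> parity_part r"
  shows "c v x \<in> parity_part (\<not> r)"
proof -
  have "c v x = c (\<Sum>i<n. polar Q v (\<f> i) *s \<e> i + polar Q v (\<e> i) *s \<f> i) x"
    using witt_expansion[of v] by simp
  also have "\<dots> = (\<Sum>i<n. polar Q v (\<f> i) *s c (\<e> i) x + polar Q v (\<e> i) *s c (\<f> i) x)"
    by (simp add: c_linear_left)
  also have "\<dots> \<in> parity_part (\<not> r)"
    using assms by (intro vec.subspace_sum vec.subspace_add vec.subspace_scale subspace_parity_part
        parity_part_e parity_part_f) auto
  finally show ?thesis .
qed

text \<open>Products of two vectors carry \<open>\<phi>\<^sub>0\<close> to all even words and
  preserve parity, so \<open>even_part\<close> is a nonzero submodule of \<Delta>; irreducibility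
  does the rest.\<close>

lemma half_spin_eq_even_part:
  assumes "half_spin c \<Delta>" "\<phi>\<^sub>0 \<in> \<Delta>"
  shows "\<Delta> = even_part"
proof -
  let ?F = "{c u \<circ> c v | u v. True}"
  have \<Delta>: "submodule ?F \<Delta>" "\<And>N. \<lbrakk>submodule ?F N; N \<subseteq> \<Delta>\<rbrakk> \<Longrightarrow> N = {0} \<or> N = \<Delta>"
    using assms(1) by (auto simp: half_spin_def irreducible_module_def)
  have sub: "vec.subspace \<Delta>" and act: "\<And>u v x. x \<in> \<Delta> \<Longrightarrow> c u (c v x) \<in> \<Delta>"
    using \<Delta>(1) unfolding submodule_def by fastforce+
  have "submodule ?F even_part"
    unfolding submodule_def even_part_eq
    using parity_part_c[OF parity_part_c] subspace_parity_part by fastforce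
  moreover have "even_part \<subseteq> \<Delta>"
    unfolding even_part_def
  proof (rule vec.span_minimal[OF _ sub], safe)
    fix xs assume "set xs \<subseteq> {..<n}" "even (length xs)"
    then show "foldr (\<lambda>i. c (\<e> i)) xs \<phi>\<^sub>0 \<in> \<Delta>"
      \<comment> \<open>Letters come off two at a time, since \<Delta> is stable only under products
        of two vectors.\<close>
      by (induction xs rule: induct_list012) (auto simp: assms(2) act)
  qed
  moreover have "\<phi>\<^sub>0 \<in> even_part"
    unfolding even_part_eq using parity_part_foldr[of "[]" True] by simp
  ultimately show ?thesis using \<Delta>(2) nonzero by blast
qed

section \<open>The spinor variety in its affine chart\<close>

lemma spinor_variety_chart:
  assumes "C \<subseteq> isotropic_subspaces Q n" "vec.span {x} \<in> spinor_variety c C" "\<kappa> x \<noteq> 0"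
  shows "x = \<kappa> x *s pure (\<lambda>k. coord k x / \<kappa> x)"
proof -
  obtain W where W: "W \<in> C" "vec.span {x} = spinor_embedding c W"
    using assms(2) by (auto simp: spinor_variety_def)
  have "x \<in> spinor_embedding c W" unfolding W(2)[symmetric] by (simp add: vec.span_base)
  then show ?thesis using pure_spinor_chart assms W(1) by blast
qed

text \<open>One inclusion is \<open>pure_spinor_chart\<close>; the other needs all graphs to lie in
  the same component \<open>C\<close>.\<close>

lemma affine_part_spinor_variety:
  assumes C: "C \<in> connected_components_of (isotropic_grassmannian Q n)"
    and W: "vec.span (\<f> ` {..<n}) \<in> C"
  shows "affine_part \<kappa> (spinor_variety c C) = pure ` tuples m"
proof (rule subset_antisym)
  have sub: "C \<subseteq> isotropic_subspaces Q n"
    using connected_components_of_subset[OF C] by (simp add: topspace_isotropic_grassmannian)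
  show "affine_part \<kappa> (spinor_variety c C) \<subseteq> pure ` tuples m"
  proof
    fix x assume x: "x \<in> affine_part \<kappa> (spinor_variety c C)"
    then have \<kappa>: "\<kappa> x = 1" by (simp add: affine_part_def)
    \<comment> \<open>Cutting off from \<open>m\<close> on lands in \<open>tuples m\<close> and
      leaves \<open>pure\<close> unchanged.\<close>
    let ?t = "\<lambda>k. if k < m then coord k x else 0"
    have "x = pure (\<lambda>k. coord k x)"
      using spinor_variety_chart[OF sub, of x] x \<kappa> by (simp add: affine_part_def)
    also have "\<dots> = pure ?t" by (rule Exp_cong) simp
    finally show "x \<in> pure ` tuples m" 
      by (rule image_eqI[where x = "?t" and f = pure]) (simp add: tuples_def)
  qed
  show "pure ` tuples m \<subseteq> affine_part \<kappa> (spinor_variety c C)"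
    using graph_in_component[OF C W] spinor_embedding_graph
    by (auto simp: affine_part_def spinor_variety_def)
qed

text \<open>Parametrizations exist, so the claim about all of them is not vacuous. The functions
  \<open>coord k\<close> give the continuous inverse and also detect the independence of the partial
  derivatives.\<close>

lemma local_parametrization_pure:
  assumes C: "C \<in> connected_components_of (isotropic_grassmannian Q n)"
    and W: "vec.span (\<f> ` {..<n}) \<in> C"
  shows "local_parametrization m (spinor_variety c C) (vec.span {\<phi>\<^sub>0}) \<kappa> (tuples m) pure"
  unfolding local_parametrization_def
proof (intro conjI ballI allI impI)
  show "linear_form \<kappa>" by (rule linear_\<kappa>)
  show "openin (top_of_set (tuples m)) (tuples m)" by simp
  show "(\<lambda>_. 0) \<in> tuples m" by (simp add: tuples_def)
  have "Exp ks (\<lambda>_. 0) x = x" for ks and x by (induction ks) auto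
  then show "vec.span {pure (\<lambda>_. 0)} = vec.span {\<phi>\<^sub>0}" by simp
  show "holomorphic_several m (tuples m) pure"
    unfolding holomorphic_several_def
  proof (intro conjI ballI allI impI)
    show "continuous_on (tuples m) pure" by (rule continuous_on_Exp) auto
    show "(\<lambda>z. pure (t(i := z)) $ k) field_differentiable at (t i)" if "i < m" for t i k
      using pure_deriv[OF that, of t "t i"]
      unfolding has_componentwise_deriv_def field_differentiable_def by blast
  qed
  show "openin (top_of_set (affine_part \<kappa> (spinor_variety c C))) (pure ` tuples m)"
    unfolding affine_part_spinor_variety[OF C W] by simp
  let ?\<psi> = "\<lambda>x k. if k < m then coord k x else 0"
  have \<psi>: "?\<psi> (pure t) = t" if "t \<in> tuples m" for t
    using that by (auto simp: tuples_def)
  have "homeomorphism (tuples m) (pure ` tuples m) pure ?\<psi>"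
  proof (rule homeomorphismI)
    show "continuous_on (tuples m) pure" by (rule continuous_on_Exp) auto
    show "continuous_on (pure ` tuples m) ?\<psi>"
    proof (rule continuous_on_coordinatewise_then_product)
      show "continuous_on (pure ` tuples m) (\<lambda>x. ?\<psi> x k)" for k
        using continuous_on_linear_form[OF linear_coord, of k] by (cases "k < m") auto
    qed
  qed (use \<psi> in \<open>auto simp: tuples_def\<close>)
  then show "\<exists>\<psi>. homeomorphism (tuples m) (pure ` tuples m) pure \<psi>" by blast
  fix t q i
  assume t: "t \<in> tuples m" and q: "(\<Sum>i<m. q i *s partial_deriv i pure t) = 0" and i: "i < m"
  have "partial_deriv j pure t = E j (pure t)" if "j < m" for j
    using pure_deriv[OF that, of t "t j"] by (intro partial_deriv_eqI) simp
  then have "(\<Sum>j<m. q j *s E j (pure t)) = 0" using q by simp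
  then have "coord i (\<Sum>j<m. q j *s E j (pure t)) = coord i 0" by (rule arg_cong)
  then show "q i = 0" using i by (simp add: coord_sum_E)
qed

lemma osculating_space_spinor_variety:
  assumes C: "C \<in> connected_components_of (isotropic_grassmannian Q n)"
    and \<phi>: "local_parametrization m (spinor_variety c C) (vec.span {\<phi>\<^sub>0}) l U \<phi>"
  shows "osculating_space m s \<phi> = projectivization (filtration s)"
proof -
  have sub: "C \<subseteq> isotropic_subspaces Q n"
    using connected_components_of_subset[OF C] by (simp add: topspace_isotropic_grassmannian)
  note \<phi>' = \<phi>[unfolded local_parametrization_def]
  have aff: "\<phi> t \<in> affine_part l (spinor_variety c C)" if "t \<in> U" for t
  proof -
    have "openin (top_of_set (affine_part l (spinor_variety c C))) (\<phi> ` U)" using \<phi>' by blast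
    then show ?thesis using that openin_imp_subset by blast
  qed
  have "vec.span (affine_osculating_space m s \<phi>) = filtration s"
  proof (rule span_affine_osculating_space_parametrization)
    show "linear_form l" "openin (top_of_set (tuples m)) U" "(\<lambda>_. 0) \<in> U"
      "vec.span {\<phi> (\<lambda>_. 0)} = vec.span {\<phi>\<^sub>0}" "holomorphic_several m U \<phi>"
      using \<phi>' by blast+
    show "l (\<phi> t) = 1" if "t \<in> U" for t
      using aff[OF that] by (simp add: affine_part_def)
    show "\<phi> t = \<kappa> (\<phi> t) *s pure (\<lambda>k. coord k (\<phi> t) / \<kappa> (\<phi> t))" if "t \<in> U" "\<kappa> (\<phi> t) \<noteq> 0" for t
      using aff[OF that(1)] that(2) by (intro spinor_variety_chart[OF sub]) (simp_all add: affine_part_def)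
    show "\<forall>i<m. q i = 0" if "(\<Sum>i<m. q i *s partial_deriv i \<phi> (\<lambda>_. 0)) = 0" for q
      using \<phi>' that by blast
  qed
  then show ?thesis by (simp add: osculating_space_def)
qed

end

text \<open>The lines in \<open>M\<close> cover \<open>M\<close>, except that there are none when
  \<open>M = {0}\<close>; passing to spans removes the exception.\<close>

lemma proj_dim_projectivization:
  assumes "vec.subspace M"
  shows "proj_dim (projectivization M) = int (vec.dim M) - 1"
proof -
  have "vec.span (\<Union>(projectivization M)) = M"
  proof (rule subset_antisym)
    show "vec.span (\<Union>(projectivization M)) \<subseteq> M"
      using assms by (intro vec.span_minimal) (auto simp: projectivization_def)
    show "M \<subseteq> vec.span (\<Union>(projectivization M))"
    proof
      fix x assume x: "x \<in> M"
      show "x \<in> vec.span (\<Union>(projectivization M))"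
      proof (cases "x = 0")
        case False
        then have "vec.dim (vec.span {x}) = 1"
          by (subst vec.dim_span_eq_card_independent) (auto simp: vec.dependent_single)
        then have "vec.span {x} \<in> projectivization M"
          using x assms by (simp add: projectivization_def vec.span_minimal)
        then show ?thesis by (meson UnionI singletonI vec.span_base)
      qed (simp add: vec.span_zero)
    qed
  qed
  then show ?thesis unfolding proj_dim_def by (metis vec.dim_span)
qed

theorem corollary3p25:
  fixes n :: nat
    and Q :: "complex ^ 'v \<Rightarrow> complex"
    and c :: "complex ^ 'v \<Rightarrow> complex ^ 's \<Rightarrow> complex ^ 's"
    and \<Delta> :: "(complex ^ 's) set"
    and C :: "(complex ^ 'v) set set"
    and p :: "(complex ^ 's) set"
  assumes "CARD('v) = 2 * n"
    and "quadratic_form Q" and "nondegenerate Q"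
    and "spin_representation Q c"
    and "half_spin c \<Delta>"
    and "C \<in> connected_components_of (isotropic_grassmannian Q n)"
    and "spinor_variety c C \<subseteq> projectivization \<Delta>"
    and "p \<in> spinor_variety c C"
  shows "(\<exists>l U \<phi>. local_parametrization (n * (n - 1) div 2) (spinor_variety c C) p l U \<phi>) \<and>
    (\<forall>l U \<phi>. local_parametrization (n * (n - 1) div 2) (spinor_variety c C) p l U \<phi> \<longrightarrow>
      (\<forall>s. (s < n div 2 \<longrightarrow>
              proj_dim (osculating_space (n * (n - 1) div 2) s \<phi>) =
                int (\<Sum>k=1..s. n choose (2 * k))) \<and>
           (n div 2 \<le> s \<longrightarrow>
              osculating_space (n * (n - 1) div 2) s \<phi> = projectivization \<Delta>))) \<and>
    proj_dim (projectivization \<Delta>) = 2 ^ (n - 1) - 1"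
proof -
  let ?m = "n * (n - 1) div 2"
  obtain W where W: "W \<in> C" "p = spinor_embedding c W"
    using assms(8) by (auto simp: spinor_variety_def)
  have "W \<in> isotropic_subspaces Q n"
    using W(1) connected_components_of_subset[OF assms(6)] by (auto simp: topspace_isotropic_grassmannian)
  then obtain E F where EF: "W = vec.span (F ` {..<n})"
    "\<And>i j. \<lbrakk>i < n; j < n\<rbrakk> \<Longrightarrow> polar Q (F i) (F j) = 0"
    "\<And>i j. \<lbrakk>i < n; j < n\<rbrakk> \<Longrightarrow> polar Q (E i) (E j) = 0"
    "\<And>i j. \<lbrakk>i < n; j < n\<rbrakk> \<Longrightarrow> polar Q (E i) (F j) = (if i = j then 1 else 0)"
    by (rule isotropic_dual_basis[OF assms(2,3)]) (rule that)
  \<comment> \<open>The inclusion of the variety in the projectivization of \<Delta> makes the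
    spinors of \<open>W\<close> a line.\<close>
  have p: "vec.subspace p" "vec.dim p = 1" "p \<subseteq> \<Delta>"
    using assms(7,8) by (auto simp: projectivization_def)
  obtain B where B: "B \<subseteq> p" "vec.independent B" "p \<subseteq> vec.span B" "card B = 1"
    using vec.basis_exists[of p] p(2) by metis
  then obtain \<phi>\<^sub>0 where \<phi>0: "B = {\<phi>\<^sub>0}" by (auto simp: card_1_singleton_iff)
  have span_p: "p = vec.span {\<phi>\<^sub>0}"
    using B \<phi>0 p(1) vec.span_minimal by blast
  have \<phi>0_nz: "\<phi>\<^sub>0 \<noteq> 0" using B(2) \<phi>0 by (auto simp: vec.dependent_single)
  obtain a b :: "nat \<Rightarrow> nat" where ab: "bij_betw (\<lambda>k. (a k, b k)) {..<?m} {(i, j). i < j \<and> j < n}"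
    using ex_enumeration_pairs by blast
  have spin: "linear_vec (c v)" "linear_vec (\<lambda>v. c v x)" "c v (c v x) = Q v *s x" for v x
    using assms(4) by (simp_all add: spin_representation_def)
  interpret spinor_chart n ?m Q c E F \<phi>\<^sub>0 a b
  proof (rule spinor_chart.intro)
    show "spinor_embedding c (vec.span (F ` {..<n})) = vec.span {\<phi>\<^sub>0}"
      using W(2) EF(1) span_p by simp
  qed (fact assms(1,2) spin EF(2-4) \<phi>0_nz ab)+
  \<comment> \<open>An index type has at least one element, so \<open>2 * n\<close> is
    positive.\<close>
  have n: "n > 0" using assms(1) zero_less_card_finite[where 'a = 'v] by simp
  have \<Delta>: "\<Delta> = even_part"
    using assms(5) B(1) p(3) \<phi>0 by (intro half_spin_eq_even_part) auto
  have "proj_dim (osculating_space ?m s \<phi>) = int (\<Sum>k=1..s. n choose (2 * k)) \<and>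
      (n div 2 \<le> s \<longrightarrow> osculating_space ?m s \<phi> = projectivization \<Delta>)"
    if "local_parametrization ?m (spinor_variety c C) p l U \<phi>" for l U \<phi> s
  proof -
    have osc: "osculating_space ?m s \<phi> = projectivization (filtration s)"
      using osculating_space_spinor_variety[OF assms(6)] that unfolding span_p .
    \<comment> \<open>The term for \<open>k = 0\<close> is 1 and cancels the shift from linear to
      projective dimension.\<close>
    have "vec.dim (filtration s) = 1 + (\<Sum>k=1..s. n choose (2 * k))"
      unfolding dim_filtration by (simp add: sum.atLeast_Suc_atMost)
    then have "proj_dim (osculating_space ?m s \<phi>) = int (\<Sum>k=1..s. n choose (2 * k))"
      unfolding osc proj_dim_projectivization[OF subspace_filtration] by simp
    then show ?thesis using osc \<Delta> filtration_eq_even_part by auto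
  qed
  moreover have "proj_dim (projectivization \<Delta>) = 2 ^ (n - 1) - 1"
    unfolding \<Delta> proj_dim_projectivization[OF subspace_even_part] using dim_even_part[OF n] by simp
  moreover have "local_parametrization ?m (spinor_variety c C) p \<kappa> (tuples ?m) pure"
    using local_parametrization_pure[OF assms(6)] W(1) unfolding EF(1) span_p by blast
  ultimately show ?thesis by blast
qed

end
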